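(* Let $d\ge2$, $0\le\gamma\le\frac12$, $\delta>\frac{d+2\gamma-1}{2}$, and let $T_{N,m}^{\delta,\gamma}$ ($N,m\in\mathbb N$) be the integral operators $$T_{N,m}^{\delta,\gamma}f(r)=\int_0^\infty K_{N,m}^{\delta,\gamma}(r,s)f(s)s^{d+2\gamma-1}\,ds$$ with the kernels $K_{N,m}^{\delta,\gamma}$ defined in the context. Then for any $1<p<\infty$ there is a constant $C$ independent of $N$ such that $$\Big\|\Big(\sum_{m=0}^\infty\sum_{j=1}^{d(m)}|T_{N,m}^{\delta,\gamma}f_{m,j}(r)|^2\Big)^{1/2}\Big\|_{L^p(\mathbb R^+,r^{d+2\gamma-1}dr)}\le C\Big\|\Big(\sum_{m=0}^\infty\sum_{j=1}^{d(m)}|f_{m,j}(r)|^2\Big)^{1/2}\Big\|_{L^p(\mathbb R^+,r^{d+2\gamma-1}dr)}$$ for every sequence of functions $f_{m,j}\in L^p(\mathbb R^+,r^{d+2\gamma-1}dr)$ ($m\ge0$, $1\le j\le d(m)$) for which the right-hand side is finite.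
   Context: $\mathbb N=\{0,1,2,\dots\}$ and $\mathbb R^+=(0,\infty)$. For a root system and multiplicity function on $\mathbb R^d$ with $\gamma=\sum_{\nu\in R_+}\kappa(\nu)$, $d(m)$ is the dimension of the space of spherical $h$-harmonics of degree $m$ on $\mathbf S^{d-1}$ (restrictions of homogeneous polynomials of degree $m$ annihilated by the Dunkl Laplacian); it depends only on $d$ and $m$: $d(m)=\binom{m+d-1}{d-1}-\binom{m+d-3}{d-1}$ (second term $0$ when $m<2$). The kernels depend only on $d,\delta,\gamma,N,m$. Binomial coefficients: $A_j^{a}=\binom{j+a}{j}=\prod_{i=1}^j\frac{a+i}{i}$. Hermite projection kernels on $\mathbb R^d$: for $r,s>0$, $u\in[-1,1]$, $\Phi_j(r,s;u)$ is defined by Mehler's formula, for $|w|<1$, $$\sum_{j=0}^\infty\Phi_j(r,s;u)w^j=\pi^{-d/2}(1-w^2)^{-d/2}\exp\Big(-\tfrac12\tfrac{1+w^2}{1-w^2}(r^2+s^2)+\tfrac{2w}{1-w^2}rsu\Big),$$ and the Hermite Cesàro kernel is $\sigma_N^{\delta,d}(r,s;u)=\frac1{A_N^\delta}\sum_{j=0}^NA_{N-j}^\delta\Phi_j(r,s;u)$. Normalized ultraspherical polynomials: for $\lambda>-\frac12$, $P_m^\lambda$ is the ultraspherical (Gegenbauer) polynomial of type $\lambda$ and degree $m$ normalized by $P_m^\lambda(1)=1$, i.e. $(1-u^2)^{\lambda-1/2}P_m^\lambda(u)=\frac{(-1)^m}{2^m(\lambda+1/2)_m}\frac{d^m}{du^m}\big((1-u^2)^{m+\lambda-1/2}\big)$,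 with $(a)_m=\Gamma(a+m)/\Gamma(a)$. With $\lambda=\frac d2+\gamma-1$ and $c_{d,\gamma}=\frac{2\pi^{(d-1)/2}}{\Gamma(\frac{d-1}{2}+\gamma)}$, the kernel is $$K_{N,m}^{\delta,\gamma}(r,s)=\frac{c_{d,\gamma}}{A_N^\delta}\sum_{j=0}^{[N/2]}A_j^{\gamma-1}A_{N-2j}^\delta\int_{-1}^1\sigma_{N-2j}^{\delta,d}(r,s;u)P_m^\lambda(u)(1-u^2)^{\lambda-1/2}\,du,$$ where $[\cdot]$ is the integer part. *)

theory Defs
  imports "HOL-Complex_Analysis.Complex_Analysis"
begin

definition cesaro_A :: "real \<Rightarrow> nat \<Rightarrow> real" where
  "cesaro_A a j = (real j + a) gchoose j"

lemma cesaro_A_eq_prod: "cesaro_A a j = (\<Prod>i=1..j. (a + real i) / real i)"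
proof -
  have "(\<Prod>i=0..<j. real j + a - real i) = (\<Prod>i=1..j. a + real i)"
    by (rule prod.reindex_bij_witness[of _ "\<lambda>i. j - i" "\<lambda>i. j - i"]) (auto simp: of_nat_diff)
  then show ?thesis
    unfolding cesaro_A_def gbinomial_prod_rev prod_dividef fact_prod by simp
qed


definition mehler :: "nat \<Rightarrow> real \<Rightarrow> real \<Rightarrow> real \<Rightarrow> real \<Rightarrow> real" where
  "mehler d r s u w =
     pi powr (- real d / 2) * (1 - w\<^sup>2) powr (- real d / 2) *
     exp (- (1 / 2) * ((1 + w\<^sup>2) / (1 - w\<^sup>2)) * (r\<^sup>2 + s\<^sup>2) + 2 * w / (1 - w\<^sup>2) * r * s * u)"

definition hermite_Phi :: "nat \<Rightarrow> nat \<Rightarrow> real \<Rightarrow> real \<Rightarrow> real \<Rightarrow> real" where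
  "hermite_Phi d j r s u =
     (THE a. \<forall>w. \<bar>w\<bar> < 1 \<longrightarrow> (\<lambda>j. a j * w ^ j) sums mehler d r s u w) j"

definition hermite_cesaro :: "real \<Rightarrow> nat \<Rightarrow> nat \<Rightarrow> real \<Rightarrow> real \<Rightarrow> real \<Rightarrow> real" where
  "hermite_cesaro \<delta> d N r s u =
     1 / cesaro_A \<delta> N * (\<Sum>j=0..N. cesaro_A \<delta> (N - j) * hermite_Phi d j r s u)"

lemma power_series_coeffs_unique:
  fixes a b :: "nat \<Rightarrow> real"
  assumes a: "\<And>w. \<bar>w\<bar> < 1 \<Longrightarrow> (\<lambda>j. a j * w ^ j) sums g w"
    and b: "\<And>w. \<bar>w\<bar> < 1 \<Longrightarrow> (\<lambda>j. b j * w ^ j) sums g w"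
  shows "a = b"
proof
  fix n
  let ?g = "\<lambda>w::real. 0::real"
  have z: "(\<lambda>j. (a j - b j) * (w - 0) ^ j) sums ?g w" if "norm (w - 0) < 1" for w
    using sums_diff[OF a[of w] b[of w]] that by (simp add: algebra_simps)
  show "a n = b n"
  proof (rule ccontr)
    assume ne: "a n \<noteq> b n"
    have "a 0 - b 0 = 0"
      using z[of 0] powser_sums_zero[of "\<lambda>j. a j - b j"] by (simp add: sums_unique2)
    with ne have "n > 0" by (cases n) auto
    with ne obtain t where "0 < t" "\<And>w. w \<in> cball 0 t - {0} \<Longrightarrow> ?g w \<noteq> 0"
      using powser_0_nonzero[of 1 0 "\<lambda>j. a j - b j" ?g n] z by auto
    from this(2)[of t] \<open>0 < t\<close> show False by simp
  qed
qed

lemma mehler_expansion_ex: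
  "\<exists>a. \<forall>w. \<bar>w\<bar> < 1 \<longrightarrow> (\<lambda>j. a j * w ^ j) sums mehler d r s u w"
proof -
  define F :: "complex \<Rightarrow> complex" where
    "F z = of_real (pi powr (- real d / 2)) * (1 - z\<^sup>2) powr of_real (- real d / 2) *
       exp (- (1 / 2) * ((1 + z\<^sup>2) / (1 - z\<^sup>2)) * of_real (r\<^sup>2 + s\<^sup>2)
            + 2 * z / (1 - z\<^sup>2) * of_real r * of_real s * of_real u)" for z
  have re: "Re (1 - z\<^sup>2) > 0" if "norm z < 1" for z :: complex
  proof -
    have "norm (z\<^sup>2) < 1" using that by (simp add: norm_power abs_square_less_1)
    then show ?thesis using abs_Re_le_cmod[of "z\<^sup>2"] by simp
  qed
  have "F holomorphic_on ball 0 1"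
    unfolding F_def
  proof (intro holomorphic_intros)
    fix z :: complex assume "z \<in> ball 0 1"
    then have "Re (1 - z\<^sup>2) > 0" using re by simp
    then show "1 - z\<^sup>2 \<notin> \<real>\<^sub>\<le>\<^sub>0" "1 - z\<^sup>2 \<noteq> 0" "1 - z\<^sup>2 \<noteq> 0"
      by (auto simp: complex_nonpos_Reals_iff)
  qed
  then have F: "(\<lambda>j. (deriv ^^ j) F 0 / fact j * (z - 0) ^ j) sums F z" if "z \<in> ball 0 1" for z
    by (rule holomorphic_power_series) (use that in auto)
  have "(\<lambda>j. Re ((deriv ^^ j) F 0 / fact j) * w ^ j) sums mehler d r s u w" if w: "\<bar>w\<bar> < 1" for w
  proof -
    have w2: "0 < 1 - w\<^sup>2" using w by (simp add: abs_square_less_1)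
    have pw: "(1 - (complex_of_real w)\<^sup>2) powr of_real (- real d / 2)
               = of_real ((1 - w\<^sup>2) powr (- real d / 2))"
      using w2 powr_of_real[of "1 - w\<^sup>2" "- real d / 2"] by simp
    have "F (of_real w) = of_real (mehler d r s u w)"
      unfolding F_def mehler_def pw by (simp flip: exp_of_real)
    with F[of "of_real w"] w have
      "(\<lambda>j. (deriv ^^ j) F 0 / fact j * of_real (w ^ j)) sums complex_of_real (mehler d r s u w)"
      by simp
    from sums_Re[OF this]
    show ?thesis unfolding Re_complex_of_real times_complex.sel by simp
  qed
  then show ?thesis
    by (intro exI[of _ "\<lambda>j. Re ((deriv ^^ j) F 0 / fact j)"] allI impI)
qed

lemma hermite_Phi_sums:
  assumes "\<bar>w\<bar> < 1"
  shows "(\<lambda>j. hermite_Phi d j r s u * w ^ j) sums mehler d r s u w"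
proof -
  let ?P = "\<lambda>a. \<forall>w. \<bar>w\<bar> < 1 \<longrightarrow> (\<lambda>j. a j * w ^ j) sums mehler d r s u w"
  obtain a where a: "?P a" using mehler_expansion_ex[of d r s u] ..
  have "b = a" if "?P b" for b
    by (rule power_series_coeffs_unique[of b "mehler d r s u" a]) (use that a in auto)
  with a have "\<exists>!a. ?P a" by (rule ex1I[of ?P])
  from theI'[of ?P, OF this] assms show ?thesis
    by (simp add: hermite_Phi_def)
qed


definition ultraspherical :: "real \<Rightarrow> nat \<Rightarrow> real poly" where
  "ultraspherical lam m = (THE P. \<forall>u\<in>{-1<..<1}.
     (1 - u\<^sup>2) powr (lam - 1 / 2) * poly P u =
       (-1) ^ m / (2 ^ m * pochhammer (lam + 1 / 2) m) *
       (deriv ^^ m) (\<lambda>v. (1 - v\<^sup>2) powr (real m + lam - 1 / 2)) u)"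

lemma rodrigues_derivs:
  "\<exists>q. poly q 1 = (-2) ^ k * (\<Prod>i<k. a - real i) \<and>
     (\<forall>u\<in>{-1<..<1}. (deriv ^^ k) (\<lambda>v. (1 - v\<^sup>2) powr a) u = (1 - u\<^sup>2) powr (a - real k) * poly q u)"
proof (induction k)
  case 0
  show ?case by (rule exI[of _ 1]) simp
next
  case (Suc k)
  then obtain q where q1: "poly q 1 = (-2) ^ k * (\<Prod>i<k. a - real i)"
    and q: "\<And>u. u \<in> {-1<..<1} \<Longrightarrow>
      (deriv ^^ k) (\<lambda>v. (1 - v\<^sup>2) powr a) u = (1 - u\<^sup>2) powr (a - real k) * poly q u"
    by blast
  define q' where "q' = [:1, 0, -1:] * pderiv q + [:0, -2 * (a - real k):] * q"
  have "(deriv ^^ Suc k) (\<lambda>v. (1 - v\<^sup>2) powr a) u = (1 - u\<^sup>2) powr (a - real (Suc k)) * poly q' u"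
    if u: "u \<in> {-1<..<1}" for u
  proof -
    have pos: "0 < 1 - u\<^sup>2" using u by (simp add: abs_square_less_1 abs_less_iff)
    have ev: "\<forall>\<^sub>F v in nhds u. (deriv ^^ k) (\<lambda>v. (1 - v\<^sup>2) powr a) v = (1 - v\<^sup>2) powr (a - real k) * poly q v"
      using eventually_nhds_in_open[OF open_greaterThanLessThan u] by eventually_elim (rule q)
    have "((\<lambda>v. (1 - v\<^sup>2) powr (a - real k) * poly q v) has_field_derivative
        (a - real k) * (1 - u\<^sup>2) powr (a - real k - 1) * (- 2 * u) * poly q u
          + (1 - u\<^sup>2) powr (a - real k) * poly (pderiv q) u) (at u)"
    proof (rule DERIV_mult'[THEN DERIV_cong])
      have "((\<lambda>v. 1 - v\<^sup>2) has_field_derivative (- 2 * u)) (at u)"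
        by (auto intro!: derivative_eq_intros)
      from DERIV_fun_powr[OF this pos, of "a - real k"]
      show "((\<lambda>v. (1 - v\<^sup>2) powr (a - real k)) has_field_derivative
          (a - real k) * (1 - u\<^sup>2) powr (a - real k - 1) * (- 2 * u)) (at u)"
        by simp
      show "(poly q has_field_derivative poly (pderiv q) u) (at u)"
        by (rule poly_DERIV)
    qed simp
    then have "deriv (\<lambda>v. (1 - v\<^sup>2) powr (a - real k) * poly q v) u =
        (a - real k) * (1 - u\<^sup>2) powr (a - real k - 1) * (- 2 * u) * poly q u
          + (1 - u\<^sup>2) powr (a - real k) * poly (pderiv q) u"
      by (rule DERIV_imp_deriv)
    also have "(1 - u\<^sup>2) powr (a - real k) = (1 - u\<^sup>2) powr (a - real (Suc k)) * (1 - u\<^sup>2)"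
      using pos powr_add[of "1 - u\<^sup>2" "a - real (Suc k)" 1] by (simp add: algebra_simps)
    also have "a - real k - 1 = a - real (Suc k)" by simp
    also have "(a - real k) * (1 - u\<^sup>2) powr (a - real (Suc k)) * (- 2 * u) * poly q u
        + (1 - u\<^sup>2) powr (a - real (Suc k)) * (1 - u\<^sup>2) * poly (pderiv q) u
        = (1 - u\<^sup>2) powr (a - real (Suc k)) * poly q' u"
      by (simp add: q'_def algebra_simps power2_eq_square)
    finally have "deriv (\<lambda>v. (1 - v\<^sup>2) powr (a - real k) * poly q v) u =
        (1 - u\<^sup>2) powr (a - real (Suc k)) * poly q' u" .
    with deriv_cong_ev[OF ev refl] show ?thesis by simp
  qed
  moreover have "poly q' 1 = (-2) ^ Suc k * (\<Prod>i<Suc k. a - real i)"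
    by (simp add: q'_def q1 algebra_simps)
  ultimately show ?case by (intro exI[of _ q'] conjI ballI)
qed

lemma ultraspherical_ex1:
  assumes "lam > - 1 / 2"
  shows "\<exists>!P. \<forall>u\<in>{-1<..<1}.
     (1 - u\<^sup>2) powr (lam - 1 / 2) * poly P u =
       (-1) ^ m / (2 ^ m * pochhammer (lam + 1 / 2) m) *
       (deriv ^^ m) (\<lambda>v. (1 - v\<^sup>2) powr (real m + lam - 1 / 2)) u"
    (is "\<exists>!P. ?R P")
    and "poly (ultraspherical lam m) 1 = 1"
proof -
  obtain q where q1: "poly q 1 = (-2) ^ m * (\<Prod>i<m. (real m + lam - 1 / 2) - real i)"
    and q: "\<And>u. u \<in> {-1<..<1} \<Longrightarrow> (deriv ^^ m) (\<lambda>v. (1 - v\<^sup>2) powr (real m + lam - 1 / 2)) u =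
        (1 - u\<^sup>2) powr (real m + lam - 1 / 2 - real m) * poly q u"
    using rodrigues_derivs[of m "real m + lam - 1 / 2"] by blast
  define P where "P = smult ((-1) ^ m / (2 ^ m * pochhammer (lam + 1 / 2) m)) q"
  have P: "?R P"
  proof
    fix u :: real assume "u \<in> {-1<..<1}"
    moreover have "real m + lam - 1 / 2 - real m = lam - 1 / 2" by simp
    ultimately show "(1 - u\<^sup>2) powr (lam - 1 / 2) * poly P u =
       (-1) ^ m / (2 ^ m * pochhammer (lam + 1 / 2) m) *
       (deriv ^^ m) (\<lambda>v. (1 - v\<^sup>2) powr (real m + lam - 1 / 2)) u"
      using q[of u] by (simp add: P_def)
  qed
  have uniq: "P1 = P2" if "?R P1" "?R P2" for P1 P2
  proof -
    have "poly (P1 - P2) u = 0" if "u \<in> {-1<..<1}" for u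
    proof -
      have "0 < 1 - u\<^sup>2" using that by (simp add: abs_square_less_1 abs_less_iff)
      moreover have "(1 - u\<^sup>2) powr (lam - 1 / 2) * poly P1 u = (1 - u\<^sup>2) powr (lam - 1 / 2) * poly P2 u"
        using \<open>?R P1\<close> \<open>?R P2\<close> \<open>u \<in> _\<close> by simp
      ultimately show ?thesis by simp
    qed
    then have "{-1<..<1} \<subseteq> {u. poly (P1 - P2) u = 0}" by blast
    moreover have "infinite {-1<..<(1::real)}" by simp
    ultimately have "infinite {u. poly (P1 - P2) u = 0}" by (rule infinite_super)
    then have "P1 - P2 = 0" using poly_roots_finite by blast
    then show ?thesis by simp
  qed
  show ex1: "\<exists>!P. ?R P" by (rule ex1I[of ?R, OF P]) (rule uniq[OF _ P])
  have "ultraspherical lam m = P"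
    unfolding ultraspherical_def by (rule the1_equality[of ?R, OF ex1 P])
  moreover have "(\<Prod>i<m. (real m + lam - 1 / 2) - real i) = pochhammer (lam + 1 / 2) m"
    unfolding pochhammer_prod
    by (rule prod.reindex_bij_witness[of _ "\<lambda>i. m - Suc i" "\<lambda>i. m - Suc i"])
       (auto simp: of_nat_diff algebra_simps)
  moreover have "pochhammer (lam + 1 / 2) m > 0"
    using assms by (intro pochhammer_pos) simp
  moreover have "(-1) ^ m * (-2) ^ m = (2::real) ^ m"
    by (simp flip: power_mult_distrib)
  ultimately show "poly (ultraspherical lam m) 1 = 1"
    by (simp add: P_def q1)
qed


definition dunkl_const :: "nat \<Rightarrow> real \<Rightarrow> real" where
  "dunkl_const d \<gamma> = 2 * pi powr ((real d - 1) / 2) / Gamma ((real d - 1) / 2 + \<gamma>)"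

definition dunkl_kernel :: "nat \<Rightarrow> real \<Rightarrow> real \<Rightarrow> nat \<Rightarrow> nat \<Rightarrow> real \<Rightarrow> real \<Rightarrow> real" where
  "dunkl_kernel d \<delta> \<gamma> N m r s =
     (let lam = real d / 2 + \<gamma> - 1 in
      dunkl_const d \<gamma> / cesaro_A \<delta> N *
      (\<Sum>j=0..N div 2. cesaro_A (\<gamma> - 1) j * cesaro_A \<delta> (N - 2 * j) *
         (LINT u:{-1..1}|lborel.
            hermite_cesaro \<delta> d (N - 2 * j) r s u * poly (ultraspherical lam m) u *
            (1 - u\<^sup>2) powr (lam - 1 / 2))))"

definition radial_measure :: "nat \<Rightarrow> real \<Rightarrow> real measure" where
  "radial_measure d \<gamma> =
     density (restrict_space lborel {0<..}) (\<lambda>r. ennreal (r powr (real d + 2 * \<gamma> - 1)))"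

definition dunkl_op ::
  "nat \<Rightarrow> real \<Rightarrow> real \<Rightarrow> nat \<Rightarrow> nat \<Rightarrow> (real \<Rightarrow> complex) \<Rightarrow> real \<Rightarrow> complex" where
  "dunkl_op d \<delta> \<gamma> N m f r =
     (LINT s:{0<..}|lborel.
        complex_of_real (dunkl_kernel d \<delta> \<gamma> N m r s) * f s *
        complex_of_real (s powr (real d + 2 * \<gamma> - 1)))"

text \<open>
  Dimension of the space of spherical \<open>h\<close>-harmonics of degree \<open>m\<close> in dimension \<open>d\<close>; it does not
  depend on the multiplicity function.
\<close>
definition harmonic_dim :: "nat \<Rightarrow> nat \<Rightarrow> nat" where
  "harmonic_dim d m =
     ((m + d - 1) choose (d - 1)) - (if m < 2 then 0 else (m + d - 3) choose (d - 1))"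


text \<open>Real powers on \<open>[0, \<infinity>]\<close>, used only for positive exponents.\<close>
definition ennpow :: "ennreal \<Rightarrow> real \<Rightarrow> ennreal" where
  "ennpow x p = (if x = \<infinity> then \<infinity> else ennreal (enn2real x powr p))"

definition Lp_norm :: "'a measure \<Rightarrow> real \<Rightarrow> ('a \<Rightarrow> ennreal) \<Rightarrow> ennreal" where
  "Lp_norm M p g = ennpow (\<integral>\<^sup>+ x. ennpow (g x) p \<partial>M) (1 / p)"

definition Lp_space :: "'a measure \<Rightarrow> real \<Rightarrow> ('a \<Rightarrow> complex) set" where
  "Lp_space M p = {f \<in> borel_measurable M. Lp_norm M p (\<lambda>x. ennreal (norm (f x))) < \<infinity>}"

definition square_function :: "nat \<Rightarrow> (nat \<Rightarrow> nat \<Rightarrow> real \<Rightarrow> complex) \<Rightarrow> real \<Rightarrow> ennreal" where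
  "square_function d f r =
     ennpow (\<Sum>m. \<Sum>j=1..harmonic_dim d m. ennreal ((norm (f m j r))\<^sup>2)) (1 / 2)"

end

theory Submission
  imports Defs
begin

text \<open>
  Put \<open>D = d + 2\<gamma>\<close>. Since \<open>\<Sum> A\<^sub>j\<^bsup>\<gamma>-1\<^esup> w\<^bsup>2j\<^esup> = (1 - w\<^sup>2)\<^bsup>-\<gamma>\<^esup>\<close>, the weighted sum of Hermite Cesaro
  kernels inside the integral defining the Dunkl kernel is the coefficient of \<open>w\<^sup>N\<close> in
  \<open>(1 - w)\<^bsup>-\<delta>-1\<^esup> (1 - w\<^sup>2)\<^bsup>-D/2\<^esup> exp E\<close>: it behaves like a Hermite Cesaro kernel in the real
  dimension \<open>D\<close>. As the normalized ultraspherical polynomials are bounded by 1, all kernels with the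
  same \<open>N\<close> are dominated by one positive kernel that does not depend on \<open>m\<close>; by Minkowski's inequality
  in \<open>\<ell>\<^sup>2\<close> and the Schur test it suffices to bound the \<open>L\<^sup>1\<close> norm of this coefficient with respect to
  \<open>r\<^bsup>D-1\<^esup> (1 - u\<^sup>2)\<^bsup>(D-3)/2\<^esup> dr du\<close>, uniformly in \<open>N\<close> and \<open>s\<close>.

  The coefficient is an integral over the circle \<open>|w| = 1 - \<eta>\<close>, \<open>\<eta> = 1/(N+2)\<close>, which is cut into the
  dyadic arcs \<open>|1 - w| ~ \<tau> = X\<eta>\<close>. With \<open>q = r\<^sup>2 + s\<^sup>2 - 2rsu\<close>, the part of the kernel coming from one
  arc has Gaussian decay for \<open>q > \<eta>X\<^bsup>2+2\<epsilon>\<^esup>\<close>. For smaller \<open>q\<close> it is estimated by its \<open>L\<^sup>2\<close> norm, which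
  the semigroup law \<open>|\<langle>G\<^sub>w, G\<^sub>v\<rangle>| \<le> C |1 - w\<^sup>2 (cnj v)\<^sup>2|\<^bsup>-D/2\<^esup>\<close> makes explicit. This gains half a
  derivative over absolute values, so that \<open>\<delta> > (D-1)/2\<close> makes the contributions of the arcs
  a convergent geometric series in \<open>X\<close>.
\<close>

section \<open>Normalized ultraspherical polynomials\<close>

text \<open>The dimension \<open>D = d + 2\<gamma>\<close> is real, so no Euclidean space carries
  these kernels, and neither orthogonality nor translation invariance can be quoted. All that is
  needed of \<open>R^D\<close> is one Gaussian integral in (radius, cosine), computed by power
  series for real parameters and continued analytically to complex ones. Exponents, up to
  \<epsilon>: on an arc at distance \<tau> from 1 the powers of \<open>1 - w\<close> put
  \<open>\<tau>^(-2\<delta>-2)\<close> into the squared L2 norm, and the double integral of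
  \<open>|t - t'|^(-D/2)\<close>, cut off at \<eta>, gives \<open>\<tau> \<eta>^(1-D/2)\<close>. The
  region \<open>q <= \<tau>^2/\<eta>\<close> has volume of order
  \<open>(\<tau>^2/\<eta>)^(D/2)\<close>. Cauchy-Schwarz yields
  \<open>\<eta>^(-\<delta>) X^((D-1)/2-\<delta>)\<close>; the factor
  \<open>\<eta>^(-\<delta>)\<close> is of the size of the binomial coefficient that normalizes the
  Cesaro mean. Mehler's kernel is singular at \<open>w = -1\<close> as well. No separate argument is
  made there: the semigroup bound on the circle depends only on \<open>t - t'\<close>, and
  \<open>1 - w\<close> stays away from 0.\<close>

primrec rodrigues_poly :: "real \<Rightarrow> nat \<Rightarrow> real poly" where
  "rodrigues_poly a 0 = 1"
| "rodrigues_poly a (Suc k) =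
     [:1, 0, -1:] * pderiv (rodrigues_poly a k) + [:0, -2 * (a - real k):] * rodrigues_poly a k"

text \<open>\<open>rodrigues_poly a k\<close> is what remains of the k-th derivative once the power
  \<open>(1 - v^2)^(a - k)\<close> is split off; its recursion is the product rule. An explicit
  recursion, rather than mere existence, lets the differential equation below be proved by
  induction.\<close>

lemma deriv_funpow_rodrigues:
  "u \<in> {-1<..<1} \<Longrightarrow>
   (deriv ^^ k) (\<lambda>v. (1 - v\<^sup>2) powr a) u = (1 - u\<^sup>2) powr (a - real k) * poly (rodrigues_poly a k) u"
proof (induction k arbitrary: u)
  case (Suc k)
  let ?q = "rodrigues_poly a k"
  have pos: "0 < 1 - u\<^sup>2" using Suc.prems by (simp add: abs_square_less_1 abs_less_iff)
  have ev: "\<forall>\<^sub>F v in nhds u. (deriv ^^ k) (\<lambda>v. (1 - v\<^sup>2) powr a) v = (1 - v\<^sup>2) powr (a - real k) * poly ?q v"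
    using eventually_nhds_in_open[OF open_greaterThanLessThan Suc.prems]
    by eventually_elim (rule Suc.IH)
  have pw: "(1 - u\<^sup>2) powr (a - real k) = (1 - u\<^sup>2) powr (a - real (Suc k)) * (1 - u\<^sup>2)"
    using pos powr_add[of "1 - u\<^sup>2" "a - real (Suc k)" 1] by (simp add: algebra_simps)
  have "((\<lambda>v. (1 - v\<^sup>2) powr (a - real k) * poly ?q v) has_field_derivative
      (1 - u\<^sup>2) powr (a - real (Suc k)) * poly (rodrigues_poly a (Suc k)) u) (at u)"
  proof (rule DERIV_mult'[THEN DERIV_cong])
    have "((\<lambda>v. 1 - v\<^sup>2) has_field_derivative (- 2 * u)) (at u)"
      by (auto intro!: derivative_eq_intros)
    from DERIV_fun_powr[OF this pos, of "a - real k"]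
    show "((\<lambda>v. (1 - v\<^sup>2) powr (a - real k)) has_field_derivative
        (a - real k) * (1 - u\<^sup>2) powr (a - real (Suc k)) * (- 2 * u)) (at u)"
      by (simp add: algebra_simps)
    show "(poly ?q has_field_derivative poly (pderiv ?q) u) (at u)"
      by (rule poly_DERIV)
    show "(1 - u\<^sup>2) powr (a - real k) * poly (pderiv ?q) u
        + (a - real k) * (1 - u\<^sup>2) powr (a - real (Suc k)) * (- 2 * u) * poly ?q u
        = (1 - u\<^sup>2) powr (a - real (Suc k)) * poly (rodrigues_poly a (Suc k)) u"
      unfolding pw by (simp add: algebra_simps power2_eq_square)
  qed
  with deriv_cong_ev[OF ev refl] show ?case
    by (simp add: DERIV_imp_deriv)
qed simp

text \<open>Gegenbauer's differential equation. The equation for \<open>k\<close> says that the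
  derivative of the next polynomial is \<open>- L\<close> times the current one; inserting this into
  the recursion gives the equation for \<open>k + 1\<close>.\<close>

lemma rodrigues_poly_ode:
  "(1 - u\<^sup>2) * poly (pderiv (pderiv (rodrigues_poly a k))) u
     - (2 * (a - real k) + 2) * u * poly (pderiv (rodrigues_poly a k)) u
     + real k * (2 * a - real k + 1) * poly (rodrigues_poly a k) u = 0"
proof (induction k arbitrary: u)
  case (Suc k)
  let ?q = "rodrigues_poly a k" and ?q' = "rodrigues_poly a (Suc k)"
  define L where "L = real (Suc k) * (2 * a - real k)"
  have d: "poly (pderiv ?q') v = - L * poly ?q v" for v
    using Suc.IH[of v]
    by (simp add: pderiv_add pderiv_mult pderiv_pCons pderiv_minus pderiv_smult L_def algebra_simps power2_eq_square)
  have "pderiv ?q' = smult (- L) ?q"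
    by (rule poly_ext) (simp add: d del: rodrigues_poly.simps)
  then have dd: "poly (pderiv (pderiv ?q')) v = - L * poly (pderiv ?q) v" for v
    by (simp add: pderiv_smult pderiv_minus)
  have e: "poly ?q' u = (1 - u\<^sup>2) * poly (pderiv ?q) u - 2 * (a - real k) * u * poly ?q u"
    by (simp add: algebra_simps power2_eq_square)
  have L: "real (Suc k) * (2 * a - real (Suc k) + 1) = L" by (simp add: L_def)
  show ?case unfolding d dd e L by (simp add: algebra_simps)
qed simp

lemma rodrigues_poly_endpoints:
  "poly (rodrigues_poly a k) 1 = (-2) ^ k * (\<Prod>i<k. a - real i)"
  "poly (rodrigues_poly a k) (-1) = 2 ^ k * (\<Prod>i<k. a - real i)"
  by (induction k) (simp_all add: algebra_simps)

lemma ultraspherical_eq_rodrigues: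
  assumes "lam > - 1 / 2"
  shows "ultraspherical lam m = smult ((-1) ^ m / (2 ^ m * pochhammer (lam + 1 / 2) m))
           (rodrigues_poly (real m + lam - 1 / 2) m)"
  unfolding ultraspherical_def
proof (rule the1_equality[OF ultraspherical_ex1(1)[OF assms]], rule ballI)
  fix u :: real assume "u \<in> {-1<..<1}"
  moreover have "real m + lam - 1 / 2 - real m = lam - 1 / 2" by simp
  ultimately show "(1 - u\<^sup>2) powr (lam - 1 / 2) *
      poly (smult ((-1) ^ m / (2 ^ m * pochhammer (lam + 1 / 2) m))
           (rodrigues_poly (real m + lam - 1 / 2) m)) u =
      (-1) ^ m / (2 ^ m * pochhammer (lam + 1 / 2) m) *
        (deriv ^^ m) (\<lambda>v. (1 - v\<^sup>2) powr (real m + lam - 1 / 2)) u"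
    using deriv_funpow_rodrigues[of u m "real m + lam - 1 / 2"] by simp
qed

text \<open>Sonin's argument: \<open>m(m+2\<lambda>)P\<^sup>2 + (1-u\<^sup>2)P'\<^sup>2\<close> has derivative \<open>4\<lambda>uP'\<^sup>2\<close>, so it is
  maximal at the endpoints.\<close>
lemma abs_ultraspherical_le_1:
  assumes lam: "lam \<ge> 0" and u: "\<bar>u\<bar> \<le> 1"
  shows "\<bar>poly (ultraspherical lam m) u\<bar> \<le> 1"
proof (cases "m = 0")
  case True
  have "ultraspherical lam 0 = 1" using ultraspherical_eq_rodrigues[of lam 0] lam by simp
  then show ?thesis using True by simp
next
  case False
  define P where "P = ultraspherical lam m"
  define L where "L = real m * (real m + 2 * lam)"
  \<comment> \<open>The final step divides by \<open>L\<close>; it vanishes for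
    \<open>m = 0\<close>, hence the separate case.\<close>
  have L: "L > 0" using False lam by (simp add: L_def add_pos_nonneg)
  define c where "c = (-1) ^ m / (2 ^ m * pochhammer (lam + 1 / 2) m)"
  define q where "q = rodrigues_poly (real m + lam - 1 / 2) m"
  have P: "P = smult c q" using ultraspherical_eq_rodrigues[of lam m] lam by (simp add: P_def c_def q_def)
  have ode: "(1 - v\<^sup>2) * poly (pderiv (pderiv P)) v
     - (2 * lam + 1) * v * poly (pderiv P) v + L * poly P v = 0" for v
  proof -
    have "(1 - v\<^sup>2) * poly (pderiv (pderiv q)) v - (2 * lam + 1) * v * poly (pderiv q) v + L * poly q v = 0"
      using rodrigues_poly_ode[of v "real m + lam - 1 / 2" m]
      by (simp add: q_def L_def algebra_simps)
    then have "c * ((1 - v\<^sup>2) * poly (pderiv (pderiv q)) v - (2 * lam + 1) * v * poly (pderiv q) v + L * poly q v) = 0"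
      by simp
    then show ?thesis by (simp add: P pderiv_smult algebra_simps)
  qed
  have P1: "poly P 1 = 1" using ultraspherical_ex1(2)[of lam m] lam by (simp add: P_def)
  have "poly P (-1) = (-1) ^ m * poly P 1"
    by (simp add: P q_def rodrigues_poly_endpoints flip: power_mult_distrib)
  then have Pm1: "(poly P (-1))\<^sup>2 = 1" by (simp add: P1 power_mult_distrib flip: power_mult)
  define g where "g v = L * (poly P v)\<^sup>2 + (1 - v\<^sup>2) * (poly (pderiv P) v)\<^sup>2" for v
  have g': "(g has_real_derivative 4 * lam * v * (poly (pderiv P) v)\<^sup>2) (at v)" for v
  proof -
    have "(g has_real_derivative (L * (2 * poly P v * poly (pderiv P) v)
        + ((1 - v\<^sup>2) * (2 * poly (pderiv P) v * poly (pderiv (pderiv P)) v)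
           - 2 * v * (poly (pderiv P) v)\<^sup>2))) (at v)"
      unfolding g_def by (auto intro!: derivative_eq_intros poly_DERIV simp: algebra_simps power2_eq_square)
    \<comment> \<open>Regrouped so that the left side of the differential equation appears as a
      factor; it vanishes by \<open>ode\<close>, and only the \<lambda> term survives.\<close>
    moreover have "L * (2 * poly P v * poly (pderiv P) v)
        + ((1 - v\<^sup>2) * (2 * poly (pderiv P) v * poly (pderiv (pderiv P)) v)
           - 2 * v * (poly (pderiv P) v)\<^sup>2)
       = 2 * poly (pderiv P) v * ((1 - v\<^sup>2) * poly (pderiv (pderiv P)) v
          - (2 * lam + 1) * v * poly (pderiv P) v + L * poly P v) + 4 * lam * v * (poly (pderiv P) v)\<^sup>2"
      by (simp add: algebra_simps power2_eq_square)
    ultimately show ?thesis by (simp add: ode)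
  qed
  have "g u \<le> L"
  proof (cases "u \<ge> 0")
    case True
    have "g u \<le> g 1"
      by (rule DERIV_nonneg_imp_nondecreasing[of u 1 g])
        (use True u lam g' in \<open>auto intro!: exI[of _ "4 * lam * _ * (poly (pderiv P) _)\<^sup>2"]\<close>)
    then show ?thesis by (simp add: g_def P1)
  next
    case False
    have "g u \<le> g (-1)"
    proof (rule DERIV_nonpos_imp_nonincreasing[of "-1" u g])
      show "-1 \<le> u" using u by simp
      fix x assume "-1 \<le> x" "x \<le> u"
      then have "4 * lam * x * (poly (pderiv P) x)\<^sup>2 \<le> 0" using False lam
        by (intro mult_nonpos_nonneg mult_nonneg_nonpos) auto
      with g'[of x] show "\<exists>y. (g has_real_derivative y) (at x) \<and> y \<le> 0" by blast
    qed
    then show ?thesis by (simp add: g_def Pm1)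
  qed
  moreover have "0 \<le> (1 - u\<^sup>2) * (poly (pderiv P) u)\<^sup>2"
    using u by (simp add: abs_square_le_1)
  ultimately have "L * (poly P u)\<^sup>2 \<le> L * 1" by (simp add: g_def)
  then have "(poly P u)\<^sup>2 \<le> 1" using L by simp
  then show ?thesis by (simp add: abs_square_le_1 P_def)
qed

section \<open>Parametric integrals and moments\<close>

text \<open>Differentiation under the integral sign from local domination of \<open>f\<close> alone:
  Cauchy's inequality turns the bound on \<open>f\<close> into one on its derivative, hence on
  difference quotients, and dominated convergence applies along sequences.\<close>

lemma holomorphic_on_lebesgue_integral:
  fixes f :: "complex \<Rightarrow> 'a \<Rightarrow> complex"
  assumes hol: "\<And>x. x \<in> space M \<Longrightarrow> (\<lambda>w. f w x) holomorphic_on S"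
    and meas: "\<And>w. w \<in> S \<Longrightarrow> f w \<in> borel_measurable M"
    and dom: "\<And>w0. w0 \<in> S \<Longrightarrow> \<exists>r>0. \<exists>h. integrable M h \<and> cball w0 r \<subseteq> S \<and>
                (\<forall>w\<in>cball w0 r. \<forall>x\<in>space M. norm (f w x) \<le> h x)"
  shows "(\<lambda>w. \<integral>x. f w x \<partial>M) holomorphic_on S"
proof -
  define F where "F w = (\<integral>x. f w x \<partial>M)" for w
  have "F field_differentiable (at w0 within S)" if w0: "w0 \<in> S" for w0
  proof -
    from dom[OF w0] obtain r h where r: "r > 0" and h: "integrable M h" and rS: "cball w0 r \<subseteq> S"
      and b: "\<And>w x. w \<in> cball w0 r \<Longrightarrow> x \<in> space M \<Longrightarrow> norm (f w x) \<le> h x" by blast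
    define D where "D = (\<integral>x. deriv (\<lambda>w. f w x) w0 \<partial>M)"
    have int: "integrable M (f w)" if "w \<in> cball w0 r" for w
      by (rule Bochner_Integration.integrable_bound[OF h])
         (use that rS meas b in \<open>auto intro!: AE_I2 order_trans[OF b abs_ge_self]\<close>)
    have der: "((\<lambda>w. f w x) has_field_derivative deriv (\<lambda>w. f w x) w) (at w)"
      if "w \<in> ball w0 r" "x \<in> space M" for w x
    proof (rule holomorphic_derivI[of _ "ball w0 r"])
      show "(\<lambda>w. f w x) holomorphic_on ball w0 r"
        using rS by (intro holomorphic_on_subset[OF hol[OF that(2)]]) auto
    qed (use that in auto)
    \<comment> \<open>Half the radius, so that the circle of radius \<open>r / 2\<close> used in
      Cauchy's inequality stays inside the ball where \<open>h\<close> dominates.\<close>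
    have derb: "norm (deriv (\<lambda>w. f w x) w) \<le> h x / (r / 2)"
      if w: "w \<in> cball w0 (r / 2)" and x: "x \<in> space M" for w x
    proof -
      have sub: "cball w (r / 2) \<subseteq> cball w0 r"
      proof
        fix v assume "v \<in> cball w (r / 2)"
        then show "v \<in> cball w0 r" using w dist_triangle[of w0 v w] by simp
      qed
      then have hS: "(\<lambda>w. f w x) holomorphic_on cball w (r / 2)"
        using rS by (intro holomorphic_on_subset[OF hol[OF x]]) auto
      have "norm ((deriv ^^ 1) (\<lambda>w. f w x) w) \<le> fact 1 * h x / (r / 2) ^ 1"
      proof (rule Cauchy_inequality)
        show "(\<lambda>w. f w x) holomorphic_on ball w (r / 2)"
          using hS by (rule holomorphic_on_subset) auto
        show "continuous_on (cball w (r / 2)) (\<lambda>w. f w x)"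
          using hS by (rule holomorphic_on_imp_continuous_on)
        fix y assume "norm (w - y) = r / 2"
        then have "y \<in> cball w (r / 2)" by (simp add: dist_norm)
        then show "norm (f y x) \<le> h x" using sub x by (intro b) auto
      qed (use r in simp)
      then show ?thesis by simp
    qed
    have quot: "norm ((f w x - f w0 x) / (w - w0)) \<le> h x / (r / 2)"
      if w: "w \<in> cball w0 (r / 2)" "w \<noteq> w0" and x: "x \<in> space M" for w x
    proof -
      have "norm (f w x - f w0 x) \<le> h x / (r / 2) * norm (w - w0)"
        by (rule field_differentiable_bound[of "cball w0 (r / 2)" "\<lambda>w. f w x" "deriv (\<lambda>w. f w x)"])
           (use w x r derb in \<open>auto intro!: has_field_derivative_at_within[OF der]\<close>)
      then show ?thesis using w by (simp add: norm_divide field_simps)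
    qed
    have "((\<lambda>w. (F w - F w0) / (w - w0)) \<longlongrightarrow> D) (at w0)"
      unfolding tendsto_at_iff_sequentially comp_def
    proof (intro allI impI)
      fix X :: "nat \<Rightarrow> complex"
      assume X: "\<forall>i. X i \<in> UNIV - {w0}" and lim: "X \<longlonglongrightarrow> w0"
      from lim r have "\<forall>\<^sub>F i in sequentially. dist (X i) w0 < r / 2"
        by (intro tendstoD) auto
      then obtain n0 where n0: "\<And>i. i \<ge> n0 \<Longrightarrow> dist (X i) w0 < r / 2"
        by (auto simp: eventually_sequentially)
      \<comment> \<open>Dominated convergence asks for the bound at every index, whereas
        \<open>X\<close> lies in the small ball only eventually; the first \<open>n0\<close> terms
        are dropped.\<close>
      define Y where "Y i = X (i + n0)" for i
      have Y: "Y i \<in> cball w0 (r / 2)" "Y i \<noteq> w0" "Y i \<in> cball w0 r" for i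
        using n0[of "i + n0"] X r by (auto simp: Y_def dist_commute)
      have Ylim: "Y \<longlonglongrightarrow> w0" unfolding Y_def by (rule LIMSEQ_ignore_initial_segment[OF lim])
      have pt: "(\<lambda>i. (f (Y i) x - f w0 x) / (Y i - w0)) \<longlonglongrightarrow> deriv (\<lambda>w. f w x) w0"
        if "x \<in> space M" for x
        using der[of w0 x] that r Ylim Y(2)
        by (auto simp: has_field_derivative_iff tendsto_at_iff_sequentially comp_def)
      have m1: "(\<lambda>x. (f (Y i) x - f w0 x) / (Y i - w0)) \<in> borel_measurable M" for i
        using int[OF Y(3)] int[of w0] r by (intro borel_measurable_divide borel_measurable_diff) auto
      have "(\<lambda>i. \<integral>x. (f (Y i) x - f w0 x) / (Y i - w0) \<partial>M) \<longlonglongrightarrow> D"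
        unfolding D_def
      proof (rule integral_dominated_convergence[where w="\<lambda>x. h x / (r / 2)"])
        \<comment> \<open>Measurability in \<open>x\<close> of the derivative is not assumed: it is
          a pointwise limit of measurable quotients.\<close>
        show "(\<lambda>x. deriv (\<lambda>w. f w x) w0) \<in> borel_measurable M"
          by (rule borel_measurable_LIMSEQ_metric[OF m1 pt])
      qed (use m1 pt quot Y h in \<open>auto intro!: AE_I2\<close>)
      moreover have "(\<integral>x. (f (Y i) x - f w0 x) / (Y i - w0) \<partial>M) = (F (Y i) - F w0) / (Y i - w0)" for i
        using int[OF Y(3)] int[of w0] r by (simp add: F_def Bochner_Integration.integral_diff)
      ultimately have "(\<lambda>i. (F (X (i + n0)) - F w0) / (X (i + n0) - w0)) \<longlonglongrightarrow> D"
        by (simp only: Y_def)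
      then show "(\<lambda>i. (F (X i) - F w0) / (X i - w0)) \<longlonglongrightarrow> D"
        by (rule LIMSEQ_offset)
    qed
    then have "(F has_field_derivative D) (at w0)" by (simp add: has_field_derivative_iff)
    then show ?thesis
      by (meson field_differentiable_def field_differentiable_at_within)
  qed
  then have "F holomorphic_on S" by (auto simp: holomorphic_on_def)
  then show ?thesis by (simp add: F_def[abs_def])
qed

text \<open>Input for the identity theorem: formulas proved for positive real parameters extend to
  complex ones.\<close>

lemma islimpt_positive_reals: "(1::complex) islimpt (of_real ` {0<..})"
proof -
  have "of_real 1 islimpt (of_real ` {0<..} :: complex set)"
  proof (rule islimpt_isCont_image)
    show "(1::real) islimpt {0<..}"
      by (rule interior_limit_point) (simp add: interior_open)
    show "\<forall>\<^sub>F y in at (1::real). of_real y \<noteq> (of_real 1 :: complex)"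
      unfolding of_real_eq_iff by (simp add: eventually_at_filter)
  qed (auto intro: continuous_intros)
  then show ?thesis by simp
qed

text \<open>Substitution \<open>t = u^2\<close> in Euler's Beta integral; these are the even moments
  of the Gegenbauer weight over half of its interval.\<close>

lemma nn_integral_Beta_square:
  fixes c :: real
  assumes c: "c > -1"
  shows "(\<integral>\<^sup>+u. ennreal (indicator {0<..<1} u * (u ^ (2 * n) * (1 - u\<^sup>2) powr c)) \<partial>lborel) =
         ennreal (Beta (real n + 1 / 2) (c + 1) / 2)"
proof -
  define f where "f t = t powr (real n + 1 / 2 - 1) * (1 - t) powr (c + 1 - 1)" for t :: real
  have im: "power2 ` {0<..<1::real} = {0<..<1}"
  proof (intro equalityI subsetI)
    fix t :: real assume "t \<in> {0<..<1}"
    then have "t = (sqrt t)\<^sup>2" "sqrt t \<in> {0<..<1}" by auto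
    then show "t \<in> power2 ` {0<..<1}" by blast
  qed (auto simp: power_less_one_iff abs_square_less_1)
  have hi: "(f has_integral Beta (real n + 1 / 2) (c + 1)) {0<..<1}"
    using has_integral_Beta_real[of "real n + 1 / 2" "c + 1"] c
    by (simp add: has_integral_Icc_iff_Ioo f_def[abs_def])
  then have "f absolutely_integrable_on {0<..<1}"
    by (intro nonnegative_absolutely_integrable_1) (auto simp: f_def has_integral_iff)
  with hi have "f absolutely_integrable_on (power2 ` {0<..<1}) \<and>
      integral (power2 ` {0<..<1}) f = Beta (real n + 1 / 2) (c + 1)"
    unfolding im by (simp add: has_integral_iff)
  moreover have "inj_on power2 {0<..<1::real}"
    by (rule inj_onI) (auto simp: power2_eq_iff)
  ultimately have "(\<lambda>u. \<bar>2 * u\<bar> * f (u\<^sup>2)) absolutely_integrable_on {0<..<1} \<and>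
      integral {0<..<1} (\<lambda>u. \<bar>2 * u\<bar> * f (u\<^sup>2)) = Beta (real n + 1 / 2) (c + 1)"
    by (subst has_absolute_integral_change_of_variables_1'[of "{0<..<1}" power2 "\<lambda>u. 2 * u" f])
       (auto intro!: derivative_eq_intros)
  then have "((\<lambda>u. \<bar>2 * u\<bar> * f (u\<^sup>2)) has_integral Beta (real n + 1 / 2) (c + 1)) {0<..<1}"
    using set_lebesgue_integral_eq_integral(1)[of "{0<..<1}" "\<lambda>u. \<bar>2 * u\<bar> * f (u\<^sup>2)"]
    by (simp add: has_integral_iff)
  from has_integral_mult_right[OF this, of "1/2"]
  have "((\<lambda>u. 1 / 2 * (\<bar>2 * u\<bar> * f (u\<^sup>2))) has_integral Beta (real n + 1 / 2) (c + 1) / 2) {0<..<1}"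
    by simp
  moreover have "1 / 2 * (\<bar>2 * u\<bar> * f (u\<^sup>2)) = u ^ (2 * n) * (1 - u\<^sup>2) powr c"
    if "u \<in> {0<..<1}" for u
  proof -
    have "u * (u\<^sup>2) powr (real n - 1 / 2) = u powr 1 * u powr (2 * (real n - 1 / 2))"
      using that by (simp add: powr_powr flip: powr_numeral)
    also have "\<dots> = u powr (2 * real n)"
      by (subst powr_add[symmetric]) (simp add: algebra_simps)
    also have "\<dots> = u ^ (2 * n)"
      using that by (subst powr_realpow[symmetric]) auto
    finally show ?thesis using that by (simp add: f_def)
  qed
  ultimately have "((\<lambda>u. u ^ (2 * n) * (1 - u\<^sup>2) powr c) has_integral Beta (real n + 1 / 2) (c + 1) / 2) {0<..<1}"
    by (rule has_integral_eq[rotated])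
  from nn_integral_has_integral_lebesgue[OF _ this] show ?thesis by simp
qed

text \<open>Substitution \<open>t = a r^2\<close> in Euler's Gamma integral.\<close>

lemma nn_integral_gaussian_moment:
  fixes a x :: real
  assumes a: "a > 0" and x: "x > 0"
  shows "(\<integral>\<^sup>+r. ennreal (indicator {0<..} r * (r powr (2 * x - 1) * exp (- a * r\<^sup>2))) \<partial>lborel) =
         ennreal (Gamma x * a powr (- x) / 2)"
proof -
  define f where "f t = t powr (x - 1) / exp t" for t :: real
  have im: "(\<lambda>r. a * r\<^sup>2) ` {0<..} = {0<..}"
  proof (intro equalityI subsetI)
    fix t :: real assume "t \<in> {0<..}"
    then have "t = a * (sqrt (t / a))\<^sup>2" "sqrt (t / a) \<in> {0<..}" using a by auto
    then show "t \<in> (\<lambda>r. a * r\<^sup>2) ` {0<..}" by blast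
  qed (use a in auto)
  have "(f has_integral Gamma x) {0..}"
    using Gamma_integral_real[OF x] by (simp add: f_def[abs_def])
  moreover have "negligible {t \<in> {0..} - {0<..}. f t \<noteq> 0}"
    by (rule negligible_subset[of "{0}"]) auto
  moreover have "{t \<in> {0<..} - {0..}. f t \<noteq> 0} = {}" by auto
  ultimately have hi: "(f has_integral Gamma x) {0<..}"
    using has_integral_spike_set_eq[of "{0..}" "{0<..}" f "Gamma x"] negligible_empty by metis
  then have "f absolutely_integrable_on {0<..}"
    by (intro nonnegative_absolutely_integrable_1) (auto simp: f_def has_integral_iff)
  with hi have "f absolutely_integrable_on ((\<lambda>r. a * r\<^sup>2) ` {0<..}) \<and>
      integral ((\<lambda>r. a * r\<^sup>2) ` {0<..}) f = Gamma x"
    unfolding im by (simp add: has_integral_iff)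
  moreover have "inj_on (\<lambda>r. a * r\<^sup>2) {0<..}"
    by (rule inj_onI) (use a in \<open>auto simp: power2_eq_iff\<close>)
  ultimately have "(\<lambda>r. \<bar>2 * a * r\<bar> * f (a * r\<^sup>2)) absolutely_integrable_on {0<..} \<and>
      integral {0<..} (\<lambda>r. \<bar>2 * a * r\<bar> * f (a * r\<^sup>2)) = Gamma x"
    by (subst has_absolute_integral_change_of_variables_1'[of "{0<..}" "\<lambda>r. a * r\<^sup>2" "\<lambda>r. 2 * a * r" f])
       (auto intro!: derivative_eq_intros)
  then have "((\<lambda>r. \<bar>2 * a * r\<bar> * f (a * r\<^sup>2)) has_integral Gamma x) {0<..}"
    using set_lebesgue_integral_eq_integral(1)[of "{0<..}" "\<lambda>r. \<bar>2 * a * r\<bar> * f (a * r\<^sup>2)"]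
    by (simp add: has_integral_iff)
  from has_integral_mult_right[OF this, of "a powr (-x) / 2"]
  have "((\<lambda>r. a powr (-x) / 2 * (\<bar>2 * a * r\<bar> * f (a * r\<^sup>2))) has_integral Gamma x * a powr (-x) / 2) {0<..}"
    by (simp add: mult_ac)
  moreover have "a powr (-x) / 2 * (\<bar>2 * a * r\<bar> * f (a * r\<^sup>2)) = r powr (2 * x - 1) * exp (- a * r\<^sup>2)"
    if "r \<in> {0<..}" for r
  proof -
    have "r * (r\<^sup>2) powr (x - 1) = r powr 1 * r powr (2 * (x - 1))"
      using that by (simp add: powr_powr flip: powr_numeral)
    also have "\<dots> = r powr (2 * x - 1)"
      by (subst powr_add[symmetric]) (simp add: algebra_simps)
    finally have 1: "r * (r\<^sup>2) powr (x - 1) = r powr (2 * x - 1)" .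
    have 2: "a powr (-x) * a * a powr (x - 1) = 1"
      using a by (simp add: powr_diff powr_minus)
    have "a powr (-x) / 2 * (\<bar>2 * a * r\<bar> * f (a * r\<^sup>2)) =
        (a powr (-x) * a * a powr (x - 1)) * (r * (r\<^sup>2) powr (x - 1)) * exp (- a * r\<^sup>2)"
      using that a by (simp add: f_def powr_mult exp_minus inverse_eq_divide)
    then show ?thesis by (simp add: 1 2)
  qed
  ultimately have "((\<lambda>r. r powr (2 * x - 1) * exp (- a * r\<^sup>2)) has_integral Gamma x * a powr (-x) / 2) {0<..}"
    by (rule has_integral_eq[rotated])
  from nn_integral_has_integral_lebesgue[OF _ this] show ?thesis by simp
qed

text \<open>Legendre duplication at half-integers, in the form that turns a series with denominators
  \<open>(2n)!\<close> into an exponential series.\<close>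

lemma Gamma_half_over_fact: "Gamma (real n + 1 / 2) / fact (2 * n) = sqrt pi / (4 ^ n * fact n)"
proof (induction n)
  case (Suc n)
  have "Gamma (real (Suc n) + 1 / 2) = (real n + 1 / 2) * Gamma (real n + 1 / 2)"
    using Gamma_plus1[of "real n + 1 / 2"] by (simp add: add_ac nonpos_Ints_def) 
  moreover have "fact (2 * Suc n) = (2 * real n + 2) * (2 * real n + 1) * fact (2 * n)"
    by (simp add: algebra_simps)
  moreover have "(2 * real n + 2) * (2 * real n + 1) = 4 * (real n + 1) * (real n + 1 / 2)"
    by (simp add: algebra_simps)
  ultimately have "Gamma (real (Suc n) + 1 / 2) / fact (2 * Suc n) =
      ((real n + 1 / 2) * Gamma (real n + 1 / 2)) / ((real n + 1 / 2) * (4 * (real n + 1) * fact (2 * n)))"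
    by (simp only: mult_ac)
  also have "\<dots> = Gamma (real n + 1 / 2) / (4 * (real n + 1) * fact (2 * n))"
    by (rule mult_divide_mult_cancel_left) (simp add: add_nonneg_eq_0_iff)
  also have "\<dots> = Gamma (real n + 1 / 2) / fact (2 * n) / (4 * (real n + 1))"
    by simp
  finally have "Gamma (real (Suc n) + 1 / 2) / fact (2 * Suc n) =
      Gamma (real n + 1 / 2) / fact (2 * n) / (4 * (real n + 1))" .
  then show ?case by (simp only: Suc.IH) (simp add: algebra_simps)
qed (simp add: Gamma_one_half_real)

section \<open>Gaussian integrals in polar coordinates\<close>

lemma fst_snd_borel_measurable [measurable]:
  "fst \<in> borel_measurable (borel :: ('a::topological_space \<times> 'b::topological_space) measure)"
  "snd \<in> borel_measurable (borel :: ('a::topological_space \<times> 'b::topological_space) measure)"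
  by (auto intro!: borel_measurable_continuous_onI continuous_intros)

definition polar_density :: "real \<Rightarrow> real \<times> real \<Rightarrow> real" where
  "polar_density D = (\<lambda>(r, u). indicator {0<..} r * r powr (D - 1) *
      (indicator {-1<..<1} u * (1 - u\<^sup>2) powr ((D - 3) / 2)))"

text \<open>The image of Lebesgue measure on \<open>\<real>\<^sup>D\<close> (up to a constant) under \<open>x \<mapsto> (|x|, cos \<angle>(x, e))\<close>,
  which makes sense for real \<open>D > 1\<close>.\<close>
definition polar_measure :: "real \<Rightarrow> (real \<times> real) measure" where
  "polar_measure D = density lborel (\<lambda>x. ennreal (polar_density D x))"

lemma borel_measurable_polar_density [measurable]: "polar_density D \<in> borel_measurable borel"
  unfolding polar_density_def borel_prod[symmetric] by measurable

lemma space_polar_measure [simp]: "space (polar_measure D) = UNIV"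
  by (simp add: polar_measure_def)

lemma sets_polar_measure [measurable_cong, simp]: "sets (polar_measure D) = sets borel"
  by (simp add: polar_measure_def)

lemma nn_integral_polar_measure:
  assumes [measurable]: "g \<in> borel_measurable borel"
  shows "(\<integral>\<^sup>+x. g x \<partial>polar_measure D) =
    (\<integral>\<^sup>+r. ennreal (indicator {0<..} r * r powr (D - 1)) *
       (\<integral>\<^sup>+u. ennreal (indicator {-1<..<1} u * (1 - u\<^sup>2) powr ((D - 3) / 2)) * g (r, u) \<partial>lborel) \<partial>lborel)"
proof -
  have "(\<integral>\<^sup>+x. g x \<partial>polar_measure D) = (\<integral>\<^sup>+x. ennreal (polar_density D x) * g x \<partial>(lborel \<Otimes>\<^sub>M lborel))"
    by (simp add: polar_measure_def nn_integral_density lborel_prod)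
  also have "\<dots> = (\<integral>\<^sup>+r. \<integral>\<^sup>+u. ennreal (polar_density D (r, u)) * g (r, u) \<partial>lborel \<partial>lborel)"
    by (intro lborel.nn_integral_fst[symmetric]) (simp add: lborel_prod)
  also have "\<dots> = (\<integral>\<^sup>+r. \<integral>\<^sup>+u. ennreal (indicator {0<..} r * r powr (D - 1)) *
       (ennreal (indicator {-1<..<1} u * (1 - u\<^sup>2) powr ((D - 3) / 2)) * g (r, u)) \<partial>lborel \<partial>lborel)"
    by (simp add: polar_density_def ennreal_mult' mult_ac)
  finally show ?thesis by (simp add: nn_integral_cmult)
qed

lemma AE_polar_measure: "AE x in polar_measure D. 0 < fst x \<and> \<bar>snd x\<bar> < 1"
proof -
  have "0 < polar_density D x \<Longrightarrow> 0 < fst x \<and> \<bar>snd x\<bar> < 1" for x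
    by (cases x) (auto simp: polar_density_def abs_less_iff zero_less_mult_iff split: split_indicator_asm)
  then show ?thesis unfolding polar_measure_def by (subst AE_density) auto
qed

text \<open>Poisson's integral for Bessel functions. Folding \<open>u\<close> onto \<open>-u\<close>
  leaves a cosh, whose Taylor series has only even powers; all its terms are nonnegative, so sum and
  integral commute for either sign of \<open>b\<close>.\<close>

lemma nn_integral_exp_Gegenbauer_weight:
  assumes c: "c > -1"
  shows "(\<integral>\<^sup>+u. ennreal (indicator {-1<..<1} u * (1 - u\<^sup>2) powr c) * ennreal (exp (b * u)) \<partial>lborel) =
    (\<Sum>n. ennreal (b ^ (2 * n) / fact (2 * n) * Beta (real n + 1 / 2) (c + 1)))"
proof -
  define W where "W u = (1 - u\<^sup>2) powr c" for u :: real
  have [measurable]: "W \<in> borel_measurable borel" unfolding W_def by measurable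
  have W0: "W u \<ge> 0" and Wm: "W (-u) = W u" for u by (simp_all add: W_def)
  let ?I = "indicator {0<..<1} :: real \<Rightarrow> real"
  \<comment> \<open>The two open halves of the interval miss the point 0.\<close>
  have ae: "AE u::real in lborel. u \<noteq> 0" by (rule AE_lborel_singleton)
  have "(\<integral>\<^sup>+u. ennreal (indicator {-1<..<1} u * W u) * ennreal (exp (b * u)) \<partial>lborel) =
    (\<integral>\<^sup>+u. ennreal (?I u * W u * exp (b * u)) + ennreal (?I (-u) * W (-u) * exp (b * u)) \<partial>lborel)"
    using ae by (intro nn_integral_cong_AE, eventually_elim) (auto simp: indicator_def W0 Wm ennreal_mult)
  also have "\<dots> = (\<integral>\<^sup>+u. ennreal (?I u * W u * exp (b * u)) \<partial>lborel)
      + (\<integral>\<^sup>+u. ennreal (?I (-u) * W (-u) * exp (b * u)) \<partial>lborel)"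
    by (rule nn_integral_add) auto
  also have "(\<integral>\<^sup>+u. ennreal (?I (-u) * W (-u) * exp (b * u)) \<partial>lborel) =
      (\<integral>\<^sup>+u. ennreal (?I u * W u * exp (- b * u)) \<partial>lborel)"
    by (subst nn_integral_real_affine[where c="-1" and t=0]) auto
  also have "(\<integral>\<^sup>+u. ennreal (?I u * W u * exp (b * u)) \<partial>lborel) + \<dots> =
      (\<integral>\<^sup>+u. ennreal (?I u * W u * exp (b * u)) + ennreal (?I u * W u * exp (- b * u)) \<partial>lborel)"
    by (rule nn_integral_add[symmetric]) auto
  also have "\<dots> = (\<integral>\<^sup>+u. (\<Sum>n. ennreal (2 * b ^ (2 * n) / fact (2 * n)) *
      ennreal (?I u * (u ^ (2 * n) * W u))) \<partial>lborel)"
  proof (rule nn_integral_cong)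
    fix u :: real
    have "(\<lambda>n. if even n then (b * u) ^ n /\<^sub>R fact n else 0) sums cosh (b * u)"
      by (rule cosh_converges)
    then have "(\<lambda>n. (b * u) ^ (2 * n) /\<^sub>R fact (2 * n)) sums cosh (b * u)"
      by (subst (asm) sums_mono_reindex[of "\<lambda>n. 2 * n", symmetric])
         (auto simp: strict_mono_def elim!: evenE)
    from sums_mult[OF this, of "2 * (?I u * W u)"]
    have "(\<lambda>n. 2 * b ^ (2 * n) / fact (2 * n) * (?I u * (u ^ (2 * n) * W u))) sums
        (2 * (?I u * W u) * cosh (b * u))"
      by (simp add: power_mult_distrib divide_inverse mult_ac)
    moreover have "2 * (?I u * W u) * cosh (b * u) = ?I u * W u * exp (b * u) + ?I u * W u * exp (- b * u)"
      by (simp add: cosh_def algebra_simps)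
    ultimately have "(\<Sum>n. ennreal (2 * b ^ (2 * n) / fact (2 * n) * (?I u * (u ^ (2 * n) * W u)))) =
        ennreal (?I u * W u * exp (b * u) + ?I u * W u * exp (- b * u))"
      using W0 by (intro suminf_ennreal_eq) auto
    moreover have "ennreal (2 * b ^ (2 * n) / fact (2 * n)) * ennreal x =
        ennreal (2 * b ^ (2 * n) / fact (2 * n) * x)" for n x
      by (rule ennreal_mult'[symmetric]) simp
    moreover have "ennreal (?I u * W u * exp (b * u)) + ennreal (?I u * W u * exp (- b * u)) =
        ennreal (?I u * W u * exp (b * u) + ?I u * W u * exp (- b * u))"
      using W0 by (intro ennreal_plus[symmetric]) auto
    ultimately show "ennreal (?I u * W u * exp (b * u)) + ennreal (?I u * W u * exp (- b * u)) =
        (\<Sum>n. ennreal (2 * b ^ (2 * n) / fact (2 * n)) * ennreal (?I u * (u ^ (2 * n) * W u)))"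
      by (simp only:)
  qed
  also have "\<dots> = (\<Sum>n. ennreal (2 * b ^ (2 * n) / fact (2 * n)) *
      (\<integral>\<^sup>+u. ennreal (?I u * (u ^ (2 * n) * W u)) \<partial>lborel))"
    by (subst nn_integral_suminf) (auto simp: nn_integral_cmult)
  also have "\<dots> = (\<Sum>n. ennreal (b ^ (2 * n) / fact (2 * n) * Beta (real n + 1 / 2) (c + 1)))"
    unfolding W_def nn_integral_Beta_square[OF c]
    by (simp add: ennreal_mult'[symmetric])
  finally show ?thesis by (simp add: W_def)
qed

text \<open>The total mass of \<open>exp (- r^2)\<close> under
  \<open>polar_measure D\<close>.\<close>

definition polar_const :: "real \<Rightarrow> real" where
  "polar_const D = sqrt pi * Gamma ((D - 1) / 2) / 2"

lemma polar_const_pos: "D > 1 \<Longrightarrow> polar_const D > 0"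
  by (simp add: polar_const_def Gamma_real_pos)

text \<open>Takes the place of completing the square in \<open>R^D\<close>: the radial moments
  produce \<open>Gamma (n + D/2)\<close>, which cancels the denominator of the angular Beta value,
  and duplication leaves the exponential series of \<open>b^2 / (4a)\<close>.\<close>

lemma nn_integral_polar_gaussian:
  assumes D: "D > 1" and a: "a > 0"
  shows "(\<integral>\<^sup>+x. ennreal (exp (- a * (fst x)\<^sup>2 + b * fst x * snd x)) \<partial>polar_measure D) =
    ennreal (polar_const D * a powr (- D / 2) * exp (b\<^sup>2 / (4 * a)))"
proof -
  define B where "B n = Beta (real n + 1 / 2) ((D - 3) / 2 + 1)" for n
  have B: "B n = Gamma (real n + 1 / 2) * Gamma ((D - 1) / 2) / Gamma (real n + D / 2)" for n
  proof -
    have "real n + 1 / 2 + ((D - 3) / 2 + 1) = real n + D / 2" "(D - 3) / 2 + 1 = (D - 1) / 2"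
      by (simp_all add: field_simps)
    then show ?thesis unfolding B_def Beta_def by metis
  qed
  have Gp: "Gamma (real n + D / 2) > 0" for n
    using D by (intro Gamma_real_pos) (simp add: add_nonneg_pos)
  have Bp: "B n \<ge> 0" for n
    unfolding B using D Gp[of n]
    by (intro divide_nonneg_nonneg mult_nonneg_nonneg less_imp_le Gamma_real_pos) (auto simp: add_nonneg_pos)
  let ?I = "indicator {0<..} :: real \<Rightarrow> real"
  have "(\<integral>\<^sup>+x. ennreal (exp (- a * (fst x)\<^sup>2 + b * fst x * snd x)) \<partial>polar_measure D) =
    (\<integral>\<^sup>+r. ennreal (?I r * r powr (D - 1)) * (\<integral>\<^sup>+u. ennreal (exp (- a * r\<^sup>2)) *
       (ennreal (indicator {-1<..<1} u * (1 - u\<^sup>2) powr ((D - 3) / 2)) * ennreal (exp ((b * r) * u))) \<partial>lborel) \<partial>lborel)"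
  proof (subst nn_integral_polar_measure)
    have "exp (- a * r\<^sup>2 + b * r * u) = exp (- a * r\<^sup>2) * exp ((b * r) * u)" for r u :: real
      by (rule exp_add)
    then have "ennreal W * ennreal (exp (- a * r\<^sup>2 + b * r * u)) =
        ennreal (exp (- a * r\<^sup>2)) * (ennreal W * ennreal (exp ((b * r) * u)))" for W r u :: real
      by (simp only: ennreal_mult' exp_ge_zero mult.left_commute)
    then show "(\<integral>\<^sup>+r. ennreal (?I r * r powr (D - 1)) *
        (\<integral>\<^sup>+u. ennreal (indicator {-1<..<1} u * (1 - u\<^sup>2) powr ((D - 3) / 2)) *
          ennreal (exp (- a * (fst (r, u))\<^sup>2 + b * fst (r, u) * snd (r, u))) \<partial>lborel) \<partial>lborel) =
      (\<integral>\<^sup>+r. ennreal (?I r * r powr (D - 1)) * (\<integral>\<^sup>+u. ennreal (exp (- a * r\<^sup>2)) *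
       (ennreal (indicator {-1<..<1} u * (1 - u\<^sup>2) powr ((D - 3) / 2)) * ennreal (exp ((b * r) * u))) \<partial>lborel) \<partial>lborel)"
      by (simp only: fst_conv snd_conv)
  qed measurable
  also have "\<dots> = (\<integral>\<^sup>+r. ennreal (?I r * r powr (D - 1)) * (ennreal (exp (- a * r\<^sup>2)) *
       (\<Sum>n. ennreal ((b * r) ^ (2 * n) / fact (2 * n) * B n))) \<partial>lborel)"
  proof -
    have "(D - 3) / 2 > -1" using D by simp
    from nn_integral_exp_Gegenbauer_weight[OF this]
    have "(\<integral>\<^sup>+u. ennreal (exp (- a * r\<^sup>2)) *
       (ennreal (indicator {-1<..<1} u * (1 - u\<^sup>2) powr ((D - 3) / 2)) * ennreal (exp ((b * r) * u))) \<partial>lborel) =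
       ennreal (exp (- a * r\<^sup>2)) * (\<Sum>n. ennreal ((b * r) ^ (2 * n) / fact (2 * n) * B n))" for r
      by (subst nn_integral_cmult) (auto simp only: B_def, measurable)
    then show ?thesis by (simp only:)
  qed
  also have "\<dots> = (\<integral>\<^sup>+r. (\<Sum>n. ennreal (b ^ (2 * n) / fact (2 * n) * B n) *
       ennreal (?I r * (r powr (2 * (real n + D / 2) - 1) * exp (- a * r\<^sup>2)))) \<partial>lborel)"
  proof (rule nn_integral_cong)
    fix r :: real
    have 1: "ennreal (?I r * r powr (D - 1)) * (ennreal (exp (- a * r\<^sup>2)) * ennreal ((b * r) ^ (2 * n) / fact (2 * n) * B n))
       = ennreal (b ^ (2 * n) / fact (2 * n) * B n) *
       ennreal (?I r * (r powr (2 * (real n + D / 2) - 1) * exp (- a * r\<^sup>2)))" for n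
    proof (cases "r > 0")
      case True
      have "r powr (2 * (real n + D / 2) - 1) = r powr (D - 1) * r powr real (2 * n)"
        by (simp flip: powr_add add: algebra_simps)
      then have "r powr (2 * (real n + D / 2) - 1) = r powr (D - 1) * r ^ (2 * n)"
        using True by (simp only: powr_realpow)
      then have "?I r * r powr (D - 1) * (exp (- a * r\<^sup>2) * ((b * r) ^ (2 * n) / fact (2 * n) * B n)) =
         b ^ (2 * n) / fact (2 * n) * B n * (?I r * (r powr (2 * (real n + D / 2) - 1) * exp (- a * r\<^sup>2)))"
        by (simp add: power_mult_distrib)
      moreover have "b ^ (2 * n) / fact (2 * n) * B n \<ge> 0"
        using Bp[of n] by simp
      ultimately show ?thesis by (simp only: ennreal_mult'[symmetric] exp_ge_zero powr_ge_zero
            indicator_pos_le mult_nonneg_nonneg)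
    qed simp
    show "ennreal (?I r * r powr (D - 1)) * (ennreal (exp (- a * r\<^sup>2)) *
       (\<Sum>n. ennreal ((b * r) ^ (2 * n) / fact (2 * n) * B n))) =
      (\<Sum>n. ennreal (b ^ (2 * n) / fact (2 * n) * B n) *
       ennreal (?I r * (r powr (2 * (real n + D / 2) - 1) * exp (- a * r\<^sup>2))))"
      unfolding ennreal_suminf_cmult[symmetric] by (rule suminf_cong) (rule 1)
  qed
  also have "\<dots> = (\<Sum>n. ennreal (b ^ (2 * n) / fact (2 * n) * B n) *
       (\<integral>\<^sup>+r. ennreal (?I r * (r powr (2 * (real n + D / 2) - 1) * exp (- a * r\<^sup>2))) \<partial>lborel))"
    by (subst nn_integral_suminf) (auto simp: nn_integral_cmult)
  also have "\<dots> = (\<Sum>n. ennreal (b ^ (2 * n) / fact (2 * n) * B n) *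
       ennreal (Gamma (real n + D / 2) * a powr (- (real n + D / 2)) / 2))"
    using D a by (subst nn_integral_gaussian_moment) (auto simp: add_nonneg_pos)
  also have "\<dots> = (\<Sum>n. ennreal (polar_const D * a powr (- D / 2) * ((b\<^sup>2 / (4 * a)) ^ n / fact n)))"
  proof (rule suminf_cong)
    fix n
    have "a powr (- (real n + D / 2)) = a powr (- D / 2) * a powr (- real n)"
      by (simp flip: powr_add add: algebra_simps)
    moreover have "a powr (- real n) = 1 / a ^ n"
      using a by (simp add: powr_minus_divide powr_realpow)
    ultimately have pw: "a powr (- (real n + D / 2)) = a powr (- D / 2) / a ^ n"
      by (simp only: times_divide_eq_right mult_1_right)
    have "b ^ (2 * n) / fact (2 * n) * B n * (Gamma (real n + D / 2) * a powr (- (real n + D / 2)) / 2)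
        = (Gamma (real n + 1 / 2) / fact (2 * n)) * b ^ (2 * n) * Gamma ((D - 1) / 2) * (a powr (- D / 2) / a ^ n) / 2"
      using Gp[of n] unfolding B pw by (simp add: mult_ac)
    also have "\<dots> = polar_const D * a powr (- D / 2) * ((b\<^sup>2 / (4 * a)) ^ n / fact n)"
      unfolding Gamma_half_over_fact power_mult[of b 2 n] power_divide power_mult_distrib polar_const_def
      by (simp add: mult_ac)
    finally show "ennreal (b ^ (2 * n) / fact (2 * n) * B n) *
       ennreal (Gamma (real n + D / 2) * a powr (- (real n + D / 2)) / 2) =
       ennreal (polar_const D * a powr (- D / 2) * ((b\<^sup>2 / (4 * a)) ^ n / fact n))"
      using Bp[of n] by (subst ennreal_mult'[symmetric]) auto
  qed
  also have "\<dots> = ennreal (polar_const D * a powr (- D / 2) * exp (b\<^sup>2 / (4 * a)))"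
  proof (rule suminf_ennreal_eq)
    have "(\<lambda>n. (b\<^sup>2 / (4 * a)) ^ n /\<^sub>R fact n) sums exp (b\<^sup>2 / (4 * a))" by (rule exp_converges)
    from sums_mult[OF this, of "polar_const D * a powr (- D / 2)"]
    show "(\<lambda>n. polar_const D * a powr (- D / 2) * ((b\<^sup>2 / (4 * a)) ^ n / fact n)) sums
       (polar_const D * a powr (- D / 2) * exp (b\<^sup>2 / (4 * a)))" by (simp only: real_scaleR_def divide_inverse mult_ac)
  qed (use polar_const_pos[OF D] a in auto)
  finally show ?thesis .
qed

lemma integrable_polar_gaussian_real:
  assumes "D > 1" "a > 0"
  shows "integrable (polar_measure D) (\<lambda>x. exp (- a * (fst x)\<^sup>2 + b * fst x * snd x))"
  by (rule integrableI_nonneg) (use nn_integral_polar_gaussian[OF assms, of b] in auto)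

lemma integral_polar_gaussian_real:
  assumes D: "D > 1" and a: "a > 0"
  shows "(\<integral>x. exp (- complex_of_real a * of_real ((fst x)\<^sup>2) + of_real b * of_real (fst x * snd x)) \<partial>polar_measure D) =
    of_real (polar_const D) * of_real a powr of_real (- D / 2) * exp ((of_real b)\<^sup>2 / (4 * of_real a))"
proof -
  have "(\<integral>x. exp (- complex_of_real a * of_real ((fst x)\<^sup>2) + of_real b * of_real (fst x * snd x)) \<partial>polar_measure D) =
    of_real (\<integral>x. exp (- a * (fst x)\<^sup>2 + b * fst x * snd x) \<partial>polar_measure D)"
    unfolding integral_complex_of_real[symmetric] by (simp flip: exp_of_real add: mult_ac)
  also have "(\<integral>x. exp (- a * (fst x)\<^sup>2 + b * fst x * snd x) \<partial>polar_measure D) =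
      polar_const D * a powr (- D / 2) * exp (b\<^sup>2 / (4 * a))"
    by (subst integral_eq_nn_integral)
       (use polar_const_pos[OF D] nn_integral_polar_gaussian[OF D a, of b] in auto)
  also have "of_real \<dots> = of_real (polar_const D) * of_real a powr of_real (- D / 2) * exp ((of_real b)\<^sup>2 / (4 * complex_of_real a))"
    using a powr_of_real[of a "- D / 2"] by (simp flip: exp_of_real)
  finally show ?thesis .
qed

text \<open>Continuation is done one variable at a time, first in \<open>\<beta>\<close> with
  \<open>a\<close> real: both sides are entire in \<open>\<beta>\<close> and agree on the positive
  reals.\<close>

lemma integral_polar_gaussian_real_complex:
  assumes D: "D > 1" and a: "a > 0"
  shows "(\<integral>x. exp (- complex_of_real a * of_real ((fst x)\<^sup>2) + \<beta> * of_real (fst x * snd x)) \<partial>polar_measure D) =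
    of_real (polar_const D) * of_real a powr of_real (- D / 2) * exp (\<beta>\<^sup>2 / (4 * of_real a))"
proof -
  define L where "L \<beta> = (\<integral>x. exp (- complex_of_real a * of_real ((fst x)\<^sup>2) + \<beta> * of_real (fst x * snd x)) \<partial>polar_measure D)" for \<beta>
  define R where "R \<beta> = of_real (polar_const D) * of_real a powr of_real (- D / 2) * exp (\<beta>\<^sup>2 / (4 * complex_of_real a))" for \<beta>
  have "L holomorphic_on UNIV" unfolding L_def
  proof (rule holomorphic_on_lebesgue_integral)
    fix \<beta>0 :: complex
    define c where "c = norm \<beta>0 + 1"
    \<comment> \<open>\<open>Re \<beta>\<close> may have either sign and so may the cosine; the sum
      of the exponentials with \<open>c\<close> and \<open>-c\<close> dominates both.\<close>
    define h where "h x = exp (- a * (fst x)\<^sup>2 + c * fst x * snd x) + exp (- a * (fst x)\<^sup>2 + (- c) * fst x * snd x)" for x :: "real \<times> real"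
    have "integrable (polar_measure D) h" unfolding h_def
      by (intro Bochner_Integration.integrable_add integrable_polar_gaussian_real D a)
    moreover have "norm (exp (- complex_of_real a * of_real ((fst x)\<^sup>2) + \<beta> * of_real (fst x * snd x))) \<le> h x"
      if "\<beta> \<in> cball \<beta>0 1" for \<beta> x
    proof -
      have "norm \<beta> \<le> c" using that norm_triangle_ineq[of \<beta>0 "\<beta> - \<beta>0"]
        by (simp add: c_def dist_norm norm_minus_commute)
      then have "\<bar>Re \<beta>\<bar> \<le> c" using abs_Re_le_cmod[of \<beta>] by simp
      then have "\<bar>Re \<beta>\<bar> * \<bar>fst x * snd x\<bar> \<le> c * \<bar>fst x * snd x\<bar>" by (rule mult_right_mono) simp
      then have "\<bar>Re \<beta> * (fst x * snd x)\<bar> \<le> \<bar>c * (fst x * snd x)\<bar>"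
        by (simp add: abs_mult c_def)
      then have "Re \<beta> * (fst x * snd x) \<le> c * fst x * snd x \<or> Re \<beta> * (fst x * snd x) \<le> (- c) * fst x * snd x"
        by (auto simp: abs_if split: if_splits)
      then have "exp (- a * (fst x)\<^sup>2 + Re \<beta> * (fst x * snd x)) \<le> h x"
      proof
        assume "Re \<beta> * (fst x * snd x) \<le> c * fst x * snd x"
        then show ?thesis unfolding h_def by (intro add_increasing2) auto
      next
        assume "Re \<beta> * (fst x * snd x) \<le> (- c) * fst x * snd x"
        then show ?thesis unfolding h_def by (intro add_increasing) auto
      qed
      then show ?thesis by simp
    qed
    ultimately show "\<exists>r>0. \<exists>h. integrable (polar_measure D) h \<and> cball \<beta>0 r \<subseteq> UNIV \<and>
        (\<forall>w\<in>cball \<beta>0 r. \<forall>x\<in>space (polar_measure D).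
          norm (exp (- complex_of_real a * of_real ((fst x)\<^sup>2) + w * of_real (fst x * snd x))) \<le> h x)"
      by (intro exI[of _ 1] conjI exI[of _ h]) auto
  qed (auto intro!: holomorphic_intros)
  moreover have "R holomorphic_on UNIV" unfolding R_def using a by (auto intro!: holomorphic_intros)
  ultimately have "(\<lambda>\<beta>. L \<beta> - R \<beta>) holomorphic_on UNIV" by (intro holomorphic_intros)
  then have "L \<beta> - R \<beta> = 0"
  proof (rule analytic_continuation[OF _ _ _ _ _ islimpt_positive_reals])
    fix z :: complex assume "z \<in> of_real ` {0<..}"
    then show "L z - R z = 0"
      unfolding L_def R_def using integral_polar_gaussian_real[OF D a] by auto
  qed auto
  then show ?thesis by (simp add: L_def R_def)
qed

text \<open>Second continuation, in \<open>\<alpha>\<close>, on the right half plane: there the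
  principal power is holomorphic and the integrand keeps Gaussian decay.\<close>

lemma integral_polar_gaussian:
  assumes D: "D > 1" and \<alpha>: "Re \<alpha> > 0"
  shows "(\<integral>x. exp (- \<alpha> * of_real ((fst x)\<^sup>2) + \<beta> * of_real (fst x * snd x)) \<partial>polar_measure D) =
    of_real (polar_const D) * \<alpha> powr of_real (- D / 2) * exp (\<beta>\<^sup>2 / (4 * \<alpha>))"
proof -
  define S where "S = {z. Re z > 0}"
  define L where "L \<alpha> = (\<integral>x. exp (- \<alpha> * of_real ((fst x)\<^sup>2) + \<beta> * of_real (fst x * snd x)) \<partial>polar_measure D)" for \<alpha>
  define R where "R \<alpha> = of_real (polar_const D) * \<alpha> powr of_real (- D / 2) * exp (\<beta>\<^sup>2 / (4 * \<alpha>))" for \<alpha>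
  have "L holomorphic_on S" unfolding L_def
  proof (rule holomorphic_on_lebesgue_integral)
    fix \<alpha>0 :: complex assume \<alpha>0: "\<alpha>0 \<in> S"
    \<comment> \<open>On the ball of this radius the real part stays at least
      \<open>Re \<alpha>0 / 2\<close>, so one real Gaussian dominates.\<close>
    define c where "c = Re \<alpha>0 / 2"
    have c: "c > 0" using \<alpha>0 by (simp add: c_def S_def)
    have ge: "Re \<alpha> \<ge> c" if "\<alpha> \<in> cball \<alpha>0 c" for \<alpha>
      using that abs_Re_le_cmod[of "\<alpha>0 - \<alpha>"] by (simp add: c_def dist_norm abs_if split: if_splits)
    define h where "h x = exp (- c * (fst x)\<^sup>2 + Re \<beta> * fst x * snd x)" for x :: "real \<times> real"
    have "integrable (polar_measure D) h" unfolding h_def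
      by (intro integrable_polar_gaussian_real D c)
    moreover have "norm (exp (- \<alpha> * of_real ((fst x)\<^sup>2) + \<beta> * of_real (fst x * snd x))) \<le> h x"
      if "\<alpha> \<in> cball \<alpha>0 c" for \<alpha> x
      using mult_right_mono[OF ge[OF that], of "(fst x)\<^sup>2"] by (simp add: h_def mult_ac)
    moreover have "cball \<alpha>0 c \<subseteq> S"
      using ge c by (auto simp: S_def simp del: mem_cball dest!: ge)
    ultimately show "\<exists>r>0. \<exists>h. integrable (polar_measure D) h \<and> cball \<alpha>0 r \<subseteq> S \<and>
        (\<forall>w\<in>cball \<alpha>0 r. \<forall>x\<in>space (polar_measure D).
          norm (exp (- w * of_real ((fst x)\<^sup>2) + \<beta> * of_real (fst x * snd x))) \<le> h x)"
      using c by (intro exI[of _ c] conjI exI[of _ h]) auto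
  qed (auto intro!: holomorphic_intros)
  moreover have "R holomorphic_on S" unfolding R_def
    by (intro holomorphic_intros) (auto simp: S_def complex_nonpos_Reals_iff)
  ultimately have "(\<lambda>\<alpha>. L \<alpha> - R \<alpha>) holomorphic_on S" by (intro holomorphic_intros)
  then have "L \<alpha> - R \<alpha> = 0"
  proof (rule analytic_continuation[OF _ _ _ _ _ islimpt_positive_reals])
    show "open S" unfolding S_def by (rule open_halfspace_Re_gt)
    show "connected S" unfolding S_def by (intro convex_connected convex_halfspace_Re_gt)
    fix z :: complex assume "z \<in> of_real ` {0<..}"
    then show "L z - R z = 0"
      unfolding L_def R_def using integral_polar_gaussian_real_complex[OF D, of _ \<beta>] by auto
  qed (use \<alpha> in \<open>auto simp: S_def\<close>)
  then show ?thesis by (simp add: L_def R_def)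
qed

section \<open>The Mehler kernel in the unit disc\<close>

lemma sigma_finite_polar_measure: "sigma_finite_measure (polar_measure D)"
  unfolding polar_measure_def
  by (subst sigma_finite_measure.sigma_finite_iff_density_finite[OF sigma_finite_lborel]) auto

text \<open>Without integrability the Bochner integral is 0 by convention, so the bound is
  unconditional; later estimates rely on this.\<close>

lemma ennreal_norm_integral_le_nn_integral:
  fixes f :: "'a \<Rightarrow> 'b :: {banach, second_countable_topology}"
  shows "ennreal (norm (integral\<^sup>L M f)) \<le> (\<integral>\<^sup>+x. ennreal (norm (f x)) \<partial>M)"
  by (cases "integrable M f") (auto intro: integral_norm_bound_ennreal simp: not_integrable_integral_eq)

lemma integrable_pair_bounded_snd:
  fixes F :: "'a \<Rightarrow> 'b \<Rightarrow> complex"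
  assumes M: "sigma_finite_measure M" and V: "finite_measure V"
    and [measurable]: "case_prod F \<in> borel_measurable (V \<Otimes>\<^sub>M M)"
    and b: "\<And>t x. t \<in> space V \<Longrightarrow> x \<in> space M \<Longrightarrow> norm (F t x) \<le> H x"
    and H: "integrable M H"
  shows "integrable (V \<Otimes>\<^sub>M M) (case_prod F)"
proof (rule integrableI_bounded)
  interpret V: finite_measure V by fact
  interpret M: sigma_finite_measure M by fact
  have "(\<integral>\<^sup>+z. ennreal (norm (case_prod F z)) \<partial>(V \<Otimes>\<^sub>M M)) = (\<integral>\<^sup>+t. \<integral>\<^sup>+x. ennreal (norm (F t x)) \<partial>M \<partial>V)"
    by (subst M.nn_integral_fst[symmetric]) auto
  also have "\<dots> \<le> (\<integral>\<^sup>+t. (\<integral>\<^sup>+x. ennreal (norm (H x)) \<partial>M) \<partial>V)"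
    by (intro nn_integral_mono ennreal_leI) (use b in \<open>auto intro: order_trans[OF _ abs_ge_self]\<close>)
  also have "\<dots> < \<infinity>"
  proof -
    have "emeasure V (space V) < \<infinity>" by (simp add: less_top[symmetric])
    then show ?thesis using H by (auto simp: integrable_iff_bounded ennreal_mult_less_top)
  qed
  finally show "(\<integral>\<^sup>+z. ennreal (norm (case_prod F z)) \<partial>(V \<Otimes>\<^sub>M M)) < \<infinity>" .
qed fact

text \<open>The squared L2 norm of a superposition is a double integral of inner products. Absolute
  values are taken only after integrating in \<open>x\<close>, so the cancellation between different
  \<open>t\<close> is kept; this is the source of the gain over pointwise estimates.\<close>

lemma nn_integral_norm_square_superposition:
  fixes K :: "'a \<Rightarrow> 'b \<Rightarrow> complex"
  assumes M: "sigma_finite_measure M" and V: "finite_measure V"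
    and K [measurable]: "case_prod K \<in> borel_measurable (V \<Otimes>\<^sub>M M)"
    and b: "\<And>t x. t \<in> space V \<Longrightarrow> x \<in> space M \<Longrightarrow> norm (K t x) \<le> h x"
    and h: "integrable M (\<lambda>x. (h x)\<^sup>2)"
  shows "(\<integral>\<^sup>+x. ennreal ((norm (\<integral>t. K t x \<partial>V))\<^sup>2) \<partial>M) \<le>
    (\<integral>\<^sup>+t. \<integral>\<^sup>+t'. ennreal (norm (\<integral>x. K t x * cnj (K t' x) \<partial>M)) \<partial>V \<partial>V)"
proof -
  interpret V: finite_measure V by fact
  interpret M: sigma_finite_measure M by fact
  interpret P: pair_sigma_finite V M ..
  have [measurable]: "cnj \<in> borel_measurable borel"
    by (intro borel_measurable_continuous_onI continuous_intros)
  have [measurable]: "case_prod (\<lambda>x t. K t x) \<in> borel_measurable (M \<Otimes>\<^sub>M V)"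
    using measurable_compose[OF measurable_pair_swap' K] by (simp add: case_prod_beta')
  define g where "g x = (\<integral>t. K t x \<partial>V)" for x
  have [measurable]: "g \<in> borel_measurable M" unfolding g_def
    by (rule V.borel_measurable_lebesgue_integral) simp
  define c where "c = measure V (space V)"
  have c: "c \<ge> 0" by (simp add: c_def)
  have Kint: "integrable V (\<lambda>t. K t x)" if x: "x \<in> space M" for x
  proof (rule V.integrable_const_bound[where B="h x"])
    show "(\<lambda>t. K t x) \<in> borel_measurable V" using x by measurable
  qed (use b x in auto)
  have gb: "norm (g x) \<le> c * h x" if x: "x \<in> space M" for x
  proof (cases "space V = {}")
    \<comment> \<open>Nonnegativity of \<open>h x\<close> is read off from some \<open>t\<close> in
      \<open>space V\<close>, so an empty space is treated apart.\<close>
    case True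
    then have "g x = (\<integral>t. 0 \<partial>V)" unfolding g_def by (intro Bochner_Integration.integral_cong) auto
    with True show ?thesis by (simp add: c_def)
  next
    case False
    then obtain t where "t \<in> space V" by blast
    then have h0: "h x \<ge> 0" using b[of t x] x norm_ge_zero order_trans by blast
    have "norm (g x) \<le> (\<integral>t. norm (K t x) \<partial>V)" unfolding g_def by (rule integral_norm_bound)
    also have "\<dots> \<le> (\<integral>t. h x \<partial>V)"
      by (rule integral_mono) (use Kint x b in auto)
    finally show ?thesis by (simp add: c_def)
  qed
  have kg: "norm (K t x * cnj (g x)) \<le> c * (h x)\<^sup>2" if "t \<in> space V" "x \<in> space M" for t x
  proof -
    have "norm (K t x) * norm (g x) \<le> h x * (c * h x)"
      by (rule mult_mono) (use that b gb in \<open>auto intro: order_trans[OF norm_ge_zero b]\<close>)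
    then show ?thesis by (simp add: norm_mult power2_eq_square mult_ac)
  qed
  \<comment> \<open>The two factors of the square are expanded one after the other:
    \<open>F1\<close> opens the first, keeping \<open>g\<close> intact, and \<open>F2\<close> opens
    \<open>g\<close>.\<close>
  have i1: "integrable (V \<Otimes>\<^sub>M M) (case_prod (\<lambda>t x. K t x * cnj (g x)))"
    by (rule integrable_pair_bounded_snd[OF M V _ kg]) (use h in auto)
  have F1: "(\<integral>x. (\<integral>t. K t x * cnj (g x) \<partial>V) \<partial>M) = (\<integral>t. (\<integral>x. K t x * cnj (g x) \<partial>M) \<partial>V)"
    by (rule P.Fubini_integral[OF i1])
  have F2: "(\<integral>x. K t x * cnj (g x) \<partial>M) = (\<integral>t'. (\<integral>x. K t x * cnj (K t' x) \<partial>M) \<partial>V)"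
    if t: "t \<in> space V" for t
  proof -
    have [measurable]: "K t \<in> borel_measurable M" using t by measurable
    have i2: "integrable (V \<Otimes>\<^sub>M M) (case_prod (\<lambda>t' x. K t x * cnj (K t' x)))"
    proof (rule integrable_pair_bounded_snd[OF M V])
      fix t' x assume "t' \<in> space V" "x \<in> space M"
      then have "norm (K t x) * norm (K t' x) \<le> h x * h x"
        by (intro mult_mono) (use t b in \<open>auto intro: order_trans[OF norm_ge_zero b]\<close>)
      then show "norm (K t x * cnj (K t' x)) \<le> (h x)\<^sup>2"
        by (simp add: norm_mult power2_eq_square)
    qed (use h in auto)
    have "(\<integral>x. K t x * cnj (g x) \<partial>M) = (\<integral>x. (\<integral>t'. K t x * cnj (K t' x) \<partial>V) \<partial>M)"
      by (rule Bochner_Integration.integral_cong) (simp_all add: g_def)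
    then show ?thesis using P.Fubini_integral[OF i2] by simp
  qed
  have gg: "(\<integral>t. K t x * cnj (g x) \<partial>V) = of_real ((norm (g x))\<^sup>2)" for x
    using complex_norm_square[of "g x"] by (simp add: g_def[symmetric])
  have gi: "integrable M (\<lambda>x. (norm (g x))\<^sup>2)"
  proof (rule Bochner_Integration.integrable_bound[of M "\<lambda>x. c\<^sup>2 * (h x)\<^sup>2"])
    show "AE x in M. norm ((norm (g x))\<^sup>2) \<le> norm (c\<^sup>2 * (h x)\<^sup>2)"
      using gb power_mono[OF gb norm_ge_zero, where n=2] by (auto simp: power_mult_distrib)
  qed (use h in auto)
  have "(\<integral>\<^sup>+x. ennreal ((norm (g x))\<^sup>2) \<partial>M) = ennreal (\<integral>x. (norm (g x))\<^sup>2 \<partial>M)"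
    by (rule nn_integral_eq_integral[OF gi]) auto
  also have "\<dots> = ennreal (norm (\<integral>x. (\<integral>t. K t x * cnj (g x) \<partial>V) \<partial>M))"
    unfolding gg integral_complex_of_real by simp
  also have "\<dots> \<le> (\<integral>\<^sup>+t. ennreal (norm (\<integral>x. K t x * cnj (g x) \<partial>M)) \<partial>V)"
    unfolding F1 by (rule ennreal_norm_integral_le_nn_integral)
  also have "\<dots> \<le> (\<integral>\<^sup>+t. \<integral>\<^sup>+t'. ennreal (norm (\<integral>x. K t x * cnj (K t' x) \<partial>M)) \<partial>V \<partial>V)"
    by (intro nn_integral_mono) (simp add: F2 ennreal_norm_integral_le_nn_integral)
  finally show ?thesis unfolding g_def .
qed

section \<open>Mehler's kernel for complex time and real dimension\<close>

definition mehler_exponent :: "complex \<Rightarrow> real \<Rightarrow> real \<Rightarrow> real \<Rightarrow> complex" where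
  "mehler_exponent w r s u =
     - (1 / 2) * ((1 + w\<^sup>2) / (1 - w\<^sup>2)) * of_real (r\<^sup>2 + s\<^sup>2) + 2 * w / (1 - w\<^sup>2) * of_real r * of_real s * of_real u"

text \<open>The dimension enters only through an exponent, so it may be any real \<open>D\<close>;
  the constant power of \<pi> is left out. The principal branch is unproblematic in the disc, where
  \<open>Re (1 - w^2) > 0\<close>.\<close>

definition mehler_gen :: "real \<Rightarrow> complex \<Rightarrow> real \<Rightarrow> real \<Rightarrow> real \<Rightarrow> complex" where
  "mehler_gen D w r s u = (1 - w\<^sup>2) powr of_real (- D / 2) * exp (mehler_exponent w r s u)"

lemma mehler_gen_commute: "mehler_gen D w r s u = mehler_gen D w s r u"
  by (simp add: mehler_gen_def mehler_exponent_def mult_ac add_ac)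

lemma unit_disc_nonzero:
  fixes w :: complex
  assumes "norm w < 1"
  shows "1 - w \<noteq> 0" "1 + w \<noteq> 0" "1 - w\<^sup>2 \<noteq> 0" "Re (1 - w) > 0" "Re (1 - w\<^sup>2) > 0"
proof -
  have "norm (w\<^sup>2) < 1" using assms by (simp add: norm_power abs_square_less_1)
  then show 1: "Re (1 - w\<^sup>2) > 0" using abs_Re_le_cmod[of "w\<^sup>2"] by simp
  show 2: "Re (1 - w) > 0" using assms abs_Re_le_cmod[of w] by simp
  have "Re (1 + w) > 0" using assms abs_Re_le_cmod[of w] by simp
  then show "1 + w \<noteq> 0" by (metis less_irrefl zero_complex.sel(1))
  from 1 2 show "1 - w \<noteq> 0" "1 - w\<^sup>2 \<noteq> 0" by auto
qed

lemma Re_cayley: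
  fixes w :: complex
  assumes "w \<noteq> 1"
  shows "Re ((1 + w) / (1 - w)) = (1 - (norm w)\<^sup>2) / (norm (1 - w))\<^sup>2"
proof -
  have "(1 + w) / (1 - w) = (1 + w) * cnj (1 - w) / of_real ((norm (1 - w))\<^sup>2)"
    using complex_div_cnj[of "1 + w" "1 - w"] by simp
  moreover have "Re ((1 + w) * cnj (1 - w)) = 1 - (norm w)\<^sup>2"
    unfolding cmod_power2 by (simp add: algebra_simps power2_eq_square)
  ultimately show ?thesis by (simp only: Re_divide_of_real)
qed

text \<open>Separates the singularities: \<open>w = 1\<close> acts on the squared distance of two
  points with lengths \<open>r\<close>, \<open>s\<close> and cosine \<open>u\<close>, while
  \<open>w = -1\<close> acts on that of their antipodal configuration. Both Cayley factors have
  nonnegative real part in the disc.\<close>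

lemma mehler_exponent_cayley:
  assumes w: "norm w < 1"
  shows "mehler_exponent w r s u = - (1 / 4) * ((1 + w) / (1 - w) * of_real (r\<^sup>2 + s\<^sup>2 - 2 * r * s * u)
     + (1 - w) / (1 + w) * of_real (r\<^sup>2 + s\<^sup>2 + 2 * r * s * u))"
proof -
  note nz = unit_disc_nonzero[OF w]
  have f: "1 - w\<^sup>2 = (1 - w) * (1 + w)" by (simp add: algebra_simps power2_eq_square)
  have c1: "(1 + w) / (1 - w) = (1 + w)\<^sup>2 / (1 - w\<^sup>2)" "(1 - w) / (1 + w) = (1 - w)\<^sup>2 / (1 - w\<^sup>2)"
    unfolding f using nz by (simp_all add: power2_eq_square)
  show ?thesis unfolding mehler_exponent_def c1
    unfolding divide_inverse by (simp add: algebra_simps power2_eq_square)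
qed

lemma chord_square_nonneg:
  fixes r s u :: real
  assumes "\<bar>u\<bar> \<le> 1"
  shows "0 \<le> r\<^sup>2 + s\<^sup>2 - 2 * r * s * u"
proof -
  have "\<bar>(r * s) * u\<bar> \<le> \<bar>r * s\<bar>"
    using mult_left_mono[OF assms, of "\<bar>r * s\<bar>"] by (simp add: abs_mult)
  then have "2 * r * s * u \<le> 2 * \<bar>r\<bar> * \<bar>s\<bar>"
    using abs_ge_self[of "(r * s) * u"] by (simp add: abs_mult mult.assoc)
  moreover have "0 \<le> (\<bar>r\<bar> - \<bar>s\<bar>)\<^sup>2" by simp
  ultimately show ?thesis by (simp add: power2_diff)
qed

text \<open>Only the Cayley factor singular at \<open>w = 1\<close> is kept; the other one only
  decreases the modulus and is bounded by 1.\<close>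

lemma norm_exp_mehler_exponent_le:
  assumes w: "norm w < 1" and u: "\<bar>u\<bar> \<le> 1"
  shows "norm (exp (mehler_exponent w r s u)) \<le>
    exp (- (1 / 4) * ((1 - (norm w)\<^sup>2) / (norm (1 - w))\<^sup>2) * (r\<^sup>2 + s\<^sup>2 - 2 * r * s * u))"
proof -
  have w2: "(norm w)\<^sup>2 < 1" using w by (simp add: abs_square_less_1)
  have "Re ((1 - w) / (1 + w)) = (1 - (norm w)\<^sup>2) / (norm (1 + w))\<^sup>2"
  proof -
    have "- w \<noteq> 1" using w by (metis less_irrefl norm_minus_cancel norm_one)
    then show ?thesis using Re_cayley[of "- w"] by simp
  qed
  then have "0 \<le> Re ((1 - w) / (1 + w))" using w2 by simp
  moreover have "0 \<le> r\<^sup>2 + s\<^sup>2 + 2 * r * s * u"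
    using chord_square_nonneg[of "- u" r s] u by simp
  ultimately have "0 \<le> Re ((1 - w) / (1 + w)) * (r\<^sup>2 + s\<^sup>2 + 2 * r * s * u)"
    by (rule mult_nonneg_nonneg)
  then have "Re (mehler_exponent w r s u) \<le>
      - (1 / 4) * (Re ((1 + w) / (1 - w)) * (r\<^sup>2 + s\<^sup>2 - 2 * r * s * u))"
  proof -
    have "Re (- (1 / 4) * (a * of_real x + b * of_real y)) = - (1 / 4) * (Re a * x + Re b * y)"
      for a b x y by simp
    moreover have "- (1 / 4) * (x + y) \<le> - (1 / 4) * x" if "0 \<le> y" for x y :: real
      using that by simp
    ultimately show ?thesis
      using \<open>0 \<le> Re ((1 - w) / (1 + w)) * (r\<^sup>2 + s\<^sup>2 + 2 * r * s * u)\<close>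
      unfolding mehler_exponent_cayley[OF w] by (simp only:)
  qed
  also have "Re ((1 + w) / (1 - w)) = (1 - (norm w)\<^sup>2) / (norm (1 - w))\<^sup>2"
    using w by (intro Re_cayley) auto
  finally show ?thesis by simp
qed

lemma norm_powr_of_real:
  "norm ((z::complex) powr of_real c) = norm z powr c"
  by (simp add: norm_powr_real_powr')

text \<open>Semigroup law on the diagonal in complex time: the product is again Gaussian in
  \<open>r\<close>, with parameters \<open>A\<close> and \<open>B s\<close>. Its integral is, up to
  a constant, the kernel at time \<open>w v\<close> with both arguments \<open>s\<close>, whose
  exponential has modulus at most 1.\<close>

lemma integral_mehler_gen_product:
  assumes D: "D > 1" and w: "norm w < 1" and v: "norm v < 1"
  shows "norm (\<integral>x. mehler_gen D w (fst x) s (snd x) * mehler_gen D v (fst x) s (snd x) \<partial>polar_measure D)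
    \<le> polar_const D * norm (1 - w\<^sup>2 * v\<^sup>2) powr (- D / 2)"
proof -
  define A where "A = (1 - w\<^sup>2 * v\<^sup>2) / ((1 - w\<^sup>2) * (1 - v\<^sup>2))"
  define B where "B = 2 * (w + v) * (1 - w * v) / ((1 - w\<^sup>2) * (1 - v\<^sup>2))"
  define P where "P = (1 - w\<^sup>2) * (1 - v\<^sup>2)"
  note nw = unit_disc_nonzero[OF w] and nv = unit_disc_nonzero[OF v]
  have z: "norm (w * v) < 1" using w v mult_strict_mono[of "norm w" 1 "norm v" 1]
    by (simp add: norm_mult)
  note nz = unit_disc_nonzero[OF z]
  have P0: "P \<noteq> 0" using nw nv by (simp add: P_def)
  have A1: "1 / 2 * ((1 + w\<^sup>2) / (1 - w\<^sup>2)) + 1 / 2 * ((1 + v\<^sup>2) / (1 - v\<^sup>2)) = A"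
    using nw nv by (simp add: A_def divide_simps) (simp add: algebra_simps)
  have B1: "2 * w / (1 - w\<^sup>2) + 2 * v / (1 - v\<^sup>2) = B"
    using nw nv by (simp add: B_def divide_simps) (simp add: algebra_simps power2_eq_square)
  have ReA: "Re A > 0"
  proof -
    have pos: "Re ((1 + z) / (1 - z)) > 0" if "norm z < 1" for z :: complex
      using that unit_disc_nonzero[OF that] by (subst Re_cayley) (auto simp: abs_square_less_1)
    have "norm (w\<^sup>2) < 1" "norm (v\<^sup>2) < 1" using w v by (simp_all add: norm_power abs_square_less_1)
    moreover have half: "Re (1 / 2 * a + 1 / 2 * b) = 1 / 2 * Re a + 1 / 2 * Re b" for a b by simp
    ultimately show ?thesis
      using pos[of "w\<^sup>2"] pos[of "v\<^sup>2"] unfolding A1[symmetric] half by linarith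
  qed
  have A0: "A \<noteq> 0" using ReA by auto
  have fac: "1 - w\<^sup>2 * v\<^sup>2 = (1 - w * v) * (1 + w * v)" by (simp add: algebra_simps power2_eq_square)
  have expo: "(B * of_real s)\<^sup>2 / (4 * A) - A * of_real (s\<^sup>2) = - ((1 - w * v) / (1 + w * v)) * of_real (s\<^sup>2)"
  proof -
    \<comment> \<open>The heart of the semigroup law: the numerator contains \<open>P\<close> as a
      factor, which cancels one of the two in the denominator.\<close>
    have "B\<^sup>2 - 4 * A\<^sup>2 = - (4 * (1 - w * v)\<^sup>2 / P)"
    proof -
      have "B\<^sup>2 - 4 * A\<^sup>2 = 4 * (((w + v) * (1 - w * v))\<^sup>2 - (1 - w\<^sup>2 * v\<^sup>2)\<^sup>2) / P\<^sup>2"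
      proof -
        have "(2 * x / P)\<^sup>2 - 4 * (y / P)\<^sup>2 = 4 * (x\<^sup>2 - y\<^sup>2) / P\<^sup>2" for x y
          by (simp add: power_divide power_mult_distrib diff_divide_distrib right_diff_distrib)
        then show ?thesis unfolding B_def A_def P_def[symmetric] mult.assoc[of 2] .
      qed
      also have "((w + v) * (1 - w * v))\<^sup>2 - (1 - w\<^sup>2 * v\<^sup>2)\<^sup>2 = - ((1 - w * v)\<^sup>2 * P)"
        unfolding P_def by (simp add: algebra_simps power2_eq_square)
      also have "4 * - ((1 - w * v)\<^sup>2 * P) / P\<^sup>2 = - (4 * (1 - w * v)\<^sup>2 / P)"
        using P0 by (simp add: power2_eq_square)
      finally show ?thesis .
    qed
    then have "(B\<^sup>2 - 4 * A\<^sup>2) / (4 * A) = - (4 * (1 - w * v)\<^sup>2 / P) / (4 * A)"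
      by (simp only:)
    also have "\<dots> = - ((1 - w * v)\<^sup>2 / (A * P))"
      by (simp add: mult.commute)
    also have "A * P = (1 - w * v) * (1 + w * v)"
      using P0 fac by (simp add: A_def P_def[symmetric])
    also have "- ((1 - w * v)\<^sup>2 / ((1 - w * v) * (1 + w * v))) = - ((1 - w * v) / (1 + w * v))"
      using nz by (simp add: power2_eq_square)
    finally have e: "(B\<^sup>2 - 4 * A\<^sup>2) / (4 * A) = - ((1 - w * v) / (1 + w * v))" .
    have "(B * of_real s)\<^sup>2 / (4 * A) - A * of_real (s\<^sup>2) = (B\<^sup>2 - 4 * A\<^sup>2) / (4 * A) * of_real (s\<^sup>2)"
      using A0 by (simp add: field_simps power2_eq_square)
    then show ?thesis by (simp only: e)
  qed
  have Repos: "Re ((1 - w * v) / (1 + w * v)) \<ge> 0"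
  proof -
    have "norm (- (w * v)) < 1" using z by simp
    then have "(norm (- (w * v)))\<^sup>2 < 1" by (simp add: abs_square_less_1)
    moreover have "- (w * v) \<noteq> 1" using z by (metis less_irrefl norm_minus_cancel norm_one)
    ultimately show ?thesis using Re_cayley[of "- (w * v)"] by simp
  qed
  have Re0: "Re ((B * of_real s)\<^sup>2 / (4 * A) - A * of_real (s\<^sup>2)) \<le> 0"
  proof -
    have "Re (- a * of_real x) \<le> 0" if "Re a \<ge> 0" "x \<ge> 0" for a x using that by simp
    with Repos show ?thesis by (simp only: expo zero_le_power2)
  qed
  define C where "C = (1 - w\<^sup>2) powr of_real (- D / 2) * (1 - v\<^sup>2) powr of_real (- D / 2)"
  have ex: "mehler_exponent w r s u + mehler_exponent v r s u =
      - A * of_real (s\<^sup>2) + (- A * of_real (r\<^sup>2) + (B * of_real s) * of_real (r * u))" for r u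
  proof -
    have "(- (1 / 2) * a * of_real (r\<^sup>2 + s\<^sup>2) + b * of_real r * of_real s * of_real u) +
        (- (1 / 2) * a' * of_real (r\<^sup>2 + s\<^sup>2) + b' * of_real r * of_real s * of_real u) =
      - (1 / 2 * a + 1 / 2 * a') * of_real (s\<^sup>2) +
        (- (1 / 2 * a + 1 / 2 * a') * of_real (r\<^sup>2) + ((b + b') * of_real s) * of_real (r * u))"
      for a a' b b' :: complex by (simp add: algebra_simps)
    then show ?thesis unfolding mehler_exponent_def A1[symmetric] B1[symmetric] .
  qed
  have "(\<lambda>x. mehler_gen D w (fst x) s (snd x) * mehler_gen D v (fst x) s (snd x)) =
    (\<lambda>x. (C * exp (- A * of_real (s\<^sup>2))) *
       exp (- A * of_real ((fst x)\<^sup>2) + (B * of_real s) * of_real (fst x * snd x)))"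
  proof
    fix x :: "real \<times> real"
    have "mehler_gen D w (fst x) s (snd x) * mehler_gen D v (fst x) s (snd x) =
        C * exp (mehler_exponent w (fst x) s (snd x) + mehler_exponent v (fst x) s (snd x))"
      by (simp only: mehler_gen_def C_def exp_add mult_ac)
    then show "mehler_gen D w (fst x) s (snd x) * mehler_gen D v (fst x) s (snd x) =
        (C * exp (- A * of_real (s\<^sup>2))) *
          exp (- A * of_real ((fst x)\<^sup>2) + (B * of_real s) * of_real (fst x * snd x))"
      unfolding ex by (simp only: exp_add[of "- A * of_real (s\<^sup>2)"] mult.assoc)
  qed
  then have "(\<integral>x. mehler_gen D w (fst x) s (snd x) * mehler_gen D v (fst x) s (snd x) \<partial>polar_measure D) =
    (C * exp (- A * of_real (s\<^sup>2))) *
       (of_real (polar_const D) * A powr of_real (- D / 2) * exp ((B * of_real s)\<^sup>2 / (4 * A)))"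
    by (simp only: integral_mult_right_zero integral_polar_gaussian[OF D ReA])
  also have "\<dots> = of_real (polar_const D) * (C * A powr of_real (- D / 2)) *
      exp ((B * of_real s)\<^sup>2 / (4 * A) - A * of_real (s\<^sup>2))"
    by (simp add: exp_diff exp_minus field_simps)
  also have "norm \<dots> \<le> polar_const D * norm (C * A powr of_real (- D / 2))"
    using Re0 polar_const_pos[OF D]
    by (simp add: norm_mult mult_left_le)
  \<comment> \<open>Principal powers of complex numbers need not multiply, but the moduli of powers
    with real exponent do; only the modulus is claimed.\<close>
  also have "norm (C * A powr of_real (- D / 2)) = norm (1 - w\<^sup>2 * v\<^sup>2) powr (- D / 2)"
  proof -
    have "norm (C * A powr of_real (- D / 2)) = norm (P * A) powr (- D / 2)"
      by (simp only: C_def norm_mult norm_powr_of_real P_def powr_mult[symmetric] norm_ge_zero mult_nonneg_nonneg mult.assoc)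
    also have "P * A = 1 - w\<^sup>2 * v\<^sup>2" using P0 by (simp add: A_def P_def[symmetric])
    finally show ?thesis .
  qed
  finally show ?thesis .
qed

section \<open>Cesaro kernels as Taylor coefficients\<close>

lemma of_real_gbinomial: "of_real (a gchoose k) = ((of_real a :: complex) gchoose k)"
  by (simp add: gbinomial_prod_rev)

lemma cesaro_A_power_series:
  fixes z :: complex
  assumes "norm z < 1"
  shows "(\<lambda>j. of_real (cesaro_A a j) * z ^ j) sums ((1 - z) powr of_real (- a - 1))"
proof -
  have e: "(of_real (- a - 1) gchoose j) * (- z) ^ j = of_real (cesaro_A a j) * z ^ j" for j
  proof -
    have "(of_real (- a - 1) gchoose j) = (- 1) ^ j * (of_real (cesaro_A a j) :: complex)"
    proof -
      have "(of_real (- a - 1) :: complex) = - of_real (a + 1)" by simp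
      then show ?thesis unfolding cesaro_A_def of_real_gbinomial
        by (simp only: gbinomial_minus) (simp add: algebra_simps)
    qed
    then show ?thesis by (simp add: uminus_power_if)
  qed
  have "(\<lambda>j. (of_real (- a - 1) gchoose j) * (- z) ^ j) sums (1 + (- z)) powr of_real (- a - 1)"
    by (rule gen_binomial_complex) (use assms in simp)
  then show ?thesis unfolding e by simp
qed

lemma mehler_gen_of_real:
  assumes w: "\<bar>w\<bar> < 1"
  shows "of_real (pi powr (- real d / 2)) * mehler_gen (real d) (of_real w) r s u = of_real (mehler d r s u w)"
proof -
  have w2: "0 < 1 - w\<^sup>2" using w by (simp add: abs_square_less_1)
  have pw: "(1 - (complex_of_real w)\<^sup>2) powr of_real (- real d / 2)
             = of_real ((1 - w\<^sup>2) powr (- real d / 2))"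
    using w2 powr_of_real[of "1 - w\<^sup>2" "- real d / 2"] by simp
  show ?thesis unfolding mehler_gen_def mehler_def mehler_exponent_def pw by (simp flip: exp_of_real)
qed

lemma holomorphic_mehler_gen: "(\<lambda>w. mehler_gen D w r s u) holomorphic_on ball 0 1"
  unfolding mehler_gen_def mehler_exponent_def
proof (intro holomorphic_intros)
  fix z :: complex assume "z \<in> ball 0 1"
  then have "Re (1 - z\<^sup>2) > 0" using unit_disc_nonzero(5) by simp
  then show "1 - z\<^sup>2 \<notin> \<real>\<^sub>\<le>\<^sub>0" "1 - z\<^sup>2 \<noteq> 0" "1 - z\<^sup>2 \<noteq> 0"
    by (auto simp: complex_nonpos_Reals_iff)
qed

text \<open>\<open>hermite_Phi\<close> is defined through real \<open>w\<close> only. The complex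
  Taylor coefficients are identified by separating real and imaginary parts on the real axis, where
  the generating function is real.\<close>

lemma hermite_Phi_power_series:
  fixes z :: complex
  assumes z: "norm z < 1"
  shows "(\<lambda>j. of_real (hermite_Phi d j r s u) * z ^ j) sums
           (of_real (pi powr (- real d / 2)) * mehler_gen (real d) z r s u)"
proof -
  define F where "F z = of_real (pi powr (- real d / 2)) * mehler_gen (real d) z r s u" for z
  define a where "a j = (deriv ^^ j) F 0 / fact j" for j
  have "F holomorphic_on ball 0 1"
    unfolding F_def by (intro holomorphic_intros holomorphic_mehler_gen)
  then have F: "(\<lambda>j. a j * z ^ j) sums F z" if "norm z < 1" for z
    using holomorphic_power_series[of F 0 1 z] that by (simp add: a_def)
  have real: "(\<lambda>j. a j * of_real (w ^ j)) sums of_real (mehler d r s u w)" if "\<bar>w\<bar> < 1" for w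
    unfolding mehler_gen_of_real[OF that, symmetric] using F[of "of_real w"] that by (simp add: F_def)
  have "(\<lambda>j. Re (a j)) = (\<lambda>j. hermite_Phi d j r s u)"
  proof (rule power_series_coeffs_unique[where g="mehler d r s u"])
    show "(\<lambda>j. Re (a j) * w ^ j) sums mehler d r s u w" if "\<bar>w\<bar> < 1" for w
      using sums_Re[OF real[OF that]] by simp
  qed (rule hermite_Phi_sums)
  moreover have "(\<lambda>j. Im (a j)) = (\<lambda>j. 0)"
  proof (rule power_series_coeffs_unique[where g="\<lambda>w. 0"])
    show "(\<lambda>j. Im (a j) * w ^ j) sums 0" if "\<bar>w\<bar> < 1" for w
      using sums_Im[OF real[OF that]] by simp
  qed simp
  ultimately have "a j = of_real (hermite_Phi d j r s u)" for j
    by (metis complex_eq_iff Re_complex_of_real Im_complex_of_real)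
  with F[OF z] show ?thesis by (simp add: F_def)
qed

text \<open>The weighted sum inside \<open>dunkl_kernel\<close>, with the factor
  \<open>cesaro_A \<delta> (N - 2 * j)\<close> already cancelled against the normalization of
  \<open>hermite_cesaro\<close>, and before integration in \<open>u\<close>.\<close>

definition cesaro_kernel :: "nat \<Rightarrow> real \<Rightarrow> real \<Rightarrow> nat \<Rightarrow> real \<Rightarrow> real \<Rightarrow> real \<Rightarrow> real" where
  "cesaro_kernel d \<delta> \<gamma> N r s u = (\<Sum>j=0..N div 2. cesaro_A (\<gamma> - 1) j *
      (\<Sum>i=0..N - 2 * j. cesaro_A \<delta> (N - 2 * j - i) * hermite_Phi d i r s u))"

lemma sum_even_indices:
  fixes f :: "nat \<Rightarrow> 'a::comm_monoid_add"
  shows "(\<Sum>n=0..N. if even n then f n else 0) = (\<Sum>j=0..N div 2. f (2 * j))"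
proof -
  have "(\<Sum>n=0..N. if even n then f n else 0) = (\<Sum>n\<in>{n\<in>{0..N}. even n}. f n)"
    by (rule sum.inter_filter[symmetric]) simp
  also have "\<dots> = (\<Sum>j=0..N div 2. f (2 * j))"
    by (rule sum.reindex_bij_witness[of _ "\<lambda>j. 2 * j" "\<lambda>n. n div 2"]) auto
  finally show ?thesis .
qed

definition cesaro_gen :: "real \<Rightarrow> real \<Rightarrow> complex \<Rightarrow> real \<Rightarrow> real \<Rightarrow> real \<Rightarrow> complex" where
  "cesaro_gen D \<delta> w r s u = (1 - w) powr of_real (- \<delta> - 1) * mehler_gen D w r s u"

lemma holomorphic_cesaro_gen: "(\<lambda>w. cesaro_gen D \<delta> w r s u) holomorphic_on ball 0 1"
  unfolding cesaro_gen_def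
proof (intro holomorphic_intros holomorphic_mehler_gen)
  fix z :: complex assume "z \<in> ball 0 1"
  then have "Re (1 - z) > 0" using unit_disc_nonzero(4) by simp
  then show "1 - z \<notin> \<real>\<^sub>\<le>\<^sub>0" by (auto simp: complex_nonpos_Reals_iff)
qed

text \<open>A Cauchy product of three series. The middle one contains only even powers, which
  produces the steps \<open>N - 2 * j\<close> and raises the dimension from \<open>d\<close> to
  \<open>d + 2\<gamma>\<close>. Formal power series take care of the convergence of the
  products.\<close>

lemma cesaro_kernel_eq_deriv:
  "of_real (cesaro_kernel d \<delta> \<gamma> N r s u) =
     of_real (pi powr (- real d / 2)) *
       ((deriv ^^ N) (\<lambda>w. cesaro_gen (real d + 2 * \<gamma>) \<delta> w r s u) 0 / fact N)"
proof -
  define a b c where "a = (\<lambda>z::complex. (1 - z) powr of_real (- \<delta> - 1))"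
    and "b = (\<lambda>z::complex. (1 - z\<^sup>2) powr of_real (- (\<gamma> - 1) - 1))"
    and "c = (\<lambda>z. of_real (pi powr (- real d / 2)) * mehler_gen (real d) z r s u)"
  define fa fb fc :: "complex fps" where
    "fa = Abs_fps (\<lambda>n. of_real (cesaro_A \<delta> n))"
    and "fb = Abs_fps (\<lambda>n. if even n then of_real (cesaro_A (\<gamma> - 1) (n div 2)) else 0)"
    and "fc = Abs_fps (\<lambda>n. of_real (hermite_Phi d n r s u))"
  have ev: "\<forall>\<^sub>F z::complex in nhds 0. norm z < 1"
    using eventually_nhds_in_open[of "ball 0 1" "0::complex"] by simp
  have "a has_fps_expansion fa"
    by (rule has_fps_expansionI, rule eventually_mono[OF ev])
       (unfold a_def fa_def fps_nth_Abs_fps, rule cesaro_A_power_series)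
  moreover have "c has_fps_expansion fc"
    by (rule has_fps_expansionI, rule eventually_mono[OF ev])
       (unfold c_def fc_def fps_nth_Abs_fps, rule hermite_Phi_power_series)
  moreover have "b has_fps_expansion fb"
  proof (rule has_fps_expansionI, rule eventually_mono[OF ev])
    fix z :: complex assume "norm z < 1"
    then have "norm (z\<^sup>2) < 1" by (simp add: norm_power abs_square_less_1)
    then have "(\<lambda>j. of_real (cesaro_A (\<gamma> - 1) j) * (z\<^sup>2) ^ j) sums b z"
      unfolding b_def by (rule cesaro_A_power_series)
    then have "(\<lambda>j. fb $ (2 * j) * z ^ (2 * j)) sums b z"
      by (simp add: fb_def power_mult)
    then show "(\<lambda>n. fb $ n * z ^ n) sums b z"
      by (subst (asm) sums_mono_reindex[where f="\<lambda>n. fb $ n * z ^ n"])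
         (auto simp: strict_mono_def fb_def elim!: evenE)
  qed
  ultimately have "(\<lambda>z. b z * (c z * a z)) has_fps_expansion (fb * (fc * fa))"
    by (intro has_fps_expansion_mult)
  moreover have "\<forall>\<^sub>F z in nhds 0. b z * (c z * a z) =
      of_real (pi powr (- real d / 2)) * cesaro_gen (real d + 2 * \<gamma>) \<delta> z r s u"
  proof (rule eventually_mono[OF ev])
    fix z :: complex assume "norm z < 1"
    then have "1 - z\<^sup>2 \<noteq> 0" by (rule unit_disc_nonzero)
    moreover have "complex_of_real (- (real d + 2 * \<gamma>) / 2) =
        of_real (- (\<gamma> - 1) - 1) + of_real (- real d / 2)"
      by (simp add: field_simps)
    ultimately have "(1 - z\<^sup>2) powr of_real (- (real d + 2 * \<gamma>) / 2) =
        (1 - z\<^sup>2) powr of_real (- (\<gamma> - 1) - 1) * (1 - z\<^sup>2) powr of_real (- real d / 2)"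
      by (simp only: powr_add)
    then show "b z * (c z * a z) =
        of_real (pi powr (- real d / 2)) * cesaro_gen (real d + 2 * \<gamma>) \<delta> z r s u"
      by (simp only: a_def b_def c_def cesaro_gen_def mehler_gen_def mult_ac)
  qed
  ultimately have 1: "(\<lambda>z. of_real (pi powr (- real d / 2)) * cesaro_gen (real d + 2 * \<gamma>) \<delta> z r s u)
      has_fps_expansion (fb * (fc * fa))"
    by (rule has_fps_expansion_cong[THEN iffD1, rotated -1]) auto
  have "(\<lambda>z. cesaro_gen (real d + 2 * \<gamma>) \<delta> z r s u) has_fps_expansion
      fps_expansion (\<lambda>z. cesaro_gen (real d + 2 * \<gamma>) \<delta> z r s u) 0"
    using holomorphic_cesaro_gen[of "real d + 2 * \<gamma>" \<delta> r s u]
    by (intro has_fps_expansion_fps_expansion[of "ball 0 1"]) auto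
  from has_fps_expansion_cmult_left[OF this, of "of_real (pi powr (- real d / 2))"] 1
  have "fb * (fc * fa) = fps_const (of_real (pi powr (- real d / 2))) *
      fps_expansion (\<lambda>z. cesaro_gen (real d + 2 * \<gamma>) \<delta> z r s u) 0"
    using fps_expansion_unique_complex by blast
  then have "(fb * (fc * fa)) $ N = of_real (pi powr (- real d / 2)) *
      ((deriv ^^ N) (\<lambda>w. cesaro_gen (real d + 2 * \<gamma>) \<delta> w r s u) 0 / fact N)"
    by (simp add: fps_expansion_def)
  moreover have "(fb * (fc * fa)) $ N = of_real (cesaro_kernel d \<delta> \<gamma> N r s u)"
  proof -
    define g where "g n = of_real (cesaro_A (\<gamma> - 1) (n div 2)) * (fc * fa) $ (N - n)" for n
    have "(fb * (fc * fa)) $ N = (\<Sum>n=0..N. if even n then g n else 0)"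
      unfolding fps_mult_nth[of fb] by (rule sum.cong) (auto simp: fb_def g_def)
    also have "\<dots> = (\<Sum>j=0..N div 2. g (2 * j))" by (rule sum_even_indices)
    also have "\<dots> = of_real (cesaro_kernel d \<delta> \<gamma> N r s u)"
      unfolding g_def fps_mult_nth fc_def fa_def fps_nth_Abs_fps cesaro_kernel_def
      by (simp add: mult.commute)
    finally show ?thesis .
  qed
  ultimately show ?thesis by simp
qed

text \<open>Cauchy's formula in the parameter \<open>t\<close>: the derivative of the path is
  \<open>2 pi i w\<close>, which absorbs one power, so the denominator has exponent \<open>N\<close>
  and not \<open>Suc N\<close>.\<close>

lemma deriv_funpow_circle_integral:
  assumes f: "f holomorphic_on ball 0 1" and \<rho>: "0 < \<rho>" "\<rho> < 1"
  shows "((\<lambda>t. f (circlepath 0 \<rho> t) / circlepath 0 \<rho> t ^ N) has_integral ((deriv ^^ N) f 0 / fact N)) {0..1}"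
proof -
  have "((\<lambda>w. f w / (w - 0) ^ Suc N) has_contour_integral (2 * pi * \<i> / fact N * (deriv ^^ N) f 0)) (circlepath 0 \<rho>)"
    using \<rho> by (intro Cauchy_has_contour_integral_higher_derivative_circlepath
        holomorphic_on_imp_continuous_on holomorphic_on_subset[OF f]) auto
  then have "((\<lambda>t. f (circlepath 0 \<rho> t) / circlepath 0 \<rho> t ^ Suc N *
      vector_derivative (circlepath 0 \<rho>) (at t)) has_integral (2 * pi * \<i> / fact N * (deriv ^^ N) f 0)) {0..1}"
    by (simp add: has_contour_integral)
  then have "((\<lambda>t. 1 / (2 * pi * \<i>) * (f (circlepath 0 \<rho> t) / circlepath 0 \<rho> t ^ Suc N *
      vector_derivative (circlepath 0 \<rho>) (at t))) has_integral
      1 / (2 * pi * \<i>) * (2 * pi * \<i> / fact N * (deriv ^^ N) f 0)) {0..1}"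
    by (rule has_integral_mult_right)
  moreover have "1 / (2 * pi * \<i>) * (f (circlepath 0 \<rho> t) / circlepath 0 \<rho> t ^ Suc N *
      vector_derivative (circlepath 0 \<rho>) (at t)) = f (circlepath 0 \<rho> t) / circlepath 0 \<rho> t ^ N" for t
  proof -
    have "vector_derivative (circlepath 0 \<rho>) (at t) = 2 * pi * \<i> * circlepath 0 \<rho> t"
      by (subst vector_derivative_circlepath) (simp add: circlepath mult_ac)
    moreover have "circlepath 0 \<rho> t \<noteq> 0" using \<rho> by (simp add: circlepath)
    ultimately show ?thesis by simp
  qed
  ultimately show ?thesis by simp
qed

section \<open>Estimates on a circle of radius close to one\<close>

lemma norm_one_minus_circle:
  fixes \<rho> \<phi> :: real
  shows "(norm (1 - of_real \<rho> * exp (\<i> * of_real \<phi>)))\<^sup>2 = (1 - \<rho>)\<^sup>2 + 4 * \<rho> * (sin (\<phi> / 2))\<^sup>2"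
proof -
  have cos: "cos \<phi> = 1 - 2 * (sin (\<phi> / 2))\<^sup>2"
    using cos_double_sin[of "\<phi> / 2"] by simp
  have "(norm (1 - of_real \<rho> * exp (\<i> * of_real \<phi>)))\<^sup>2 = (1 - \<rho> * cos \<phi>)\<^sup>2 + (\<rho> * sin \<phi>)\<^sup>2"
    unfolding cmod_power2 by (simp add: exp_Euler cos_of_real sin_of_real)
  also have "\<dots> = 1 - 2 * \<rho> * cos \<phi> + \<rho>\<^sup>2 * ((sin \<phi>)\<^sup>2 + (cos \<phi>)\<^sup>2)"
    unfolding distrib_left power_mult_distrib power2_diff by simp
  also have "\<dots> = 1 - 2 * \<rho> * (1 - 2 * (sin (\<phi> / 2))\<^sup>2) + \<rho>\<^sup>2"
    by (simp only: sin_cos_squared_add mult_1_right) (simp only: cos)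
  also have "\<dots> = (1 - \<rho>)\<^sup>2 + 4 * \<rho> * (sin (\<phi> / 2))\<^sup>2"
    unfolding power2_diff by (simp add: algebra_simps)
  finally show ?thesis .
qed

lemma jordan_sin_ge:
  fixes x :: real
  assumes "0 \<le> x" "x \<le> pi / 2"
  shows "2 / pi * x \<le> sin x"
proof (cases "x = 0")
  case False
  have "concave_on {0..pi} sin"
    unfolding concave_on_def
    by (rule f''_ge0_imp_convex[where f'="\<lambda>x. - cos x" and f''="\<lambda>x. sin x"])
       (auto intro!: derivative_eq_intros sin_ge_zero)
  moreover have "x = (1 - 2 / pi * x) *\<^sub>R 0 + (2 / pi * x) *\<^sub>R (pi / 2)" by simp
  moreover have "0 \<le> 2 / pi * x" "2 / pi * x \<le> 1" using assms by (auto simp: field_simps)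
  ultimately have "sin x \<ge> (1 - 2 / pi * x) * sin 0 + (2 / pi * x) * sin (pi / 2)"
    using assms concave_onD[of "{0..pi}" sin "2 / pi * x" 0 "pi / 2"] by auto
  then show ?thesis by simp
qed simp

lemma norm_one_minus_circle_ge:
  fixes \<rho> \<phi> :: real
  assumes \<rho>: "0 \<le> \<rho>" "\<rho> \<le> 1" and \<phi>: "\<bar>\<phi>\<bar> \<le> pi"
  shows "norm (1 - of_real \<rho> * exp (\<i> * of_real \<phi>)) \<ge> 2 * sqrt \<rho> / pi * \<bar>\<phi>\<bar>"
proof (rule power2_le_imp_le)
  have "2 / pi * (\<bar>\<phi>\<bar> / 2) \<le> sin (\<bar>\<phi>\<bar> / 2)" by (rule jordan_sin_ge) (use \<phi> in auto)
  then have "(\<bar>\<phi>\<bar> / pi)\<^sup>2 \<le> (sin (\<bar>\<phi>\<bar> / 2))\<^sup>2" by (intro power_mono) auto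
  also have "(sin (\<bar>\<phi>\<bar> / 2))\<^sup>2 = (sin (\<phi> / 2))\<^sup>2" by (cases "\<phi> \<ge> 0") auto
  finally have "4 * \<rho> * (\<bar>\<phi>\<bar> / pi)\<^sup>2 \<le> 4 * \<rho> * (sin (\<phi> / 2))\<^sup>2"
    using \<rho> by (intro mult_left_mono) auto
  moreover have "(2 * sqrt \<rho> / pi * \<bar>\<phi>\<bar>)\<^sup>2 = 4 * \<rho> * (\<bar>\<phi>\<bar> / pi)\<^sup>2"
    using \<rho> by (simp add: power_mult_distrib power_divide)
  ultimately show "(2 * sqrt \<rho> / pi * \<bar>\<phi>\<bar>)\<^sup>2 \<le> (norm (1 - of_real \<rho> * exp (\<i> * of_real \<phi>)))\<^sup>2"
    unfolding norm_one_minus_circle by (simp add: add_increasing)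
qed simp

lemma circlepath_0_exp: "circlepath 0 \<rho> t = of_real \<rho> * exp (\<i> * of_real (2 * pi * t))"
  by (simp add: circlepath mult_ac)

lemma norm_circlepath_0: "norm (circlepath 0 \<rho> t) = \<bar>\<rho>\<bar>"
  unfolding circlepath_0_exp norm_mult norm_exp_i_times by simp

lemma circlepath_reflect: "circlepath 0 \<rho> (1 - t) = cnj (circlepath 0 \<rho> t)"
proof -
  have "exp (2 * of_real pi * \<i> * of_real (1 - t)) = exp (2 * of_real pi * \<i>) * exp (- (2 * of_real pi * \<i> * of_real t))"
    by (subst exp_add[symmetric]) (simp add: right_diff_distrib)
  then show ?thesis
    by (simp add: circlepath exp_cnj)
qed

lemma norm_one_minus_circlepath:
  fixes \<rho> t :: real
  assumes \<rho>: "1 / 2 \<le> \<rho>" "\<rho> \<le> 1" and t: "0 \<le> t" "t \<le> 1 / 2"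
  shows "norm (1 - circlepath 0 \<rho> t) \<ge> 2 * t" "norm (1 - circlepath 0 \<rho> t) \<le> (1 - \<rho>) + 7 * t"
proof -
  have "1 / 2 \<le> sqrt \<rho>" using \<rho> by (intro real_le_rsqrt) (simp add: power2_eq_square)
  then have "2 * t \<le> 4 * sqrt \<rho> * t" using t by (intro mult_right_mono) auto
  also have "\<dots> = 2 * sqrt \<rho> / pi * \<bar>2 * pi * t\<bar>" using t by simp
  also have "\<dots> \<le> norm (1 - circlepath 0 \<rho> t)"
    unfolding circlepath_0_exp by (rule norm_one_minus_circle_ge) (use \<rho> t in auto)
  finally show "norm (1 - circlepath 0 \<rho> t) \<ge> 2 * t" .
  have "\<bar>sin (pi * t)\<bar> \<le> \<bar>pi * t\<bar>" by (rule abs_sin_x_le_abs_x)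
  then have "(sin (pi * t))\<^sup>2 \<le> (pi * t)\<^sup>2" by (simp add: abs_le_square_iff)
  then have "4 * \<rho> * (sin (pi * t))\<^sup>2 \<le> 4 * 1 * (pi * t)\<^sup>2"
    using \<rho> by (intro mult_mono) auto
  then have "(norm (1 - circlepath 0 \<rho> t))\<^sup>2 \<le> (1 - \<rho>)\<^sup>2 + (2 * pi * t)\<^sup>2"
    unfolding circlepath_0_exp norm_one_minus_circle by (simp add: power_mult_distrib)
  also have "\<dots> \<le> ((1 - \<rho>) + 2 * pi * t)\<^sup>2"
    unfolding power2_sum using \<rho> t by simp
  finally have "norm (1 - circlepath 0 \<rho> t) \<le> (1 - \<rho>) + 2 * pi * t"
    by (rule power2_le_imp_le) (use \<rho> t in simp)
  \<comment> \<open>7 exceeds 2\<pi>; together with a radius gap of at most \<tau> it accounts for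
    the factor 8 in the definition of admissible arcs.\<close>
  also have "2 * pi * t \<le> 7 * t" using pi_approx(2) t by (intro mult_right_mono) auto
  finally show "norm (1 - circlepath 0 \<rho> t) \<le> (1 - \<rho>) + 7 * t" by simp
qed

lemma norm_one_minus_ge:
  fixes z :: "'a :: real_normed_algebra_1"
  assumes "norm z \<le> c"
  shows "norm (1 - z) \<ge> 1 - c"
  using norm_triangle_ineq2[of 1 z] assms by simp

text \<open>The argument of the product is \<open>4 pi (t - t')\<close>; for
  \<open>|t - t'| <= 1/4\<close> it stays in \<open>[-pi, pi]\<close>, where the chord controls the
  angle. This is why arcs have length at most 1/4. The position on the circle is irrelevant, so
  \<open>w = -1\<close> is not special.\<close>

lemma norm_one_minus_circlepath_product:
  fixes \<rho> t t' :: real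
  assumes \<rho>: "1 / 2 \<le> \<rho>" "\<rho> \<le> 1" and t: "\<bar>t - t'\<bar> \<le> 1 / 4"
  shows "norm (1 - (circlepath 0 \<rho> t)\<^sup>2 * (cnj (circlepath 0 \<rho> t'))\<^sup>2) \<ge> ((1 - \<rho>) + \<bar>t - t'\<bar>) / 2"
proof -
  have e: "(circlepath 0 \<rho> t)\<^sup>2 * (cnj (circlepath 0 \<rho> t'))\<^sup>2 = of_real (\<rho> ^ 4) * exp (\<i> * of_real (4 * pi * (t - t')))"
  proof -
    have "exp (\<i> * of_real (4 * pi * (t - t'))) =
      (exp (\<i> * of_real (2 * pi * t)))\<^sup>2 * (exp (- (\<i> * of_real (2 * pi * t'))))\<^sup>2"
      by (simp flip: exp_double exp_add) (simp add: algebra_simps)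
    then show ?thesis
      unfolding circlepath_0_exp by (simp add: exp_cnj power_mult_distrib eval_nat_numeral mult_ac)
  qed
  have "\<rho>\<^sup>2 \<ge> (1 / 2)\<^sup>2" using \<rho> by (intro power_mono) auto
  then have r2: "sqrt (\<rho> ^ 4) \<ge> 1 / 4" 
    using real_sqrt_abs[of "\<rho>\<^sup>2"] by (simp add: power_divide flip: power_mult)
  have "\<bar>t - t'\<bar> \<le> 8 * sqrt (\<rho> ^ 4) * \<bar>t - t'\<bar>" using r2 by (simp add: mult_le_cancel_right1)
  also have "\<dots> = 2 * sqrt (\<rho> ^ 4) / pi * \<bar>4 * pi * (t - t')\<bar>" by (simp add: abs_mult)
  also have "\<dots> \<le> norm (1 - of_real (\<rho> ^ 4) * exp (\<i> * of_real (4 * pi * (t - t'))))"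
    by (rule norm_one_minus_circle_ge) (use \<rho> t in \<open>auto simp: abs_mult power_le_one\<close>)
  finally have 1: "\<bar>t - t'\<bar> \<le> norm (1 - of_real (\<rho> ^ 4) * exp (\<i> * of_real (4 * pi * (t - t'))))" .
  have "\<rho> ^ 4 \<le> \<rho> ^ 1" using \<rho> by (intro power_decreasing) auto
  then have "norm (of_real (\<rho> ^ 4) * exp (\<i> * of_real (4 * pi * (t - t')))) \<le> \<rho>"
    unfolding norm_mult norm_exp_i_times using \<rho> by (simp add: norm_power)
  then have 2: "1 - \<rho> \<le> norm (1 - of_real (\<rho> ^ 4) * exp (\<i> * of_real (4 * pi * (t - t'))))"
    by (rule norm_one_minus_ge)
  from 1 2 show ?thesis unfolding e by simp
qed

text \<open>A single term of the exponential series suffices, of an index \<open>m\<close> at least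
  \<open>p / q\<close>.\<close>

lemma powr_exp_bounded:
  fixes p q c :: real
  assumes "q > 0" "c > 0"
  shows "\<exists>C>0. \<forall>x\<ge>1. x powr p * exp (- c * x powr q) \<le> C"
proof -
  define m where "m = nat \<lceil>p / q\<rceil>"
  have m: "p \<le> q * real m"
  proof -
    have "p / q \<le> real m" unfolding m_def by linarith
    then show ?thesis using assms by (simp add: field_simps)
  qed
  have "x powr p * exp (- c * x powr q) \<le> fact m / c ^ m" if x: "x \<ge> 1" for x
  proof -
    have "(c * x powr q) ^ m / fact m \<le> exp (c * x powr q)"
      using assms sum_le_suminf[OF summable_exp_generic[of "c * x powr q"], of "{m}"]
      by (simp add: exp_def divide_inverse mult.commute)
    moreover have "(x powr q) ^ m = x powr (q * real m)"
      using x by (simp add: powr_powr flip: powr_realpow)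
    ultimately have "c ^ m * x powr (q * real m) \<le> fact m * exp (c * x powr q)"
      by (simp add: power_mult_distrib field_simps)
    moreover have "c ^ m * x powr p \<le> c ^ m * x powr (q * real m)"
      using x m assms by (intro mult_left_mono powr_mono) auto
    ultimately have "c ^ m * x powr p \<le> fact m * exp (c * x powr q)" by simp
    then show ?thesis using assms by (simp add: exp_minus field_simps)
  qed
  then show ?thesis using assms by (intro exI[of _ "fact m / c ^ m"]) auto
qed

text \<open>For \<open>D = 2\<close> the inner products have size \<open>1 / |t - t'|\<close>, which
  integrates to a logarithm; the exponent \<open>\<epsilon> - 1\<close> replaces it by a small
  power.\<close>

lemma nn_integral_powr_singularity:
  fixes a b t \<eta> \<epsilon> :: real
  assumes t: "a \<le> t" "t \<le> b" and \<eta>: "\<eta> > 0" and \<epsilon>: "\<epsilon> > 0"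
  shows "(\<integral>\<^sup>+t'. ennreal (indicator {a..b} t' * (\<eta> + \<bar>t - t'\<bar>) powr (\<epsilon> - 1)) \<partial>lborel)
     \<le> ennreal (2 / \<epsilon> * (\<eta> + (b - a)) powr \<epsilon>)"
proof -
  have A: "((\<lambda>x. (\<eta> + \<bar>t - x\<bar>) powr (\<epsilon> - 1)) has_integral ((\<eta> + (t - a)) powr \<epsilon> / \<epsilon> - \<eta> powr \<epsilon> / \<epsilon>)) {a..t}"
  proof -
    have "((\<lambda>x. (\<eta> + (t - x)) powr (\<epsilon> - 1)) has_integral
        (- ((\<eta> + (t - t)) powr \<epsilon> / \<epsilon>) - - ((\<eta> + (t - a)) powr \<epsilon> / \<epsilon>))) {a..t}"
      by (rule fundamental_theorem_of_calculus)
         (use t \<eta> \<epsilon> in \<open>auto intro!: derivative_eq_intros simp flip: has_real_derivative_iff_has_vector_derivative\<close>)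
    then have "((\<lambda>x. (\<eta> + (t - x)) powr (\<epsilon> - 1)) has_integral
        ((\<eta> + (t - a)) powr \<epsilon> / \<epsilon> - \<eta> powr \<epsilon> / \<epsilon>)) {a..t}" by simp
    then show ?thesis by (rule has_integral_eq[rotated]) auto
  qed
  have B: "((\<lambda>x. (\<eta> + \<bar>t - x\<bar>) powr (\<epsilon> - 1)) has_integral ((\<eta> + (b - t)) powr \<epsilon> / \<epsilon> - \<eta> powr \<epsilon> / \<epsilon>)) {t..b}"
  proof -
    have "((\<lambda>x. (\<eta> + (x - t)) powr (\<epsilon> - 1)) has_integral
        ((\<eta> + (b - t)) powr \<epsilon> / \<epsilon> - (\<eta> + (t - t)) powr \<epsilon> / \<epsilon>)) {t..b}"
      by (rule fundamental_theorem_of_calculus)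
         (use t \<eta> \<epsilon> in \<open>auto intro!: derivative_eq_intros simp flip: has_real_derivative_iff_has_vector_derivative\<close>)
    then have "((\<lambda>x. (\<eta> + (x - t)) powr (\<epsilon> - 1)) has_integral
        ((\<eta> + (b - t)) powr \<epsilon> / \<epsilon> - \<eta> powr \<epsilon> / \<epsilon>)) {t..b}" by simp
    then show ?thesis by (rule has_integral_eq[rotated]) auto
  qed
  define I where "I = ((\<eta> + (t - a)) powr \<epsilon> / \<epsilon> - \<eta> powr \<epsilon> / \<epsilon>) + ((\<eta> + (b - t)) powr \<epsilon> / \<epsilon> - \<eta> powr \<epsilon> / \<epsilon>)"
  have "((\<lambda>x. (\<eta> + \<bar>t - x\<bar>) powr (\<epsilon> - 1)) has_integral I) {a..b}"
    unfolding I_def by (rule has_integral_combine[OF t A B])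
  from nn_integral_has_integral_lebesgue[OF _ this]
  have "(\<integral>\<^sup>+t'. ennreal (indicator {a..b} t' * (\<eta> + \<bar>t - t'\<bar>) powr (\<epsilon> - 1)) \<partial>lborel) = ennreal I" by simp
  moreover have "I \<le> 2 / \<epsilon> * (\<eta> + (b - a)) powr \<epsilon>"
  proof -
    have "(\<eta> + (t - a)) powr \<epsilon> / \<epsilon> \<le> (\<eta> + (b - a)) powr \<epsilon> / \<epsilon>" "(\<eta> + (b - t)) powr \<epsilon> / \<epsilon> \<le> (\<eta> + (b - a)) powr \<epsilon> / \<epsilon>"
      using t \<eta> \<epsilon> by (auto intro!: divide_right_mono powr_mono2)
    moreover have "\<eta> powr \<epsilon> / \<epsilon> \<ge> 0" using \<epsilon> by simp
    ultimately show ?thesis unfolding I_def by simp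
  qed
  ultimately show ?thesis by (simp add: ennreal_leI)
qed

section \<open>The circle of integration and the integrand on it\<close>

definition circle_gap :: "nat \<Rightarrow> real" where
  "circle_gap N = 1 / (real N + 2)"

definition circle_pt :: "nat \<Rightarrow> real \<Rightarrow> complex" where
  "circle_pt N t = circlepath 0 (1 - circle_gap N) t"

definition circle_integrand :: "real \<Rightarrow> real \<Rightarrow> nat \<Rightarrow> real \<Rightarrow> real \<Rightarrow> real \<times> real \<Rightarrow> complex" where
  "circle_integrand D \<delta> N s t x =
     cesaro_gen D \<delta> (circle_pt N t) (fst x) s (snd x) / circle_pt N t ^ N"

text \<open>The offset 2 in \<open>circle_gap\<close> keeps the radius at least 1/2 even for
  \<open>N = 0\<close>.\<close>

lemma circle_gap_bounds: "0 < circle_gap N" "circle_gap N \<le> 1 / 2"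
  by (auto simp: circle_gap_def field_simps)

lemma norm_circle_pt: "norm (circle_pt N t) = 1 - circle_gap N"
  using circle_gap_bounds[of N] by (simp add: circle_pt_def norm_circlepath_0)

lemma norm_circle_pt_less_1: "norm (circle_pt N t) < 1"
  using circle_gap_bounds[of N] by (simp add: norm_circle_pt)

text \<open>A gap of order \<open>1/N\<close> is what makes division by \<open>w^N\<close> cost only
  a constant: the inverse radius is \<open>1 + 1/(N+1)\<close>, whose N-th power stays below
  \<open>e\<close>.\<close>

lemma inverse_norm_circle_pt_power_le: "1 / norm (circle_pt N t) ^ N \<le> 4"
proof -
  have "1 / (1 - circle_gap N) = 1 + 1 / (real N + 1)"
    by (simp add: circle_gap_def field_simps)
  also have "\<dots> \<le> exp (1 / (real N + 1))" by (rule exp_ge_add_one_self)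
  finally have "(1 / (1 - circle_gap N)) ^ N \<le> exp (1 / (real N + 1)) ^ N"
    using circle_gap_bounds[of N] by (intro power_mono) auto
  also have "\<dots> = exp (real N / (real N + 1))" by (simp flip: exp_of_nat_mult)
  also have "\<dots> \<le> exp 1" by simp
  also have "\<dots> \<le> 4" using exp_le by simp
  finally show ?thesis by (simp add: norm_circle_pt power_divide)
qed

lemma norm_circle_pt_square_le: "norm ((circle_pt N t)\<^sup>2) \<le> 1 - circle_gap N"
  using power_decreasing[of 1 2 "1 - circle_gap N"] circle_gap_bounds[of N]
  by (simp add: norm_power norm_circle_pt)

lemma one_minus_circle_pt_bounds:
  "circle_gap N \<le> norm (1 - circle_pt N t)" "circle_gap N \<le> norm (1 - (circle_pt N t)\<^sup>2)"
  "norm (1 - circle_pt N t) \<le> 2" "norm (1 - (circle_pt N t)\<^sup>2) \<le> 2"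
proof -
  note g = circle_gap_bounds[of N]
  show "circle_gap N \<le> norm (1 - circle_pt N t)"
    using norm_one_minus_ge[of "circle_pt N t" "1 - circle_gap N"] by (simp add: norm_circle_pt)
  from norm_one_minus_ge[OF norm_circle_pt_square_le] show "circle_gap N \<le> norm (1 - (circle_pt N t)\<^sup>2)" by simp
  show "norm (1 - circle_pt N t) \<le> 2"
    using norm_triangle_ineq4[of 1 "circle_pt N t"] g by (simp add: norm_circle_pt)
  show "norm (1 - (circle_pt N t)\<^sup>2) \<le> 2"
    using norm_triangle_ineq4[of 1 "(circle_pt N t)\<^sup>2"] norm_circle_pt_square_le[of N t] g by simp
qed

lemma continuous_on_circle_pt [continuous_intros]:
  "continuous_on A T \<Longrightarrow> continuous_on A (\<lambda>z. circle_pt N (T z))"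
  unfolding circle_pt_def circlepath_0_exp by (intro continuous_intros)

text \<open>Stated with all four variables moving, since it supplies the measurability in
  \<open>(t, x)\<close> as well as in \<open>((r, s), u)\<close> and \<open>t\<close>.\<close>

lemma continuous_on_circle_integrand:
  assumes "continuous_on A T" "continuous_on A R" "continuous_on A S" "continuous_on A U"
  shows "continuous_on A (\<lambda>z. circle_integrand D \<delta> N (S z) (T z) (R z, U z))"
proof -
  have *: "Re (1 - circle_pt N t) \<ge> 0" "Re (1 - (circle_pt N t)\<^sup>2) \<ge> 0"
    "1 - circle_pt N t \<noteq> 0" "1 - (circle_pt N t)\<^sup>2 \<noteq> 0" "circle_pt N t \<noteq> 0" for t
    using unit_disc_nonzero[OF norm_circle_pt_less_1[of N t]] norm_circle_pt[of N t] circle_gap_bounds[of N]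
    by (auto intro: less_imp_le)
  show ?thesis
    unfolding circle_integrand_def cesaro_gen_def mehler_gen_def mehler_exponent_def fst_conv snd_conv
    by (intro continuous_intros assms) (use * in \<open>auto simp del: minus_complex.sel one_complex.sel\<close>)
qed

lemma borel_measurable_circle_integrand:
  "(\<lambda>(t, x). circle_integrand D \<delta> N s t x) \<in> borel_measurable (borel \<Otimes>\<^sub>M borel)"
proof -
  have "continuous_on UNIV (\<lambda>z. circle_integrand D \<delta> N s (fst z) (fst (snd z), snd (snd z)))"
    by (intro continuous_on_circle_integrand continuous_intros)
  then show ?thesis by (simp add: borel_prod case_prod_beta' borel_measurable_continuous_onI)
qed

lemma norm_circle_integrand_le:
  assumes u: "\<bar>snd x\<bar> \<le> 1"
  shows "norm (circle_integrand D \<delta> N s t x) \<le> 4 * norm (1 - circle_pt N t) powr (- \<delta> - 1) *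
     norm (1 - (circle_pt N t)\<^sup>2) powr (- D / 2) *
     exp (- (circle_gap N / (4 * (norm (1 - circle_pt N t))\<^sup>2)) * ((fst x)\<^sup>2 + s\<^sup>2 - 2 * fst x * s * snd x))"
proof -
  let ?w = "circle_pt N t" and ?q = "(fst x)\<^sup>2 + s\<^sup>2 - 2 * fst x * s * snd x"
  note g = circle_gap_bounds[of N]
  have q: "?q \<ge> 0" by (rule chord_square_nonneg[OF u])
  have "circle_gap N \<le> 1 - (norm ?w)\<^sup>2"
    using norm_circle_pt_square_le[of N t] by (simp add: norm_power)
  then have "circle_gap N / (4 * (norm (1 - ?w))\<^sup>2) * ?q \<le> (1 / 4) * ((1 - (norm ?w)\<^sup>2) / (norm (1 - ?w))\<^sup>2) * ?q"
    by (intro mult_right_mono[OF _ q]) (simp add: divide_right_mono)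
  then have e: "norm (exp (mehler_exponent ?w (fst x) s (snd x))) \<le> exp (- (circle_gap N / (4 * (norm (1 - ?w))\<^sup>2)) * ?q)"
    by (intro order_trans[OF norm_exp_mehler_exponent_le[OF norm_circle_pt_less_1 u]]) simp
  have "norm (circle_integrand D \<delta> N s t x) = (1 / norm ?w ^ N) * (norm (1 - ?w) powr (- \<delta> - 1) *
      (norm (1 - ?w\<^sup>2) powr (- D / 2) * norm (exp (mehler_exponent ?w (fst x) s (snd x)))))"
    unfolding circle_integrand_def cesaro_gen_def mehler_gen_def norm_divide norm_mult norm_power norm_powr_of_real
    by simp
  also have "\<dots> \<le> 4 * (norm (1 - ?w) powr (- \<delta> - 1) *
      (norm (1 - ?w\<^sup>2) powr (- D / 2) * exp (- (circle_gap N / (4 * (norm (1 - ?w))\<^sup>2)) * ?q)))"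
    by (intro mult_mono inverse_norm_circle_pt_power_le e order_refl) auto
  finally show ?thesis by (simp only: mult.assoc)
qed

text \<open>Purely qualitative: \<open>h\<close> depends badly on \<open>N\<close> and
  \<open>s\<close> and serves only to justify Fubini. The cross term is handled by
  \<open>exp |y| <= exp y + exp (-y)\<close>.\<close>

lemma circle_integrand_dominated:
  assumes D: "D > 1" and \<delta>: "\<delta> > 0"
  shows "\<exists>h. integrable (polar_measure D) (\<lambda>x. (h x)\<^sup>2) \<and> (\<forall>t x. norm (circle_integrand D \<delta> N s t x) \<le> h x)"
proof -
  define \<eta> where "\<eta> = circle_gap N"
  have g: "0 < \<eta>" "\<eta> \<le> 1 / 2" using circle_gap_bounds[of N] by (auto simp: \<eta>_def)
  define B where "B = 4 * (\<eta> powr (- \<delta> - 1) * \<eta> powr (- D / 2))"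
  define E where "E b x = exp (- (\<eta> / 8) * (fst x)\<^sup>2 + b * fst x * snd x)" for b and x :: "real \<times> real"
  define b where "b = 2 / \<eta> * s"
  define h where "h x = B * (E b x + E (- b) x)" for x
  have B: "B \<ge> 0" by (simp add: B_def)
  have bound: "norm (circle_integrand D \<delta> N s t x) \<le> h x" for t x
  proof -
    let ?w = "circle_pt N t"
    have w2: "norm (?w\<^sup>2) < 1" using norm_circle_pt_less_1[of N t] by (simp add: norm_power abs_square_less_1)
    have le: "norm (?w\<^sup>2) \<le> 1 - \<eta>"
      using norm_circle_pt_square_le by (simp add: \<eta>_def)
    have Rea: "Re ((1 + ?w\<^sup>2) / (1 - ?w\<^sup>2)) \<ge> \<eta> / 4"
    proof -
      have "Re ((1 + ?w\<^sup>2) / (1 - ?w\<^sup>2)) = (1 - (norm (?w\<^sup>2))\<^sup>2) / (norm (1 - ?w\<^sup>2))\<^sup>2"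
        using w2 by (intro Re_cayley) auto
      moreover have "\<eta> / 2\<^sup>2 \<le> (1 - (norm (?w\<^sup>2))\<^sup>2) / (norm (1 - ?w\<^sup>2))\<^sup>2"
      proof (rule frac_le)
        have "(norm (?w\<^sup>2))\<^sup>2 \<le> norm (?w\<^sup>2)"
          unfolding power2_eq_square[of "norm (?w\<^sup>2)"] using w2 by (intro mult_left_le) auto
        then show "\<eta> \<le> 1 - (norm (?w\<^sup>2))\<^sup>2" using le by simp
        show "(norm (1 - ?w\<^sup>2))\<^sup>2 \<le> 2\<^sup>2" using one_minus_circle_pt_bounds(4)[of N t] by (intro power_mono) auto
        show "0 < (norm (1 - ?w\<^sup>2))\<^sup>2" using unit_disc_nonzero(3)[OF norm_circle_pt_less_1[of N t]] by simp
        show "0 \<le> 1 - (norm (?w\<^sup>2))\<^sup>2" using w2 by (simp add: abs_square_le_1)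
      qed
      ultimately show ?thesis by simp
    qed
    have Imb: "\<bar>Re (2 * ?w / (1 - ?w\<^sup>2))\<bar> \<le> 2 / \<eta>"
    proof -
      have "norm (2 * ?w / (1 - ?w\<^sup>2)) \<le> 2 * 1 / \<eta>"
        unfolding norm_divide norm_mult
        using norm_circle_pt_less_1[of N t] one_minus_circle_pt_bounds(2)[of N t] g
        by (intro frac_le mult_mono) (auto simp: \<eta>_def)
      then show ?thesis using abs_Re_le_cmod[of "2 * ?w / (1 - ?w\<^sup>2)"] by simp
    qed
    have "Re (mehler_exponent ?w (fst x) s (snd x)) =
        - (1 / 2) * Re ((1 + ?w\<^sup>2) / (1 - ?w\<^sup>2)) * ((fst x)\<^sup>2 + s\<^sup>2)
        + Re (2 * ?w / (1 - ?w\<^sup>2)) * (s * fst x * snd x)"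
    proof -
      have "Re (- (1 / 2) * a * of_real y + c * of_real r * of_real s' * of_real u) =
         - (1 / 2) * Re a * y + Re c * (s' * r * u)" for a c y r s' u
        by (simp add: algebra_simps)
      then show ?thesis unfolding mehler_exponent_def .
    qed
    also have "- (1 / 2) * Re ((1 + ?w\<^sup>2) / (1 - ?w\<^sup>2)) * ((fst x)\<^sup>2 + s\<^sup>2) \<le> - (\<eta> / 8) * (fst x)\<^sup>2"
    proof -
      have "\<eta> / 4 * (fst x)\<^sup>2 \<le> Re ((1 + ?w\<^sup>2) / (1 - ?w\<^sup>2)) * ((fst x)\<^sup>2 + s\<^sup>2)"
        using Rea g by (intro mult_mono) auto
      then show ?thesis by simp
    qed
    also have "Re (2 * ?w / (1 - ?w\<^sup>2)) * (s * fst x * snd x) \<le> \<bar>b * fst x * snd x\<bar>"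
    proof -
      have "Re (2 * ?w / (1 - ?w\<^sup>2)) * (s * fst x * snd x) \<le> \<bar>Re (2 * ?w / (1 - ?w\<^sup>2))\<bar> * \<bar>s * fst x * snd x\<bar>"
        using abs_ge_self[of "Re (2 * ?w / (1 - ?w\<^sup>2)) * (s * fst x * snd x)"] by (simp only: abs_mult)
      also have "\<dots> \<le> 2 / \<eta> * \<bar>s * fst x * snd x\<bar>" by (intro mult_right_mono Imb) auto
      also have "\<dots> = \<bar>b * fst x * snd x\<bar>" using g by (simp add: b_def abs_mult)
      finally show ?thesis .
    qed
    finally have "norm (exp (mehler_exponent ?w (fst x) s (snd x))) \<le> exp (- (\<eta> / 8) * (fst x)\<^sup>2 + \<bar>b * fst x * snd x\<bar>)"
      by simp
    also have "\<dots> \<le> E b x + E (- b) x"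
      unfolding E_def by (auto simp: abs_if intro: add_increasing add_increasing2)
    finally have e: "norm (exp (mehler_exponent ?w (fst x) s (snd x))) \<le> E b x + E (- b) x" .
    have "norm (circle_integrand D \<delta> N s t x) = (1 / norm ?w ^ N) * ((norm (1 - ?w) powr (- \<delta> - 1) *
        norm (1 - ?w\<^sup>2) powr (- D / 2)) * norm (exp (mehler_exponent ?w (fst x) s (snd x))))"
      unfolding circle_integrand_def cesaro_gen_def mehler_gen_def norm_divide norm_mult norm_power norm_powr_of_real
      by simp
    also have "\<dots> \<le> 4 * ((\<eta> powr (- \<delta> - 1) * \<eta> powr (- D / 2)) * (E b x + E (- b) x))"
      using one_minus_circle_pt_bounds[of N t] g D \<delta>
      by (intro mult_mono inverse_norm_circle_pt_power_le e powr_mono2') (auto simp: \<eta>_def)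
    finally show ?thesis by (simp only: h_def B_def mult.assoc)
  qed
  have "integrable (polar_measure D) (\<lambda>x. (h x)\<^sup>2)"
  proof (rule Bochner_Integration.integrable_bound)
    have E2: "(E c x)\<^sup>2 = exp (- (\<eta> / 4) * (fst x)\<^sup>2 + (2 * c) * fst x * snd x)" for c x
      by (simp add: E_def exp_double[symmetric] algebra_simps)
    show "integrable (polar_measure D) (\<lambda>x. 2 * B\<^sup>2 * ((E b x)\<^sup>2 + (E (- b) x)\<^sup>2))"
      unfolding E2 using D g
      by (intro integrable_mult_right Bochner_Integration.integrable_add integrable_polar_gaussian_real) auto
    show "AE x in polar_measure D. norm ((h x)\<^sup>2) \<le> norm (2 * B\<^sup>2 * ((E b x)\<^sup>2 + (E (- b) x)\<^sup>2))"
    proof (rule AE_I2)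
      fix x
      have "0 \<le> (E b x - E (- b) x)\<^sup>2" by simp
      then have "(E b x + E (- b) x)\<^sup>2 \<le> 2 * ((E b x)\<^sup>2 + (E (- b) x)\<^sup>2)" by (simp add: power2_sum power2_diff)
      then have "B\<^sup>2 * (E b x + E (- b) x)\<^sup>2 \<le> 2 * B\<^sup>2 * ((E b x)\<^sup>2 + (E (- b) x)\<^sup>2)"
        using mult_left_mono[of "(E b x + E (- b) x)\<^sup>2" "2 * ((E b x)\<^sup>2 + (E (- b) x)\<^sup>2)" "B\<^sup>2"]
        by (simp add: algebra_simps)
      then show "norm ((h x)\<^sup>2) \<le> norm (2 * B\<^sup>2 * ((E b x)\<^sup>2 + (E (- b) x)\<^sup>2))"
        by (simp add: h_def power_mult_distrib)
    qed
  qed (auto simp: h_def E_def)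
  with bound show ?thesis by blast
qed

section \<open>Kernels of arcs\<close>

lemma cnj_mehler_gen:
  assumes "norm w < 1"
  shows "cnj (mehler_gen D w r s u) = mehler_gen D (cnj w) r s u"
proof -
  have "Re (1 - w\<^sup>2) > 0" using unit_disc_nonzero(5)[OF assms] .
  then have "cnj ((1 - w\<^sup>2) powr of_real (- D / 2)) = (1 - (cnj w)\<^sup>2) powr of_real (- D / 2)"
    by (subst cnj_powr) auto
  then show ?thesis by (simp add: mehler_gen_def mehler_exponent_def exp_cnj)
qed

text \<open>Conjugation carries the kernel at time \<open>v\<close> into the one at
  \<open>cnj v\<close>, so the semigroup law applies to \<open>w\<close> and
  \<open>cnj v\<close>.\<close>

lemma norm_inner_circle_integrand_le:
  assumes D: "D > 1"
  shows "norm (\<integral>x. circle_integrand D \<delta> N s t x * cnj (circle_integrand D \<delta> N s t' x) \<partial>polar_measure D) \<le>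
    16 * norm (1 - circle_pt N t) powr (- \<delta> - 1) * norm (1 - circle_pt N t') powr (- \<delta> - 1) *
      (polar_const D * norm (1 - (circle_pt N t)\<^sup>2 * (cnj (circle_pt N t'))\<^sup>2) powr (- D / 2))"
proof -
  let ?w = "circle_pt N t" and ?v = "circle_pt N t'"
  define c where "c w = (1 - w) powr of_real (- \<delta> - 1) / w ^ N" for w :: complex
  have cb: "norm (c (circle_pt N t)) \<le> 4 * norm (1 - circle_pt N t) powr (- \<delta> - 1)" for t
    unfolding c_def norm_divide norm_power norm_powr_of_real
    using mult_right_mono[OF inverse_norm_circle_pt_power_le[of N t], of "norm (1 - circle_pt N t) powr (- \<delta> - 1)"]
    by simp
  have v: "norm ?v < 1" "norm (cnj ?v) < 1" using norm_circle_pt_less_1[of N t'] by simp_all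
  have "circle_integrand D \<delta> N s t x * cnj (circle_integrand D \<delta> N s t' x) =
      (c ?w * cnj (c ?v)) * (mehler_gen D ?w (fst x) s (snd x) * mehler_gen D (cnj ?v) (fst x) s (snd x))" for x
    unfolding cnj_mehler_gen[OF v(1), symmetric] circle_integrand_def cesaro_gen_def c_def by simp
  then have "norm (\<integral>x. circle_integrand D \<delta> N s t x * cnj (circle_integrand D \<delta> N s t' x) \<partial>polar_measure D) =
      norm (c ?w) * norm (c ?v) * norm (\<integral>x. mehler_gen D ?w (fst x) s (snd x) * mehler_gen D (cnj ?v) (fst x) s (snd x) \<partial>polar_measure D)"
    by (simp add: norm_mult)
  also have "\<dots> \<le> (4 * norm (1 - ?w) powr (- \<delta> - 1)) * (4 * norm (1 - ?v) powr (- \<delta> - 1)) *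
      (polar_const D * norm (1 - ?w\<^sup>2 * (cnj ?v)\<^sup>2) powr (- D / 2))"
    by (intro mult_mono cb integral_mehler_gen_product D v norm_circle_pt_less_1) auto
  finally show ?thesis by simp
qed

text \<open>A density on the whole line rather than a restricted space, so that its measurable sets
  are all Borel sets while the measure is finite.\<close>

definition interval_lborel :: "real \<Rightarrow> real \<Rightarrow> real measure" where
  "interval_lborel a b = density lborel (\<lambda>t. ennreal (indicator {a..b} t))"

lemma sets_interval_lborel [measurable_cong, simp]: "sets (interval_lborel a b) = sets borel"
  by (simp add: interval_lborel_def)

lemma nn_integral_interval_lborel:
  "f \<in> borel_measurable borel \<Longrightarrow>
    (\<integral>\<^sup>+t. f t \<partial>interval_lborel a b) = (\<integral>\<^sup>+t. ennreal (indicator {a..b} t) * f t \<partial>lborel)"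
  by (simp add: interval_lborel_def nn_integral_density)

lemma AE_interval_lborel: "AE t in interval_lborel a b. t \<in> {a..b}"
  unfolding interval_lborel_def by (subst AE_density) (auto simp: indicator_def)

lemma emeasure_interval_lborel:
  "a \<le> b \<Longrightarrow> emeasure (interval_lborel a b) (space (interval_lborel a b)) = ennreal (b - a)"
  by (simp add: interval_lborel_def emeasure_density ennreal_indicator)

lemma finite_interval_lborel: "a \<le> b \<Longrightarrow> finite_measure (interval_lborel a b)"
  by (rule finite_measureI) (simp add: emeasure_interval_lborel)

definition arc_kernel :: "real \<Rightarrow> real \<Rightarrow> nat \<Rightarrow> real \<Rightarrow> real \<Rightarrow> real \<Rightarrow> real \<times> real \<Rightarrow> complex" where
  "arc_kernel D \<delta> N s a b x = (\<integral>t. circle_integrand D \<delta> N s t x \<partial>interval_lborel a b)"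

lemma borel_measurable_arc_kernel:
  assumes "a \<le> b"
  shows "arc_kernel D \<delta> N s a b \<in> borel_measurable borel"
proof -
  interpret V: finite_measure "interval_lborel a b" by (rule finite_interval_lborel[OF assms])
  have "(\<lambda>(x, t). circle_integrand D \<delta> N s t x) \<in> borel_measurable (borel \<Otimes>\<^sub>M borel)"
    using measurable_compose[OF measurable_pair_swap' borel_measurable_circle_integrand] by (simp add: case_prod_beta')
  then have "(\<lambda>(x, t). circle_integrand D \<delta> N s t x) \<in> borel_measurable (borel \<Otimes>\<^sub>M interval_lborel a b)"
    by (simp cong: measurable_cong_sets sets_pair_measure_cong)
  then show ?thesis unfolding arc_kernel_def
    by (rule V.borel_measurable_lebesgue_integral)
qed

text \<open>Origin of the powers of \<tau>: \<open>-2\<delta> - 2\<close> from the two factors in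
  \<open>1 - w\<close>, \<open>\<epsilon>\<close> from the inner integral over the arc, 1 from the
  outer one.\<close>

lemma arc_kernel_L2_bound:
  assumes D: "D \<ge> 2" and \<delta>: "\<delta> > 0" and \<epsilon>: "\<epsilon> > 0" and ab: "a \<le> b" "b - a \<le> 1 / 4" "b - a \<le> \<tau>"
    and \<tau>: "circle_gap N \<le> \<tau>" and w: "\<And>t. t \<in> {a..b} \<Longrightarrow> \<tau> \<le> norm (1 - circle_pt N t)"
  shows "(\<integral>\<^sup>+x. (ennreal (norm (arc_kernel D \<delta> N s a b x)))\<^sup>2 \<partial>polar_measure D) \<le>
    ennreal (16 * polar_const D * 2 powr (D / 2) * (2 / \<epsilon>) * 2 powr \<epsilon> *
      (\<tau> powr (- 2 * \<delta> - 1 + \<epsilon>) * circle_gap N powr (1 - D / 2 - \<epsilon>)))"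
proof -
  define \<eta> where "\<eta> = circle_gap N"
  have g: "0 < \<eta>" "\<eta> \<le> 1 / 2" "\<eta> \<le> \<tau>" using circle_gap_bounds[of N] \<tau> by (auto simp: \<eta>_def)
  have D1: "D > 1" using D by simp
  note K = polar_const_pos[OF D1]
  obtain h where h: "integrable (polar_measure D) (\<lambda>x. (h x)\<^sup>2)"
    and hb: "\<And>t x. norm (circle_integrand D \<delta> N s t x) \<le> h x"
    using circle_integrand_dominated[OF D1 \<delta>, of N s] by blast
  let ?V = "interval_lborel a b"
  define A where "A = 16 * polar_const D * 2 powr (D / 2) * (\<tau> powr (- 2 * \<delta> - 2) * \<eta> powr (1 - D / 2 - \<epsilon>))"
  have A: "A \<ge> 0" using K by (simp add: A_def)
  have inner: "norm (\<integral>x. circle_integrand D \<delta> N s t x * cnj (circle_integrand D \<delta> N s t' x) \<partial>polar_measure D)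
      \<le> A * (\<eta> + \<bar>t - t'\<bar>) powr (\<epsilon> - 1)" if t: "t \<in> {a..b}" "t' \<in> {a..b}" for t t'
  proof -
    have p: "norm (1 - circle_pt N t) powr (- \<delta> - 1) \<le> \<tau> powr (- \<delta> - 1)" if "t \<in> {a..b}" for t
      using w[OF that] g \<delta> by (intro powr_mono2') auto
    have "\<bar>t - t'\<bar> \<le> 1 / 4" using t ab unfolding atLeastAtMost_iff abs_le_iff by linarith
    then have y: "(\<eta> + \<bar>t - t'\<bar>) / 2 \<le> norm (1 - (circle_pt N t)\<^sup>2 * (cnj (circle_pt N t'))\<^sup>2)"
      using norm_one_minus_circlepath_product[of "1 - circle_gap N" t t'] g
      by (auto simp: circle_pt_def \<eta>_def)
    define z where "z = \<eta> + \<bar>t - t'\<bar>"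
    have z: "z > 0" "\<eta> \<le> z" using g by (auto simp: z_def)
    have "norm (1 - (circle_pt N t)\<^sup>2 * (cnj (circle_pt N t'))\<^sup>2) powr (- D / 2) \<le> (z / 2) powr (- D / 2)"
      using y z D unfolding z_def by (intro powr_mono2') auto
    \<comment> \<open>Only a barely integrable power of \<open>z\<close> is kept; the rest has
      exponent at most 0 because \<open>D >= 2\<close>, and is evaluated at the smallest value
      \<eta>.\<close>
    also have "\<dots> = 2 powr (D / 2) * (z powr (1 - D / 2 - \<epsilon>) * z powr (\<epsilon> - 1))"
      using z by (simp add: powr_divide powr_minus_divide flip: powr_add)
    also have "\<dots> \<le> 2 powr (D / 2) * (\<eta> powr (1 - D / 2 - \<epsilon>) * z powr (\<epsilon> - 1))"
      using z g D \<epsilon> by (intro mult_left_mono mult_right_mono powr_mono2') auto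
    finally have y': "norm (1 - (circle_pt N t)\<^sup>2 * (cnj (circle_pt N t'))\<^sup>2) powr (- D / 2) \<le>
        2 powr (D / 2) * (\<eta> powr (1 - D / 2 - \<epsilon>) * z powr (\<epsilon> - 1))" .
    have "norm (\<integral>x. circle_integrand D \<delta> N s t x * cnj (circle_integrand D \<delta> N s t' x) \<partial>polar_measure D)
      \<le> 16 * \<tau> powr (- \<delta> - 1) * \<tau> powr (- \<delta> - 1) *
          (polar_const D * (2 powr (D / 2) * (\<eta> powr (1 - D / 2 - \<epsilon>) * z powr (\<epsilon> - 1))))"
      using K by (intro order_trans[OF norm_inner_circle_integrand_le[OF D1]] mult_mono p t y' order_refl) auto
    also have "\<tau> powr (- 2 * \<delta> - 2) = \<tau> powr (- \<delta> - 1) * \<tau> powr (- \<delta> - 1)"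
      by (simp flip: powr_add)
    then have "16 * \<tau> powr (- \<delta> - 1) * \<tau> powr (- \<delta> - 1) *
          (polar_const D * (2 powr (D / 2) * (\<eta> powr (1 - D / 2 - \<epsilon>) * z powr (\<epsilon> - 1)))) = A * z powr (\<epsilon> - 1)"
      unfolding A_def by (simp only: mult_ac)
    finally show ?thesis by (simp only: z_def)
  qed
  have "(\<integral>\<^sup>+x. (ennreal (norm (arc_kernel D \<delta> N s a b x)))\<^sup>2 \<partial>polar_measure D) \<le>
    (\<integral>\<^sup>+t. \<integral>\<^sup>+t'. ennreal (norm (\<integral>x. circle_integrand D \<delta> N s t x * cnj (circle_integrand D \<delta> N s t' x) \<partial>polar_measure D)) \<partial>?V \<partial>?V)"
    unfolding arc_kernel_def ennreal_power[OF norm_ge_zero]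
  proof (rule nn_integral_norm_square_superposition[OF sigma_finite_polar_measure finite_interval_lborel[OF ab(1)]])
    show "(\<lambda>(t, x). circle_integrand D \<delta> N s t x) \<in> borel_measurable (?V \<Otimes>\<^sub>M polar_measure D)"
      using borel_measurable_circle_integrand by (simp cong: measurable_cong_sets sets_pair_measure_cong)
  qed (use h hb in auto)
  also have "\<dots> \<le> (\<integral>\<^sup>+t. \<integral>\<^sup>+t'. ennreal A * ennreal ((\<eta> + \<bar>t - t'\<bar>) powr (\<epsilon> - 1)) \<partial>?V \<partial>?V)"
  proof (rule nn_integral_mono_AE, rule AE_mp[OF AE_interval_lborel], rule AE_I2, rule impI)
    fix t assume t: "t \<in> {a..b}"
    show "(\<integral>\<^sup>+t'. ennreal (norm (\<integral>x. circle_integrand D \<delta> N s t x * cnj (circle_integrand D \<delta> N s t' x) \<partial>polar_measure D)) \<partial>?V)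
       \<le> (\<integral>\<^sup>+t'. ennreal A * ennreal ((\<eta> + \<bar>t - t'\<bar>) powr (\<epsilon> - 1)) \<partial>?V)"
      by (rule nn_integral_mono_AE, rule AE_mp[OF AE_interval_lborel], rule AE_I2)
         (auto simp: ennreal_mult'[symmetric] A intro!: ennreal_leI inner t)
  qed
  also have "\<dots> \<le> (\<integral>\<^sup>+t. ennreal A * ennreal (2 / \<epsilon> * (\<eta> + (b - a)) powr \<epsilon>) \<partial>?V)"
  proof (rule nn_integral_mono_AE, rule AE_mp[OF AE_interval_lborel], rule AE_I2, rule impI)
    fix t assume t: "t \<in> {a..b}"
    have "(\<integral>\<^sup>+t'. ennreal A * ennreal ((\<eta> + \<bar>t - t'\<bar>) powr (\<epsilon> - 1)) \<partial>?V) =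
        ennreal A * (\<integral>\<^sup>+t'. ennreal (indicator {a..b} t' * (\<eta> + \<bar>t - t'\<bar>) powr (\<epsilon> - 1)) \<partial>lborel)"
      by (simp add: nn_integral_cmult nn_integral_interval_lborel ennreal_mult')
    also have "\<dots> \<le> ennreal A * ennreal (2 / \<epsilon> * (\<eta> + (b - a)) powr \<epsilon>)"
      using t g \<epsilon> by (intro mult_left_mono nn_integral_powr_singularity) auto
    finally show "(\<integral>\<^sup>+t'. ennreal A * ennreal ((\<eta> + \<bar>t - t'\<bar>) powr (\<epsilon> - 1)) \<partial>?V)
      \<le> ennreal A * ennreal (2 / \<epsilon> * (\<eta> + (b - a)) powr \<epsilon>)" .
  qed
  also have "\<dots> = ennreal (A * (2 / \<epsilon> * (\<eta> + (b - a)) powr \<epsilon>) * (b - a))"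
  proof -
    have nn: "0 \<le> A * (2 / \<epsilon> * (\<eta> + (b - a)) powr \<epsilon>)" using A \<epsilon> by simp
    show ?thesis
      by (simp only: nn_integral_const emeasure_interval_lborel[OF ab(1)] ennreal_mult'[OF A, symmetric]
          ennreal_mult'[OF nn, symmetric])
  qed
  also have "\<dots> \<le> ennreal (A * (2 / \<epsilon> * (2 powr \<epsilon> * \<tau> powr \<epsilon>)) * \<tau>)"
  proof (intro ennreal_leI mult_mono order_refl)
    have "(\<eta> + (b - a)) powr \<epsilon> \<le> (2 * \<tau>) powr \<epsilon>"
      using g ab \<epsilon> by (intro powr_mono2) auto
    then show "(\<eta> + (b - a)) powr \<epsilon> \<le> 2 powr \<epsilon> * \<tau> powr \<epsilon>" using g by (simp add: powr_mult)
  qed (use A \<epsilon> ab g in auto)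
  also have "A * (2 / \<epsilon> * (2 powr \<epsilon> * \<tau> powr \<epsilon>)) * \<tau> = 16 * polar_const D * 2 powr (D / 2) * (2 / \<epsilon>) * 2 powr \<epsilon> *
      (\<tau> powr (- 2 * \<delta> - 1 + \<epsilon>) * \<eta> powr (1 - D / 2 - \<epsilon>))"
  proof -
    have "\<tau> powr (- 2 * \<delta> - 1 + \<epsilon>) = \<tau> powr (- 2 * \<delta> - 2) * \<tau> powr \<epsilon> * \<tau> powr 1"
      unfolding powr_add[symmetric] by (rule arg_cong[where f="\<lambda>z. \<tau> powr z"]) simp
    then have "\<tau> powr (- 2 * \<delta> - 1 + \<epsilon>) = \<tau> powr (- 2 * \<delta> - 2) * \<tau> powr \<epsilon> * \<tau>"
      using g by simp
    then show ?thesis unfolding A_def by (simp only: mult_ac)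
  qed
  finally show ?thesis by (simp only: \<eta>_def)
qed

definition chord_square :: "real \<Rightarrow> real \<times> real \<Rightarrow> real" where
  "chord_square s x = (fst x)\<^sup>2 + s\<^sup>2 - 2 * fst x * s * snd x"

lemma borel_measurable_chord_square [measurable]: "chord_square s \<in> borel_measurable borel"
  unfolding chord_square_def by measurable

text \<open>Completing the square cancels \<open>s\<close> altogether: for real \<open>D\<close>
  this is what survives of translation invariance, and it makes all later bounds uniform in
  \<open>s\<close>.\<close>

lemma nn_integral_exp_chord_square:
  assumes D: "D > 1" and a: "a > 0"
  shows "(\<integral>\<^sup>+x. ennreal (exp (- a * chord_square s x)) \<partial>polar_measure D) = ennreal (polar_const D * a powr (- D / 2))"
proof -
  have "ennreal (exp (- a * chord_square s x)) =
      ennreal (exp (- a * s\<^sup>2)) * ennreal (exp (- a * (fst x)\<^sup>2 + (2 * a * s) * fst x * snd x))" for x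
    by (simp add: chord_square_def algebra_simps flip: ennreal_mult' exp_add)
  then have "(\<integral>\<^sup>+x. ennreal (exp (- a * chord_square s x)) \<partial>polar_measure D) =
      ennreal (exp (- a * s\<^sup>2)) * ennreal (polar_const D * a powr (- D / 2) * exp ((2 * a * s)\<^sup>2 / (4 * a)))"
    by (simp only:) (subst nn_integral_cmult, simp, simp only: nn_integral_polar_gaussian[OF D a])
  also have "\<dots> = ennreal (polar_const D * a powr (- D / 2) * (exp (- a * s\<^sup>2) * exp ((2 * a * s)\<^sup>2 / (4 * a))))"
    by (subst ennreal_mult'[symmetric]) (simp_all add: mult_ac)
  also have "exp (- a * s\<^sup>2) * exp ((2 * a * s)\<^sup>2 / (4 * a)) = 1"
    unfolding exp_add[symmetric] using a by (simp add: power2_eq_square)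
  finally show ?thesis by simp
qed

text \<open>Absolute values inside an integral of length at most \<tau>. The factor in
  \<open>1 - w^2\<close> is estimated crudely by its value at distance \<eta>, which covers arcs
  near -1; the bound is used only far out, where exponential decay absorbs the loss.\<close>

lemma arc_kernel_pointwise_bound:
  assumes D: "D > 0" and \<delta>: "\<delta> > 0" and ab: "a \<le> b" "b - a \<le> \<tau>" and \<tau>: "circle_gap N \<le> \<tau>"
    and w: "\<And>t. t \<in> {a..b} \<Longrightarrow> \<tau> \<le> norm (1 - circle_pt N t) \<and> norm (1 - circle_pt N t) \<le> 8 * \<tau>"
    and x: "\<bar>snd x\<bar> \<le> 1"
  shows "norm (arc_kernel D \<delta> N s a b x) \<le> 4 * (\<tau> powr (- \<delta>) * circle_gap N powr (- D / 2)) *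
      exp (- (circle_gap N / (256 * \<tau>\<^sup>2)) * chord_square s x)"
proof -
  define \<eta> where "\<eta> = circle_gap N"
  have g: "0 < \<eta>" "\<eta> \<le> 1 / 2" "\<eta> \<le> \<tau>" using circle_gap_bounds[of N] \<tau> by (auto simp: \<eta>_def)
  have q: "chord_square s x \<ge> 0" unfolding chord_square_def by (rule chord_square_nonneg[OF x])
  define B where "B = 4 * \<tau> powr (- \<delta> - 1) * \<eta> powr (- D / 2) * exp (- (\<eta> / (256 * \<tau>\<^sup>2)) * chord_square s x)"
  have pt: "norm (circle_integrand D \<delta> N s t x) \<le> B" if t: "t \<in> {a..b}" for t
  proof -
    have n: "\<tau> \<le> norm (1 - circle_pt N t)" "norm (1 - circle_pt N t) \<le> 8 * \<tau>" using w[OF t] by auto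
    \<comment> \<open>The square of 8 times the factor 4 from Mehler's exponent gives 256.\<close>
    have "(norm (1 - circle_pt N t))\<^sup>2 \<le> (8 * \<tau>)\<^sup>2" using n by (intro power_mono) auto
    then have "\<eta> / (256 * \<tau>\<^sup>2) \<le> \<eta> / (4 * (norm (1 - circle_pt N t))\<^sup>2)"
      using g n by (intro divide_left_mono mult_pos_pos zero_less_power) (auto simp: power_mult_distrib)
    from mult_right_mono[OF this q]
    have e: "exp (- (\<eta> / (4 * (norm (1 - circle_pt N t))\<^sup>2)) * chord_square s x) \<le> exp (- (\<eta> / (256 * \<tau>\<^sup>2)) * chord_square s x)"
      by simp
    have "norm (circle_integrand D \<delta> N s t x) \<le> 4 * norm (1 - circle_pt N t) powr (- \<delta> - 1) *
     norm (1 - (circle_pt N t)\<^sup>2) powr (- D / 2) *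
     exp (- (\<eta> / (4 * (norm (1 - circle_pt N t))\<^sup>2)) * chord_square s x)"
      using norm_circle_integrand_le[OF x, of D \<delta> N s t] by (simp only: \<eta>_def chord_square_def)
    also have "\<dots> \<le> B" unfolding B_def
      using n g \<delta> D one_minus_circle_pt_bounds(2)[of N t]
      by (intro mult_mono e powr_mono2') (auto simp: \<eta>_def)
    finally show ?thesis .
  qed
  have B: "B \<ge> 0" by (simp add: B_def)
  have "ennreal (norm (arc_kernel D \<delta> N s a b x)) \<le> (\<integral>\<^sup>+t. ennreal (norm (circle_integrand D \<delta> N s t x)) \<partial>interval_lborel a b)"
    unfolding arc_kernel_def by (rule ennreal_norm_integral_le_nn_integral)
  also have "\<dots> \<le> (\<integral>\<^sup>+t. ennreal B \<partial>interval_lborel a b)"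
    by (rule nn_integral_mono_AE, rule AE_mp[OF AE_interval_lborel], rule AE_I2) (auto intro!: ennreal_leI pt)
  also have "\<dots> = ennreal (B * (b - a))"
    using B ab by (simp only: nn_integral_const emeasure_interval_lborel) (simp add: ennreal_mult')
  also have "\<dots> \<le> ennreal (B * \<tau>)" using B ab by (intro ennreal_leI mult_left_mono) auto
  finally have "norm (arc_kernel D \<delta> N s a b x) \<le> B * \<tau>"
    using B g by (subst (asm) ennreal_le_iff) auto
  also have "\<tau> powr (- \<delta>) = \<tau> powr (- \<delta> - 1) * \<tau> powr 1" unfolding powr_add[symmetric] by simp
  then have "B * \<tau> = 4 * (\<tau> powr (- \<delta>) * \<eta> powr (- D / 2)) * exp (- (\<eta> / (256 * \<tau>\<^sup>2)) * chord_square s x)"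
    using g by (simp add: B_def)
  finally show ?thesis by (simp only: \<eta>_def)
qed

lemma ennreal_le_of_power2_le:
  assumes "a\<^sup>2 \<le> ennreal (y\<^sup>2)" "y \<ge> 0"
  shows "a \<le> ennreal y"
proof (cases a)
  case (real r)
  then have "ennreal (r\<^sup>2) \<le> ennreal (y\<^sup>2)" using assms by (simp add: ennreal_power)
  then have "r\<^sup>2 \<le> y\<^sup>2" by (subst (asm) ennreal_le_iff) auto
  then have "r \<le> y" using assms(2) by (rule power2_le_imp_le)
  then show ?thesis using real by (simp add: ennreal_leI)
next
  case top
  then show ?thesis using assms by (simp add: ennreal_top_mult power2_eq_square top_unique)
qed

text \<open>Cauchy-Schwarz on the region \<open>Q\<close> of small chord, pointwise decay outside.
  The surplus of \<delta> over the critical index is \<open>2\<kappa>\<close>: half of it pays for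
  the losses in \<epsilon>, the other half remains as decay in \<open>X\<close>.\<close>

lemma arc_kernel_L1_bound:
  fixes D \<delta> :: real
  assumes D: "D \<ge> 2" and \<delta>: "\<delta> > (D - 1) / 2"
  shows "\<exists>C>0. \<forall>N s a b \<tau>. a \<le> b \<longrightarrow> b - a \<le> 1 / 4 \<longrightarrow> b - a \<le> \<tau> \<longrightarrow> circle_gap N \<le> \<tau> \<longrightarrow>
     (\<forall>t\<in>{a..b}. \<tau> \<le> norm (1 - circle_pt N t) \<and> norm (1 - circle_pt N t) \<le> 8 * \<tau>) \<longrightarrow>
     (\<integral>\<^sup>+x. ennreal (norm (arc_kernel D \<delta> N s a b x)) \<partial>polar_measure D) \<le>
       ennreal (C * circle_gap N powr (- \<delta>) * (\<tau> / circle_gap N) powr (- ((\<delta> - (D - 1) / 2) / 2)))"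
proof -
  define \<kappa> where "\<kappa> = (\<delta> - (D - 1) / 2) / 2"
  \<comment> \<open>Chosen so that \<open>\<epsilon> (D + 1) = 2\<kappa>\<close>: one \<epsilon> is
    lost in the L2 bound and \<open>\<epsilon> D\<close> in the enlarged volume of
    \<open>Q\<close>.\<close>
  define \<epsilon> where "\<epsilon> = (\<delta> - (D - 1) / 2) / (D + 1)"
  have \<kappa>: "\<kappa> > 0" and \<epsilon>: "\<epsilon> > 0" using D \<delta> by (auto simp: \<kappa>_def \<epsilon>_def)
  have \<epsilon>D: "\<epsilon> * (D + 1) = 2 * \<kappa>" using D by (simp add: \<kappa>_def \<epsilon>_def)
  have D1: "D > 1" "D > 0" and \<delta>0: "\<delta> > 0" using D \<delta> by auto
  define K where "K = polar_const D"
  have K: "K > 0" unfolding K_def by (rule polar_const_pos[OF D1(1)])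
  define C1 where "C1 = 16 * K * 2 powr (D / 2) * (2 / \<epsilon>) * 2 powr \<epsilon> * (exp 1 * K)"
  have C1: "C1 > 0" using K \<epsilon> by (simp add: C1_def)
  obtain C2 where C2: "C2 > 0" "\<And>X::real. X \<ge> 1 \<Longrightarrow> X powr (D + \<kappa>) * exp (- (1 / 512) * X powr (2 * \<epsilon>)) \<le> C2"
    using powr_exp_bounded[of "2 * \<epsilon>" "1 / 512" "D + \<kappa>"] \<epsilon> by auto
  define C3 where "C3 = 4 * (K * (1 / 512) powr (- D / 2)) * C2"
  have C3: "C3 > 0" using K C2 by (simp add: C3_def)
  show ?thesis
  proof (intro exI[of _ "sqrt C1 + C3"] conjI allI impI)
    show "sqrt C1 + C3 > 0" using C1 C3 by (simp add: add_pos_pos)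
    fix N s a b \<tau>
    assume ab: "a \<le> b" "b - a \<le> 1 / 4" "b - a \<le> \<tau>" and \<tau>: "circle_gap N \<le> \<tau>"
      and w: "\<forall>t\<in>{a..b}. \<tau> \<le> norm (1 - circle_pt N t) \<and> norm (1 - circle_pt N t) \<le> 8 * \<tau>"
    define \<eta> where "\<eta> = circle_gap N"
    have g: "0 < \<eta>" "\<eta> \<le> 1 / 2" "\<eta> \<le> \<tau>" "0 < \<tau>" using circle_gap_bounds[of N] \<tau> by (auto simp: \<eta>_def)
    define X where "X = \<tau> / \<eta>"
    have X: "X \<ge> 1" and \<tau>X: "\<tau> = \<eta> * X" using g by (auto simp: X_def)
    have X0: "X > 0" using X by simp
    \<comment> \<open>\<open>\<eta> X^2 = \<tau>^2 / \<eta>\<close> is the natural Gaussian width of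
      the arc; the extra \<open>X^(2\<epsilon>)\<close> makes the exterior part decay faster than
      any power of \<open>X\<close>.\<close>
    define q where "q = \<eta> * X powr (2 + 2 * \<epsilon>)"
    have q: "q > 0" using g X0 by (simp add: q_def)
    define k where "k x = ennreal (norm (arc_kernel D \<delta> N s a b x))" for x
    have [measurable]: "k \<in> borel_measurable borel"
      unfolding k_def using borel_measurable_arc_kernel[OF ab(1)] by measurable
    let ?M = "polar_measure D"
    define Q where "Q = {x. chord_square s x \<le> q}"
    have [measurable]: "Q \<in> sets borel" unfolding Q_def by measurable

    have CS: "(\<integral>\<^sup>+x. k x * indicator Q x \<partial>?M)\<^sup>2 \<le> (\<integral>\<^sup>+x. (k x)\<^sup>2 \<partial>?M) * (\<integral>\<^sup>+x. (indicator Q x)\<^sup>2 \<partial>?M)"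
      by (rule Cauchy_Schwarz_nn_integral) auto
    \<comment> \<open>Volume of \<open>Q\<close> in the manner of Markov's inequality: on
      \<open>Q\<close> the function \<open>exp (1 - chord_square s x / q)\<close> is at least 1, and
      its integral is known.\<close>
    have "(\<integral>\<^sup>+x. (indicator Q x)\<^sup>2 \<partial>?M) \<le> (\<integral>\<^sup>+x. ennreal (exp 1) * ennreal (exp (- (1 / q) * chord_square s x)) \<partial>?M)"
    proof (rule nn_integral_mono)
      fix x
      show "(indicator Q x)\<^sup>2 \<le> ennreal (exp 1) * ennreal (exp (- (1 / q) * chord_square s x))"
      proof (cases "x \<in> Q")
        case True
        then have "0 \<le> 1 + - (1 / q) * chord_square s x" using q by (simp add: Q_def field_simps)
        then have "1 \<le> exp 1 * exp (- (1 / q) * chord_square s x)" unfolding exp_add[symmetric] by simp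
        then show ?thesis using True by (simp add: ennreal_mult'[symmetric])
      qed simp
    qed
    also have "\<dots> = ennreal (exp 1 * (K * (1 / q) powr (- D / 2)))"
    proof -
      have "1 / q > 0" using q by simp
      then show ?thesis
        by (subst nn_integral_cmult, measurable)
           (simp only: nn_integral_exp_chord_square[OF D1(1)] K_def ennreal_mult' exp_ge_zero)
    qed
    also have "(1 / q) powr (- D / 2) = \<eta> powr (D / 2) * X powr ((1 + \<epsilon>) * D)"
      using g X0 by (simp add: q_def powr_divide powr_minus powr_mult powr_powr algebra_simps)
    finally have vol: "(\<integral>\<^sup>+x. (indicator Q x)\<^sup>2 \<partial>?M) \<le>
       ennreal (exp 1 * (K * (\<eta> powr (D / 2) * X powr ((1 + \<epsilon>) * D))))" .
    have L2: "(\<integral>\<^sup>+x. (k x)\<^sup>2 \<partial>?M) \<le> ennreal (16 * K * 2 powr (D / 2) * (2 / \<epsilon>) * 2 powr \<epsilon> *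
      (\<tau> powr (- 2 * \<delta> - 1 + \<epsilon>) * \<eta> powr (1 - D / 2 - \<epsilon>)))"
      unfolding k_def K_def \<eta>_def by (rule arc_kernel_L2_bound[OF D \<delta>0 \<epsilon> ab \<tau>]) (use w in auto)
    have "(\<integral>\<^sup>+x. k x * indicator Q x \<partial>?M)\<^sup>2 \<le>
       ennreal (16 * K * 2 powr (D / 2) * (2 / \<epsilon>) * 2 powr \<epsilon> * (\<tau> powr (- 2 * \<delta> - 1 + \<epsilon>) * \<eta> powr (1 - D / 2 - \<epsilon>))) *
       ennreal (exp 1 * (K * (\<eta> powr (D / 2) * X powr ((1 + \<epsilon>) * D))))"
      by (rule order_trans[OF CS mult_mono[OF L2 vol]]) auto
    also have "\<dots> = ennreal (C1 * ((\<tau> powr (- 2 * \<delta> - 1 + \<epsilon>) * \<eta> powr (1 - D / 2 - \<epsilon>)) * (\<eta> powr (D / 2) * X powr ((1 + \<epsilon>) * D))))"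
      using K \<epsilon> by (subst ennreal_mult'[symmetric]) (auto simp: C1_def mult_ac)
    \<comment> \<open>With \<open>\<tau> = \<eta> X\<close> the powers of \<eta> add up to
      \<open>-2\<delta>\<close> and those of \<open>X\<close> to \<open>-2\<kappa>\<close>;
      \<epsilon> drops out by its choice.\<close>
    also have "(\<tau> powr (- 2 * \<delta> - 1 + \<epsilon>) * \<eta> powr (1 - D / 2 - \<epsilon>)) * (\<eta> powr (D / 2) * X powr ((1 + \<epsilon>) * D)) =
        (\<eta> powr (- \<delta>) * X powr (- \<kappa>))\<^sup>2"
    proof -
      have "(\<tau> powr (- 2 * \<delta> - 1 + \<epsilon>) * \<eta> powr (1 - D / 2 - \<epsilon>)) * (\<eta> powr (D / 2) * X powr ((1 + \<epsilon>) * D)) =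
         (\<eta> powr (- 2 * \<delta> - 1 + \<epsilon>) * \<eta> powr (1 - D / 2 - \<epsilon>) * \<eta> powr (D / 2)) *
         (X powr (- 2 * \<delta> - 1 + \<epsilon>) * X powr ((1 + \<epsilon>) * D))"
        using g X0 by (simp add: \<tau>X powr_mult mult_ac)
      also have "\<eta> powr (- 2 * \<delta> - 1 + \<epsilon>) * \<eta> powr (1 - D / 2 - \<epsilon>) * \<eta> powr (D / 2) = \<eta> powr (- \<delta> + - \<delta>)"
        unfolding powr_add[symmetric] by (rule arg_cong[where f="\<lambda>z. \<eta> powr z"]) simp
      also have "X powr (- 2 * \<delta> - 1 + \<epsilon>) * X powr ((1 + \<epsilon>) * D) = X powr (- \<kappa> + - \<kappa>)"
        unfolding powr_add[symmetric]
      proof (rule arg_cong[where f="\<lambda>z. X powr z"])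
        have "\<epsilon> * D + \<epsilon> = 2 * \<kappa>" using \<epsilon>D by (simp add: distrib_left)
        then have 1: "\<epsilon> * D = 2 * \<kappa> - \<epsilon>" by simp
        have 2: "2 * \<delta> = 4 * \<kappa> + D - 1" by (simp add: \<kappa>_def field_simps)
        have "- 2 * \<delta> - 1 + \<epsilon> + (1 + \<epsilon>) * D = - (2 * \<delta>) - 1 + \<epsilon> + D + \<epsilon> * D"
          by (simp add: distrib_right)
        then show "- 2 * \<delta> - 1 + \<epsilon> + (1 + \<epsilon>) * D = - \<kappa> + - \<kappa>"
          unfolding 1 2 by simp
      qed
      finally show ?thesis unfolding powr_add by (simp only: power2_eq_square mult_ac)
    qed
    also have "C1 * (\<eta> powr (- \<delta>) * X powr (- \<kappa>))\<^sup>2 = (sqrt C1 * (\<eta> powr (- \<delta>) * X powr (- \<kappa>)))\<^sup>2"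
      using C1 by (simp only: power_mult_distrib real_sqrt_pow2)
    finally have inner: "(\<integral>\<^sup>+x. k x * indicator Q x \<partial>?M) \<le> ennreal (sqrt C1 * (\<eta> powr (- \<delta>) * X powr (- \<kappa>)))"
      by (rule ennreal_le_of_power2_le) (use C1 in auto)

    \<comment> \<open>Half of the pointwise decay rate \<open>\<eta> / (256 \<tau>^2)\<close>. One
      half is spent at the boundary of \<open>Q\<close> to produce the small factor in
      \<open>B\<close>, the other half keeps the integral finite.\<close>
    define c where "c = 1 / (512 * (\<eta> * X\<^sup>2))"
    have c: "c > 0" using g X0 by (simp add: c_def)
    define B where "B = 4 * (\<tau> powr (- \<delta>) * \<eta> powr (- D / 2)) * exp (- (1 / 512) * X powr (2 * \<epsilon>))"
    have B: "B \<ge> 0" by (simp add: B_def)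
    have cq: "c * q = (1 / 512) * X powr (2 * \<epsilon>)"
    proof -
      have "X powr (2 + 2 * \<epsilon>) = X\<^sup>2 * X powr (2 * \<epsilon>)" using X0 by (simp add: powr_add)
      then show ?thesis using g X0 by (simp add: c_def q_def)
    qed
    have "(\<integral>\<^sup>+x. k x * indicator (- Q) x \<partial>?M) \<le> (\<integral>\<^sup>+x. ennreal B * ennreal (exp (- c * chord_square s x)) \<partial>?M)"
    proof (rule nn_integral_mono_AE, rule AE_mp[OF AE_polar_measure], rule AE_I2, rule impI)
      fix x :: "real \<times> real" assume x: "0 < fst x \<and> \<bar>snd x\<bar> < 1"
      show "k x * indicator (- Q) x \<le> ennreal B * ennreal (exp (- c * chord_square s x))"
      proof (cases "x \<in> Q")
        case False
        have "norm (arc_kernel D \<delta> N s a b x) \<le> 4 * (\<tau> powr (- \<delta>) * \<eta> powr (- D / 2)) *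
            exp (- (\<eta> / (256 * \<tau>\<^sup>2)) * chord_square s x)"
          unfolding \<eta>_def by (rule arc_kernel_pointwise_bound[OF D1(2) \<delta>0 ab(1,3) \<tau>]) (use w x in auto)
        also have "\<eta> / (256 * \<tau>\<^sup>2) = 2 * c"
          using g X0 by (simp add: c_def \<tau>X power2_eq_square)
        also have "exp (- (2 * c) * chord_square s x) \<le> exp (- (1 / 512) * X powr (2 * \<epsilon>)) * exp (- c * chord_square s x)"
        proof -
          have "c * q \<le> c * chord_square s x" using False c by (intro mult_left_mono) (auto simp: Q_def)
          then show ?thesis unfolding exp_add[symmetric] using cq by simp
        qed
        finally have "norm (arc_kernel D \<delta> N s a b x) \<le> B * exp (- c * chord_square s x)"
          by (simp add: B_def mult_left_mono)
        then show ?thesis using B False by (simp add: k_def ennreal_mult'[symmetric] ennreal_leI)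
      qed simp
    qed
    also have "\<dots> = ennreal (B * (K * c powr (- D / 2)))"
      using B c by (subst nn_integral_cmult, measurable)
        (simp only: nn_integral_exp_chord_square[OF D1(1)] K_def ennreal_mult')
    also have "B * (K * c powr (- D / 2)) \<le> C3 * (\<eta> powr (- \<delta>) * X powr (- \<kappa>))"
    proof -
      have "c powr (- D / 2) = (1 / 512) powr (- D / 2) * (\<eta> powr (D / 2) * X powr D)"
      proof -
        have "(X\<^sup>2) powr (D / 2) = X powr D"
          using X0 by (simp add: powr_powr flip: powr_numeral)
        then have 1: "(\<eta> * X\<^sup>2) powr (D / 2) = \<eta> powr (D / 2) * X powr D" by (simp only: powr_mult)
        have inv: "inverse y powr (- D / 2) = y powr (D / 2)" if "y > 0" for y :: real
          using that by (simp add: inverse_powr powr_minus)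
        have "\<eta> * X\<^sup>2 > 0" using g X0 by simp
        note 2 = inv[OF this]
        have "c = 1 / 512 * inverse (\<eta> * X\<^sup>2)" by (simp add: c_def inverse_eq_divide)
        then show ?thesis by (simp only: powr_mult[of "1 / 512"] 2 1)
      qed
      then have "B * (K * c powr (- D / 2)) =
         4 * (K * (1 / 512) powr (- D / 2)) * ((\<tau> powr (- \<delta>) * (\<eta> powr (- D / 2) * \<eta> powr (D / 2))) *
           (X powr D * exp (- (1 / 512) * X powr (2 * \<epsilon>))))"
        by (simp only: B_def mult_ac)
      also have "\<eta> powr (- D / 2) * \<eta> powr (D / 2) = 1" using g by (simp flip: powr_add)
      also have "\<tau> powr (- \<delta>) = \<eta> powr (- \<delta>) * X powr (- \<delta>)" using g X0 by (simp add: \<tau>X powr_mult)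
      also have "4 * (K * (1 / 512) powr (- D / 2)) * ((\<eta> powr (- \<delta>) * X powr (- \<delta>) * 1) *
           (X powr D * exp (- (1 / 512) * X powr (2 * \<epsilon>)))) \<le>
         4 * (K * (1 / 512) powr (- D / 2)) * ((\<eta> powr (- \<delta>) * 1) * (X powr (- \<kappa>) * C2))"
      proof (rule mult_left_mono)
        \<comment> \<open>The decay in \<open>X^(-\<delta>)\<close> is given away; the growth
          \<open>X^D\<close> is beaten by the exponential, with \<open>X^(-\<kappa>)\<close> to
          spare.\<close>
        have "X powr (- \<delta>) \<le> X powr 0" using X \<delta>0 by (intro powr_mono) auto
        then have d: "X powr (- \<delta>) \<le> 1" using X0 by simp
        have "X powr D = X powr (- \<kappa>) * X powr (D + \<kappa>)" by (simp flip: powr_add)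
        then have e: "X powr D * exp (- (1 / 512) * X powr (2 * \<epsilon>)) \<le> X powr (- \<kappa>) * C2"
          using mult_left_mono[OF C2(2)[OF X], of "X powr (- \<kappa>)"] by (simp add: mult.assoc)
        show "(\<eta> powr (- \<delta>) * X powr (- \<delta>) * 1) * (X powr D * exp (- (1 / 512) * X powr (2 * \<epsilon>))) \<le>
          (\<eta> powr (- \<delta>) * 1) * (X powr (- \<kappa>) * C2)"
          by (rule mult_mono[OF _ e]) (use d C2(1) in \<open>auto simp: mult_left_le\<close>)
      qed (use K in auto)
      finally show ?thesis by (simp only: C3_def mult_ac mult_1_right)
    qed
    finally have outer: "(\<integral>\<^sup>+x. k x * indicator (- Q) x \<partial>?M) \<le> ennreal (C3 * (\<eta> powr (- \<delta>) * X powr (- \<kappa>)))"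
      by (simp add: ennreal_leI)

    have "(\<integral>\<^sup>+x. k x \<partial>?M) = (\<integral>\<^sup>+x. k x * indicator Q x + k x * indicator (- Q) x \<partial>?M)"
      by (intro nn_integral_cong) (auto simp: indicator_def)
    also have "\<dots> = (\<integral>\<^sup>+x. k x * indicator Q x \<partial>?M) + (\<integral>\<^sup>+x. k x * indicator (- Q) x \<partial>?M)"
      by (rule nn_integral_add) auto
    also have "\<dots> \<le> ennreal (sqrt C1 * (\<eta> powr (- \<delta>) * X powr (- \<kappa>))) + ennreal (C3 * (\<eta> powr (- \<delta>) * X powr (- \<kappa>)))"
      by (rule add_mono[OF inner outer])
    also have "\<dots> = ennreal ((sqrt C1 + C3) * \<eta> powr (- \<delta>) * X powr (- \<kappa>))"
      using C1 C3 by (subst ennreal_plus[symmetric]) (auto simp: algebra_simps)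
    finally show "(\<integral>\<^sup>+x. ennreal (norm (arc_kernel D \<delta> N s a b x)) \<partial>polar_measure D) \<le>
       ennreal ((sqrt C1 + C3) * circle_gap N powr (- \<delta>) * (\<tau> / circle_gap N) powr (- ((\<delta> - (D - 1) / 2) / 2)))"
      by (simp only: k_def \<eta>_def X_def \<kappa>_def)
  qed
qed

section \<open>Joining the arcs to the full circle\<close>

lemma arc_kernel_eq_integral:
  "arc_kernel D \<delta> N s a b x = integral {a..b} (\<lambda>t. circle_integrand D \<delta> N s t x)"
  and arc_kernel_integrable: "(\<lambda>t. circle_integrand D \<delta> N s t x) integrable_on {a..b}"
proof -
  have c: "continuous_on A (\<lambda>t. circle_integrand D \<delta> N s t x)" for A
    using continuous_on_circle_integrand[of A "\<lambda>t. t" "\<lambda>t. fst x" "\<lambda>t. s" "\<lambda>t. snd x"]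
    by (simp add: continuous_on_id)
  show "(\<lambda>t. circle_integrand D \<delta> N s t x) integrable_on {a..b}"
    using c by (rule integrable_continuous_interval)
  have [measurable]: "(\<lambda>t. circle_integrand D \<delta> N s t x) \<in> borel_measurable borel"
    using c by (rule borel_measurable_continuous_onI)
  have "arc_kernel D \<delta> N s a b x = (LINT t:{a..b}|lborel. circle_integrand D \<delta> N s t x)"
    unfolding arc_kernel_def interval_lborel_def set_lebesgue_integral_def
    by (rule integral_density) auto
  then show "arc_kernel D \<delta> N s a b x = integral {a..b} (\<lambda>t. circle_integrand D \<delta> N s t x)"
    using set_borel_integral_eq_integral(2)[OF borel_integrable_atLeastAtMost'[OF c]] by simp
qed

lemma arc_kernel_norm_subadditive:
  assumes "a \<le> b" "b \<le> c"
  shows "(\<integral>\<^sup>+x. ennreal (norm (arc_kernel D \<delta> N s a c x)) \<partial>polar_measure D) \<le>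
    (\<integral>\<^sup>+x. ennreal (norm (arc_kernel D \<delta> N s a b x)) \<partial>polar_measure D) +
    (\<integral>\<^sup>+x. ennreal (norm (arc_kernel D \<delta> N s b c x)) \<partial>polar_measure D)"
proof -
  have [measurable]: "arc_kernel D \<delta> N s a b \<in> borel_measurable borel" "arc_kernel D \<delta> N s b c \<in> borel_measurable borel"
    using assms by (auto intro: borel_measurable_arc_kernel)
  have "arc_kernel D \<delta> N s a c x = arc_kernel D \<delta> N s a b x + arc_kernel D \<delta> N s b c x" for x
    unfolding arc_kernel_eq_integral
    by (rule Henstock_Kurzweil_Integration.integral_combine[OF assms arc_kernel_integrable, symmetric])
  then have "(\<integral>\<^sup>+x. ennreal (norm (arc_kernel D \<delta> N s a c x)) \<partial>polar_measure D) \<le>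
    (\<integral>\<^sup>+x. ennreal (norm (arc_kernel D \<delta> N s a b x)) + ennreal (norm (arc_kernel D \<delta> N s b c x)) \<partial>polar_measure D)"
    by (intro nn_integral_mono) (simp add: norm_triangle_ineq flip: ennreal_plus)
  also have "\<dots> = (\<integral>\<^sup>+x. ennreal (norm (arc_kernel D \<delta> N s a b x)) \<partial>polar_measure D) +
    (\<integral>\<^sup>+x. ennreal (norm (arc_kernel D \<delta> N s b c x)) \<partial>polar_measure D)"
    by (rule nn_integral_add) auto
  finally show ?thesis .
qed

text \<open>Stated for an abstract set function \<open>U\<close>, so that it serves the upper half
  circle directly and the lower one after reflection.\<close>

lemma dyadic_summation:
  fixes U :: "real \<Rightarrow> real \<Rightarrow> ennreal" and \<kappa> B :: real
  assumes sub: "\<And>b c. 0 \<le> b \<Longrightarrow> b \<le> c \<Longrightarrow> U 0 c \<le> U 0 b + U b c"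
    and piece: "\<And>a b \<tau>. 0 \<le> a \<Longrightarrow> a \<le> b \<Longrightarrow> b \<le> 1 / 2 \<Longrightarrow> b - a \<le> 1 / 4 \<Longrightarrow> b - a \<le> \<tau> \<Longrightarrow> circle_gap N \<le> \<tau> \<Longrightarrow>
      (\<And>t. t \<in> {a..b} \<Longrightarrow> \<tau> \<le> norm (1 - circle_pt N t) \<and> norm (1 - circle_pt N t) \<le> 8 * \<tau>) \<Longrightarrow>
      U a b \<le> ennreal (B * (\<tau> / circle_gap N) powr (- \<kappa>))"
    and \<kappa>: "\<kappa> > 0" and B: "B \<ge> 0"
  shows "U 0 (1 / 2) \<le> ennreal (B * (1 + 1 / (1 - 2 powr (- \<kappa>))))"
proof -
  define \<eta> where "\<eta> = circle_gap N"
  have g: "0 < \<eta>" "\<eta> \<le> 1 / 2" using circle_gap_bounds[of N] by (auto simp: \<eta>_def)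
  \<comment> \<open>\<open>J\<close> makes \<open>h\<close> comparable to the gap,
    \<open>\<eta>/2 <= h <= \<eta>\<close>, while \<open>2^J h\<close> is exactly 1/2: the dyadic
    points end at the half circle without a remainder.\<close>
  obtain J where J: "2 ^ J \<le> N + 2" "N + 2 < 2 ^ (J + 1)"
    using ex_power_ivl1[of 2 "N + 2"] by auto
  have J1: "J \<ge> 1" using J(2) by (cases J) auto
  define h where "h = (1 / 2 ^ (J + 1) :: real)"
  have "real (2 ^ J) \<le> real (N + 2)" "real (N + 2) < real (2 ^ (J + 1))" using J by (simp_all only: of_nat_le_iff of_nat_less_iff)
  then have h: "\<eta> / 2 \<le> h" "h \<le> \<eta>" by (auto simp: h_def \<eta>_def circle_gap_def field_simps)
  have h0: "h > 0" by (simp add: h_def)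
  have hJ: "2 ^ J * h = 1 / 2" by (simp add: h_def)
  have low: "\<eta> \<le> norm (1 - circle_pt N t)" for t
    using one_minus_circle_pt_bounds(1)[of N t] by (simp add: \<eta>_def)
  have bds: "2 * t \<le> norm (1 - circle_pt N t)" "norm (1 - circle_pt N t) \<le> \<eta> + 7 * t" if "0 \<le> t" "t \<le> 1 / 2" for t
    using norm_one_minus_circlepath[of "1 - circle_gap N" t] that g by (auto simp: circle_pt_def \<eta>_def)
  define q where "q = 2 powr (- \<kappa>)"
  have q: "0 < q" "q < 1" using \<kappa> by (auto simp: q_def powr_less_one)
  have "U 0 (2 ^ n * h) \<le> ennreal (B * (1 + (\<Sum>i<n. q ^ i)))" if "n \<le> J" for n
    using that
  proof (induction n)
    case 0
    have "h \<le> 1 / 2 ^ (1 + 1)" unfolding h_def using J1 by (intro divide_left_mono power_increasing) auto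
    then have h4: "h \<le> 1 / 4" by simp
    \<comment> \<open>The initial arc uses \<open>\<tau> = \<eta>\<close>, so its power equals 1; it
      is the summand 1 in front of the geometric series.\<close>
    have "U 0 h \<le> ennreal (B * (\<eta> / circle_gap N) powr (- \<kappa>))"
    proof (rule piece)
      fix t assume "t \<in> {0..h}"
      then show "\<eta> \<le> norm (1 - circle_pt N t) \<and> norm (1 - circle_pt N t) \<le> 8 * \<eta>"
        using low[of t] bds(2)[of t] h h4 by auto
    qed (use h h0 h4 in \<open>auto simp: \<eta>_def\<close>)
    then show ?case using g by (simp add: \<eta>_def)
  next
    case (Suc n)
    \<comment> \<open>The right endpoint of the new arc, which runs from \<open>\<tau>/2\<close> to
      \<tau>. There \<open>2t >= \<tau>\<close> and \<open>\<eta> + 7t <= 8\<tau>\<close>, as the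
      arc condition demands.\<close>
    define \<tau> where "\<tau> = 2 * (2 ^ n * h)"
    have "2 ^ Suc n * h \<le> 2 ^ J * h" using Suc.prems h0 by (intro mult_right_mono power_increasing) auto
    then have \<tau>: "\<tau> \<le> 1 / 2" using hJ by (simp add: \<tau>_def)
    have "1 * h \<le> 2 ^ n * h" using h0 by (intro mult_right_mono) auto
    then have \<tau>\<eta>: "\<eta> \<le> \<tau>" using h by (simp add: \<tau>_def)
    have p: "U (2 ^ n * h) \<tau> \<le> ennreal (B * (\<tau> / circle_gap N) powr (- \<kappa>))"
    proof (rule piece)
      fix t assume "t \<in> {2 ^ n * h..\<tau>}"
      then have "\<tau> \<le> 2 * t" "t \<le> \<tau>" "0 \<le> t" using h0 by (auto simp: \<tau>_def intro: order_trans[rotated])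
      then show "\<tau> \<le> norm (1 - circle_pt N t) \<and> norm (1 - circle_pt N t) \<le> 8 * \<tau>"
        using bds[of t] \<tau> \<tau>\<eta> by auto
    qed (use \<tau> \<tau>\<eta> h0 in \<open>auto simp: \<tau>_def \<eta>_def mult_ac\<close>)
    have "2 ^ n * (\<eta> / \<eta>) \<le> 2 ^ n * (2 * h / \<eta>)" using h g by (intro mult_left_mono divide_right_mono) auto
    then have "2 ^ n \<le> \<tau> / \<eta>" using g by (simp add: \<tau>_def mult_ac)
    then have "(\<tau> / \<eta>) powr (- \<kappa>) \<le> (2 ^ n) powr (- \<kappa>)" using \<kappa> by (intro powr_mono2') auto
    also have "\<dots> = q ^ n" by (simp add: q_def powr_powr powr_realpow[symmetric] mult.commute flip: powr_realpow)
    finally have "B * (\<tau> / circle_gap N) powr (- \<kappa>) \<le> B * q ^ n" using B by (intro mult_left_mono) (auto simp: \<eta>_def)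
    with p have p': "U (2 ^ n * h) \<tau> \<le> ennreal (B * q ^ n)" by (meson ennreal_leI order_trans)
    have "U 0 \<tau> \<le> U 0 (2 ^ n * h) + U (2 ^ n * h) \<tau>" using h0 by (intro sub) (auto simp: \<tau>_def)
    also have "\<dots> \<le> ennreal (B * (1 + (\<Sum>i<n. q ^ i))) + ennreal (B * q ^ n)"
      using Suc by (intro add_mono p') auto
    also have "\<dots> = ennreal (B * (1 + (\<Sum>i<Suc n. q ^ i)))"
      using B q by (subst ennreal_plus[symmetric]) (auto simp: algebra_simps sum_nonneg)
    finally show ?case by (simp add: \<tau>_def mult.assoc)
  qed
  from this[of J] have "U 0 (1 / 2) \<le> ennreal (B * (1 + (\<Sum>i<J. q ^ i)))" by (simp only: hJ order_refl)
  also have "(\<Sum>i<J. q ^ i) \<le> 1 / (1 - q)"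
    using q by (simp add: sum_gp_strict divide_right_mono)
  then have "ennreal (B * (1 + (\<Sum>i<J. q ^ i))) \<le> ennreal (B * (1 + 1 / (1 - q)))"
    using B by (intro ennreal_leI mult_left_mono) auto
  finally show ?thesis by (simp only: q_def)
qed

text \<open>Two dyadic decompositions, one for each half of the circle, both starting at
  \<open>w = 1\<close>.\<close>

lemma circle_kernel_L1_bound:
  fixes D \<delta> :: real
  assumes D: "D \<ge> 2" and \<delta>: "\<delta> > (D - 1) / 2"
  shows "\<exists>C>0. \<forall>N s. (\<integral>\<^sup>+x. ennreal (norm (arc_kernel D \<delta> N s 0 1 x)) \<partial>polar_measure D) \<le>
      ennreal (C * circle_gap N powr (- \<delta>))"
proof -
  define \<kappa> where "\<kappa> = (\<delta> - (D - 1) / 2) / 2"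
  have \<kappa>: "\<kappa> > 0" using \<delta> by (simp add: \<kappa>_def)
  obtain C where C: "C > 0" and piece: "\<And>N s a b \<tau>. a \<le> b \<Longrightarrow> b - a \<le> 1 / 4 \<Longrightarrow> b - a \<le> \<tau> \<Longrightarrow> circle_gap N \<le> \<tau> \<Longrightarrow>
     (\<forall>t\<in>{a..b}. \<tau> \<le> norm (1 - circle_pt N t) \<and> norm (1 - circle_pt N t) \<le> 8 * \<tau>) \<Longrightarrow>
     (\<integral>\<^sup>+x. ennreal (norm (arc_kernel D \<delta> N s a b x)) \<partial>polar_measure D) \<le>
       ennreal (C * circle_gap N powr (- \<delta>) * (\<tau> / circle_gap N) powr (- \<kappa>))"
    using arc_kernel_L1_bound[OF D \<delta>] unfolding \<kappa>_def by metis
  define S where "S = 1 + 1 / (1 - 2 powr (- \<kappa>))"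
  have "2 powr (- \<kappa>) < 1" using \<kappa> by (simp add: powr_less_one)
  then have S: "S > 0" by (simp add: S_def add_pos_pos)
  show ?thesis
  proof (intro exI[of _ "2 * (C * S)"] conjI allI)
    show "2 * (C * S) > 0" using C S by simp
    fix N s
    define T where "T a b = (\<integral>\<^sup>+x. ennreal (norm (arc_kernel D \<delta> N s a b x)) \<partial>polar_measure D)" for a b
    define B where "B = C * circle_gap N powr (- \<delta>)"
    have B: "B \<ge> 0" using C by (simp add: B_def)
    have T: "T a b \<le> ennreal (B * (\<tau> / circle_gap N) powr (- \<kappa>))"
      if "a \<le> b" "b - a \<le> 1 / 4" "b - a \<le> \<tau>" "circle_gap N \<le> \<tau>"
        "\<And>t. t \<in> {a..b} \<Longrightarrow> \<tau> \<le> norm (1 - circle_pt N t) \<and> norm (1 - circle_pt N t) \<le> 8 * \<tau>" for a b \<tau>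
      unfolding T_def B_def by (rule piece) (use that in auto)
    have sub: "T a c \<le> T a b + T b c" if "a \<le> b" "b \<le> c" for a b c
      unfolding T_def by (rule arc_kernel_norm_subadditive[OF that])
    have refl: "norm (1 - circle_pt N (1 - t)) = norm (1 - circle_pt N t)" for t
      unfolding circle_pt_def circlepath_reflect
      using complex_mod_cnj[of "1 - circlepath 0 (1 - circle_gap N) t"] by simp
    have L: "T 0 (1 / 2) \<le> ennreal (B * S)"
      unfolding S_def by (rule dyadic_summation[where N=N]) (use sub T \<kappa> B in auto)
    \<comment> \<open>\<open>t\<close> and \<open>1 - t\<close> give conjugate points, so distances
      to 1 agree; the second half is traversed backwards.\<close>
    have R: "T (1 - 1 / 2) (1 - 0) \<le> ennreal (B * S)"
      unfolding S_def
    proof (rule dyadic_summation[where N=N and U="\<lambda>a b. T (1 - b) (1 - a)"])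
      show "T (1 - c) (1 - 0) \<le> T (1 - b) (1 - 0) + T (1 - c) (1 - b)" if "0 \<le> b" "b \<le> c" for b c
        using sub[of "1 - c" "1 - b" "1 - 0"] that by (simp add: add.commute)
      show "T (1 - b) (1 - a) \<le> ennreal (B * (\<tau> / circle_gap N) powr (- \<kappa>))"
        if "0 \<le> a" "a \<le> b" "b \<le> 1 / 2" "b - a \<le> 1 / 4" "b - a \<le> \<tau>" "circle_gap N \<le> \<tau>"
        "\<And>t. t \<in> {a..b} \<Longrightarrow> \<tau> \<le> norm (1 - circle_pt N t) \<and> norm (1 - circle_pt N t) \<le> 8 * \<tau>" for a b \<tau>
      proof (rule T)
        fix t assume "t \<in> {1 - b..1 - a}"
        then have "1 - t \<in> {a..b}" by auto
        from that(7)[OF this] show "\<tau> \<le> norm (1 - circle_pt N t) \<and> norm (1 - circle_pt N t) \<le> 8 * \<tau>"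
          by (simp add: refl)
      qed (use that in auto)
    qed (use \<kappa> B in auto)
    have "T 0 1 \<le> T 0 (1 / 2) + T (1 / 2) 1" by (rule sub) auto
    also have "\<dots> \<le> ennreal (B * S) + ennreal (B * S)" using L R by (intro add_mono) auto
    also have "\<dots> = ennreal (2 * (C * S) * circle_gap N powr (- \<delta>))"
      using C S by (subst ennreal_plus[symmetric]) (auto simp: B_def mult_ac)
    finally show "(\<integral>\<^sup>+x. ennreal (norm (arc_kernel D \<delta> N s 0 1 x)) \<partial>polar_measure D) \<le>
      ennreal (2 * (C * S) * circle_gap N powr (- \<delta>))" by (simp add: T_def)
  qed
qed

section \<open>Schur test and Minkowski inequality\<close>

lemma ennpow_ennreal: "x \<ge> 0 \<Longrightarrow> ennpow (ennreal x) p = ennreal (x powr p)"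
  by (simp add: ennpow_def)

lemma ennpow_mono:
  assumes "x \<le> y" "p > 0"
  shows "ennpow x p \<le> ennpow y p"
proof (cases "y = \<infinity>")
  case False
  then have "x \<noteq> \<infinity>" "enn2real x \<le> enn2real y"
    using assms by (auto simp: enn2real_mono less_top top_unique)
  then show ?thesis using False assms by (auto simp: ennpow_def intro!: ennreal_leI powr_mono2)
qed (simp add: ennpow_def)

lemma borel_measurable_ennpow [measurable]:
  assumes [measurable]: "g \<in> borel_measurable M"
  shows "(\<lambda>x. ennpow (g x) p) \<in> borel_measurable M"
  unfolding ennpow_def by measurable

lemma ennpow_half_power2: "ennpow (x\<^sup>2) (1 / 2) = x"
proof (cases x)
  case (real r)
  then show ?thesis by (simp add: ennreal_power ennpow_ennreal powr_half_sqrt)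
qed (simp add: ennpow_def power2_eq_square ennreal_top_mult)

lemma ennpow_mult_inverse_exponent:
  assumes "c \<ge> 0" "p > 0" "x < \<infinity>"
  shows "ennpow (ennreal (c powr p) * x) (1 / p) = ennreal c * ennpow x (1 / p)"
proof -
  obtain r where r: "x = ennreal r" "r \<ge> 0" using assms(3) by (cases x) auto
  then have "ennpow (ennreal (c powr p) * x) (1 / p) = ennreal ((c powr p * r) powr (1 / p))"
    by (simp add: ennreal_mult'[symmetric] ennpow_ennreal)
  also have "(c powr p * r) powr (1 / p) = c * r powr (1 / p)"
    using assms by (simp add: powr_mult powr_powr)
  finally show ?thesis using r assms by (simp add: ennpow_ennreal ennreal_mult')
qed

text \<open>Young's inequality with a free point \<open>t\<close> at which equality holds: the
  tangent to the concave function \<open>x powr (1/p)\<close> at \<open>t powr p\<close>, evaluated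
  at the p-th power of \<open>g\<close>.\<close>

lemma ennreal_Young_tangent:
  assumes p: "p > 1" and t: "t > 0"
  shows "g \<le> ennreal (t powr (1 - p) / p) * ennpow g p + ennreal (t * (1 - 1 / p))"
proof (cases g)
  case (real x)
  define y where "y = x / t"
  have y: "y \<ge> 0" using real t by (simp add: y_def)
  have "y * 1 \<le> y powr p / p + 1 powr (p / (p - 1)) / (p / (p - 1))"
    using p y by (intro Youngs_inequality) (auto simp: field_simps)
  then have "t * y \<le> t * (y powr p / p + (1 - 1 / p))"
    using p t by (intro mult_left_mono) (auto simp: field_simps)
  also have "t * y = x" using t by (simp add: y_def)
  also have "t * (y powr p / p + (1 - 1 / p)) = t powr (1 - p) / p * x powr p + t * (1 - 1 / p)"
    using t real by (simp add: y_def powr_divide powr_diff field_simps)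
  finally have "ennreal x \<le> ennreal (t powr (1 - p) / p * x powr p + t * (1 - 1 / p))" by (rule ennreal_leI)
  also have "\<dots> = ennreal (t powr (1 - p) / p) * ennreal (x powr p) + ennreal (t * (1 - 1 / p))"
    using p t by (subst ennreal_plus) (auto simp: ennreal_mult'[symmetric])
  finally show ?thesis using real by (simp add: ennpow_ennreal)
next
  case top
  then show ?thesis using p t by (simp add: ennpow_def ennreal_mult_top)
qed

text \<open>Hoelder for the weight \<open>a\<close>: Young's inequality is integrated against
  \<open>a\<close>, then \<open>t\<close> is optimized. Everything takes place in
  \<open>ennreal\<close>, with no integrability to check.\<close>

lemma nn_integral_Hoelder_weight:
  assumes [measurable]: "a \<in> borel_measurable M" "g \<in> borel_measurable M"
    and p: "p > 1" and c: "c > 0" and mass: "(\<integral>\<^sup>+x. a x \<partial>M) \<le> ennreal c"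
  shows "ennpow (\<integral>\<^sup>+x. a x * g x \<partial>M) p \<le> ennreal (c powr (p - 1)) * (\<integral>\<^sup>+x. a x * ennpow (g x) p \<partial>M)"
proof (cases "\<integral>\<^sup>+x. a x * ennpow (g x) p \<partial>M")
  case top
  then show ?thesis using c by (simp add: ennreal_mult_top)
next
  case (real I)
  show ?thesis
  proof (cases "I = 0")
    case True
    \<comment> \<open>The optimal \<open>t\<close> would be 0 here, which Young's inequality does
      not admit.\<close>
    then have "AE x in M. a x * ennpow (g x) p = 0" using real by (simp add: nn_integral_0_iff_AE)
    then have "AE x in M. a x * g x = 0"
    proof eventually_elim
      case (elim x)
      then have "a x = 0 \<or> ennpow (g x) p = 0" by simp
      then show ?case
      proof
        assume "ennpow (g x) p = 0"
        then have "g x = 0" using p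
          by (cases "g x") (auto simp: ennpow_def split: if_splits)
        then show ?thesis by simp
      qed simp
    qed
    then have "(\<integral>\<^sup>+x. a x * g x \<partial>M) = 0" by (simp add: nn_integral_0_iff_AE)
    then show ?thesis by (simp add: ennpow_def)
  next
    case False
    with real have I: "I > 0" by simp
    \<comment> \<open>The minimizer of the right side as a function of \<open>t\<close>.\<close>
    define t where "t = (I / c) powr (1 / p)"
    have t: "t > 0" using I c by (simp add: t_def)
    have tp: "t powr p = I / c" using I c p by (simp add: t_def powr_powr)
    have "(\<integral>\<^sup>+x. a x * g x \<partial>M) \<le> (\<integral>\<^sup>+x. ennreal (t powr (1 - p) / p) * (a x * ennpow (g x) p) + ennreal (t * (1 - 1 / p)) * a x \<partial>M)"
    proof (rule nn_integral_mono)
      fix x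
      have "a x * g x \<le> a x * (ennreal (t powr (1 - p) / p) * ennpow (g x) p + ennreal (t * (1 - 1 / p)))"
        by (intro mult_left_mono ennreal_Young_tangent p t) simp
      then show "a x * g x \<le> ennreal (t powr (1 - p) / p) * (a x * ennpow (g x) p) + ennreal (t * (1 - 1 / p)) * a x"
        by (simp only: distrib_left mult_ac)
    qed
    also have "\<dots> = ennreal (t powr (1 - p) / p) * (\<integral>\<^sup>+x. a x * ennpow (g x) p \<partial>M) + ennreal (t * (1 - 1 / p)) * (\<integral>\<^sup>+x. a x \<partial>M)"
      by (simp add: nn_integral_add nn_integral_cmult)
    also have "\<dots> \<le> ennreal (t powr (1 - p) / p) * ennreal I + ennreal (t * (1 - 1 / p)) * ennreal c"
      using real mass by (intro add_mono mult_left_mono) auto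
    also have "\<dots> = ennreal (t powr (1 - p) / p * I + t * (1 - 1 / p) * c)"
      using I c t p by (subst ennreal_plus) (auto simp: ennreal_mult'[symmetric])
    also have "t powr (1 - p) / p * I + t * (1 - 1 / p) * c = c * t"
    proof -
      have "t powr (1 - p) = t * c / I" using t I c tp by (simp add: powr_diff)
      then have "t powr (1 - p) / p * I = t * c / p" using I by simp
      then show ?thesis by (simp add: algebra_simps)
    qed
    finally have "ennpow (\<integral>\<^sup>+x. a x * g x \<partial>M) p \<le> ennpow (ennreal (c * t)) p"
      using p by (intro ennpow_mono) auto
    also have "\<dots> = ennreal (c powr (p - 1) * I)"
    proof -
      have "(c * t) powr p = c powr p * (I / c)" using tp by (simp add: powr_mult)
      also have "\<dots> = c powr (p - 1) * I" using c by (simp add: powr_diff)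
      finally show ?thesis using c t by (simp add: ennpow_ennreal)
    qed
    finally show ?thesis using real by (simp add: ennreal_mult')
  qed
qed

text \<open>Hoelder in each row costs \<open>c^(p-1)\<close> by the row mass; after Tonelli the
  column mass contributes the last factor \<open>c\<close>.\<close>

lemma Schur_test_nn_integral:
  assumes M: "sigma_finite_measure M"
    and a [measurable]: "(\<lambda>(x, y). a x y) \<in> borel_measurable (M \<Otimes>\<^sub>M M)"
    and g [measurable]: "g \<in> borel_measurable M" and p: "p > 1" and c: "c > 0"
    and row: "\<And>x. x \<in> space M \<Longrightarrow> (\<integral>\<^sup>+y. a x y \<partial>M) \<le> ennreal c"
    and col: "\<And>y. y \<in> space M \<Longrightarrow> (\<integral>\<^sup>+x. a x y \<partial>M) \<le> ennreal c"
  shows "(\<integral>\<^sup>+x. ennpow (\<integral>\<^sup>+y. a x y * g y \<partial>M) p \<partial>M) \<le> ennreal (c powr p) * (\<integral>\<^sup>+y. ennpow (g y) p \<partial>M)"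
proof -
  interpret M: sigma_finite_measure M by fact
  interpret P: pair_sigma_finite M M ..
  have "(\<integral>\<^sup>+x. ennpow (\<integral>\<^sup>+y. a x y * g y \<partial>M) p \<partial>M) \<le>
      (\<integral>\<^sup>+x. ennreal (c powr (p - 1)) * (\<integral>\<^sup>+y. a x y * ennpow (g y) p \<partial>M) \<partial>M)"
    by (intro nn_integral_mono nn_integral_Hoelder_weight p c row) auto
  also have "\<dots> = ennreal (c powr (p - 1)) * (\<integral>\<^sup>+x. \<integral>\<^sup>+y. a x y * ennpow (g y) p \<partial>M \<partial>M)"
    by (rule nn_integral_cmult) measurable
  also have "(\<integral>\<^sup>+x. \<integral>\<^sup>+y. a x y * ennpow (g y) p \<partial>M \<partial>M) = (\<integral>\<^sup>+y. \<integral>\<^sup>+x. a x y * ennpow (g y) p \<partial>M \<partial>M)"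
    by (rule P.Fubini'[symmetric]) measurable
  also have "\<dots> \<le> (\<integral>\<^sup>+y. ennreal c * ennpow (g y) p \<partial>M)"
  proof (rule nn_integral_mono)
    fix y assume y: "y \<in> space M"
    then have "(\<integral>\<^sup>+x. a x y * ennpow (g y) p \<partial>M) = (\<integral>\<^sup>+x. a x y \<partial>M) * ennpow (g y) p"
      by (intro nn_integral_multc) measurable
    also have "\<dots> \<le> ennreal c * ennpow (g y) p" by (intro mult_right_mono col y) simp
    finally show "(\<integral>\<^sup>+x. a x y * ennpow (g y) p \<partial>M) \<le> ennreal c * ennpow (g y) p" .
  qed
  also have "\<dots> = ennreal c * (\<integral>\<^sup>+y. ennpow (g y) p \<partial>M)"
    by (rule nn_integral_cmult) measurable
  finally have "(\<integral>\<^sup>+x. ennpow (\<integral>\<^sup>+y. a x y * g y \<partial>M) p \<partial>M) \<le>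
     ennreal (c powr (p - 1)) * (ennreal c * (\<integral>\<^sup>+y. ennpow (g y) p \<partial>M))"
    by (simp add: mult_left_mono)
  also have "\<dots> = ennreal (c powr (p - 1) * c) * (\<integral>\<^sup>+y. ennpow (g y) p \<partial>M)"
    using c by (simp add: ennreal_mult' mult.assoc)
  also have "c powr (p - 1) * c = c powr p" using c by (simp add: powr_diff)
  finally show ?thesis .
qed

text \<open>With \<open>b\<^sub>i = \<integral> a |f\<^sub>i|\<close> one has \<open>\<Sum> b\<^sub>i\<^sup>2 = \<integral> a \<Sum> b\<^sub>i |f\<^sub>i| \<le> (\<Sum> b\<^sub>i\<^sup>2)\<^bsup>1/2\<^esup> \<integral> a G\<close> for every
  finite set of indices.\<close>
lemma Minkowski_finite_l2:
  fixes f :: "'i \<Rightarrow> 'a \<Rightarrow> complex"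
  assumes I: "finite I" and [measurable]: "a \<in> borel_measurable M" "\<And>i. i \<in> I \<Longrightarrow> f i \<in> borel_measurable M"
      "G \<in> borel_measurable M"
    and G: "\<And>x. x \<in> space M \<Longrightarrow> ennreal (sqrt (\<Sum>i\<in>I. (norm (f i x))\<^sup>2)) \<le> G x"
  shows "(\<Sum>i\<in>I. (\<integral>\<^sup>+x. a x * ennreal (norm (f i x)) \<partial>M)\<^sup>2) \<le> (\<integral>\<^sup>+x. a x * G x \<partial>M)\<^sup>2"
proof (cases "\<integral>\<^sup>+x. a x * G x \<partial>M")
  case (real H)
  \<comment> \<open>Each term is finite, so the argument can continue with real numbers
    \<open>b i\<close> and divide by \<open>S\<close> at the end.\<close>
  have le: "(\<integral>\<^sup>+x. a x * ennreal (norm (f i x)) \<partial>M) \<le> ennreal H" if i: "i \<in> I" for i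
  proof -
    have "norm (f i x) \<le> sqrt (\<Sum>i\<in>I. (norm (f i x))\<^sup>2)" for x
      using I i by (intro real_le_rsqrt member_le_sum) auto
    then have "(\<integral>\<^sup>+x. a x * ennreal (norm (f i x)) \<partial>M) \<le> (\<integral>\<^sup>+x. a x * G x \<partial>M)"
      by (intro nn_integral_mono mult_left_mono order_trans[OF _ G] ennreal_leI) auto
    then show ?thesis by (simp only: real)
  qed
  define b where "b i = enn2real (\<integral>\<^sup>+x. a x * ennreal (norm (f i x)) \<partial>M)" for i
  have b0: "b i \<ge> 0" for i by (simp add: b_def)
  have b: "(\<integral>\<^sup>+x. a x * ennreal (norm (f i x)) \<partial>M) = ennreal (b i)" if "i \<in> I" for i
    using le[OF that] unfolding b_def by (intro ennreal_enn2real[symmetric]) (auto intro: le_less_trans)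
  define S where "S = sqrt (\<Sum>i\<in>I. (b i)\<^sup>2)"
  have S0: "S \<ge> 0" by (simp add: S_def sum_nonneg)
  have SS: "S\<^sup>2 = (\<Sum>i\<in>I. (b i)\<^sup>2)" by (simp add: S_def sum_nonneg)
  have "ennreal (S\<^sup>2) = (\<Sum>i\<in>I. ennreal (b i) * (\<integral>\<^sup>+x. a x * ennreal (norm (f i x)) \<partial>M))"
    unfolding SS by (simp add: b b0 power2_eq_square ennreal_mult' flip: sum_ennreal)
  also have "\<dots> = (\<Sum>i\<in>I. (\<integral>\<^sup>+x. a x * (ennreal (b i) * ennreal (norm (f i x))) \<partial>M))"
    by (intro sum.cong refl) (subst nn_integral_cmult[symmetric], auto simp: mult_ac)
  also have "\<dots> = (\<integral>\<^sup>+x. (\<Sum>i\<in>I. a x * (ennreal (b i) * ennreal (norm (f i x)))) \<partial>M)"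
    by (rule nn_integral_sum[symmetric]) auto
  also have "\<dots> \<le> (\<integral>\<^sup>+x. ennreal S * (a x * G x) \<partial>M)"
  proof (rule nn_integral_mono)
    fix x assume x: "x \<in> space M"
    have "(\<Sum>i\<in>I. b i * norm (f i x)) \<le> S * sqrt (\<Sum>i\<in>I. (norm (f i x))\<^sup>2)"
    proof (rule power2_le_imp_le)
      show "(\<Sum>i\<in>I. b i * norm (f i x))\<^sup>2 \<le> (S * sqrt (\<Sum>i\<in>I. (norm (f i x))\<^sup>2))\<^sup>2"
        unfolding power_mult_distrib SS using Cauchy_Schwarz_ineq_sum[of b "\<lambda>i. norm (f i x)" I]
        by (simp add: sum_nonneg)
    qed (simp add: S0 sum_nonneg)
    then have "ennreal (\<Sum>i\<in>I. b i * norm (f i x)) \<le> ennreal S * ennreal (sqrt (\<Sum>i\<in>I. (norm (f i x))\<^sup>2))"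
      using S0 by (simp add: ennreal_mult'[symmetric] ennreal_leI)
    also have "\<dots> \<le> ennreal S * G x" by (intro mult_left_mono G x) simp
    finally have "ennreal (\<Sum>i\<in>I. b i * norm (f i x)) \<le> ennreal S * G x" .
    then have "a x * (\<Sum>i\<in>I. ennreal (b i) * ennreal (norm (f i x))) \<le> a x * (ennreal S * G x)"
      by (intro mult_left_mono) (simp_all add: b0 ennreal_mult'[symmetric])
    then show "(\<Sum>i\<in>I. a x * (ennreal (b i) * ennreal (norm (f i x)))) \<le> ennreal S * (a x * G x)"
      by (simp only: sum_distrib_left[symmetric] mult_ac)
  qed
  also have "\<dots> = ennreal (S * H)"
    using S0 by (subst nn_integral_cmult) (auto simp: real ennreal_mult')
  finally have "S\<^sup>2 \<le> S * H" using S0 real by (subst (asm) ennreal_le_iff) auto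
  then have "S \<le> H" using S0 real by (cases "S = 0") (auto simp: power2_eq_square)
  then have "S\<^sup>2 \<le> H\<^sup>2" using S0 by (intro power_mono) auto
  then have "ennreal (\<Sum>i\<in>I. (b i)\<^sup>2) \<le> ennreal (H\<^sup>2)" unfolding SS by (rule ennreal_leI)
  then show ?thesis using real by (simp add: b b0 ennreal_power flip: sum_ennreal)
qed (simp add: power2_eq_square ennreal_top_mult)

section \<open>Majorants of the Dunkl kernels\<close>

lemma cesaro_A_pos: "a > -1 \<Longrightarrow> cesaro_A a n > 0"
  unfolding cesaro_A_eq_prod by (intro prod_pos) (auto intro!: divide_pos_pos)

text \<open>The binomial coefficient is asymptotic to
  \<open>N^\<delta> / Gamma (\<delta> + 1)\<close>, from the asymptotics of binomials with upper
  index \<open>-\<delta> - 1\<close>.\<close>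

lemma inverse_cesaro_A_bound:
  fixes \<delta> :: real
  assumes \<delta>: "\<delta> > 0"
  shows "\<exists>C>0. \<forall>N. 1 / cesaro_A \<delta> N \<le> C * circle_gap N powr \<delta>"
proof -
  have lim: "(\<lambda>n. cesaro_A \<delta> n / real n powr \<delta>) \<longlonglongrightarrow> inverse (Gamma (\<delta> + 1))"
  proof (rule Lim_transform_eventually)
    show "(\<lambda>n. ((- \<delta> - 1) gchoose n) / ((-1) ^ n / exp ((- \<delta> - 1 + 1) * of_real (ln (real n))))) \<longlonglongrightarrow> inverse (Gamma (\<delta> + 1))"
      using gbinomial_asymptotic[of "- \<delta> - 1"] by (simp add: add.commute)
    show "\<forall>\<^sub>F n in sequentially. ((- \<delta> - 1) gchoose n) / ((-1) ^ n / exp ((- \<delta> - 1 + 1) * of_real (ln (real n)))) =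
        cesaro_A \<delta> n / real n powr \<delta>"
      using eventually_gt_at_top[of 0]
    proof eventually_elim
      case (elim n)
      have "((- \<delta> - 1) gchoose n) = (-1) ^ n * cesaro_A \<delta> n"
      proof -
        have "- \<delta> - 1 = - (\<delta> + 1)" by simp
        then show ?thesis unfolding cesaro_A_def by (simp only: gbinomial_minus) (simp add: add.commute)
      qed
      moreover have "exp ((- \<delta> - 1 + 1) * of_real (ln (real n))) = 1 / real n powr \<delta>"
        using elim by (simp add: powr_def exp_minus inverse_eq_divide)
      ultimately show ?case by simp
    qed
  qed
  have lim2: "(\<lambda>n. ((real n + 2) / real n) powr \<delta>) \<longlonglongrightarrow> 1 powr \<delta>"
  proof (intro tendsto_intros)
    have "(\<lambda>n. 1 + 2 / real n) \<longlonglongrightarrow> 1 + 0"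
      by (intro tendsto_intros tendsto_divide_0[OF tendsto_const] filterlim_real_sequentially filterlim_at_top_imp_at_infinity)
    moreover have "\<forall>\<^sub>F n in sequentially. 1 + 2 / real n = (real n + 2) / real n"
      using eventually_gt_at_top[of 0] by eventually_elim (simp add: field_simps)
    ultimately show "(\<lambda>n. (real n + 2) / real n) \<longlonglongrightarrow> 1"
      by (simp add: Lim_transform_eventually)
  qed simp
  have G: "Gamma (\<delta> + 1) > 0" using \<delta> by (intro Gamma_real_pos) simp
  have "(\<lambda>n. ((real n + 2) / real n) powr \<delta> / (cesaro_A \<delta> n / real n powr \<delta>)) \<longlonglongrightarrow> 1 powr \<delta> / inverse (Gamma (\<delta> + 1))"
    using G by (intro tendsto_divide lim lim2) simp
  moreover have "\<forall>\<^sub>F n in sequentially. ((real n + 2) / real n) powr \<delta> / (cesaro_A \<delta> n / real n powr \<delta>) = (real n + 2) powr \<delta> / cesaro_A \<delta> n"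
    using eventually_gt_at_top[of 0] by eventually_elim (simp add: powr_divide)
  ultimately have "(\<lambda>n. (real n + 2) powr \<delta> / cesaro_A \<delta> n) \<longlonglongrightarrow> 1 powr \<delta> / inverse (Gamma (\<delta> + 1))"
    by (rule Lim_transform_eventually)
  \<comment> \<open>A convergent sequence is bounded from index 0 on, so the finitely many
    \<open>N\<close> outside the asymptotic range need no care.\<close>
  then have "Bseq (\<lambda>n. (real n + 2) powr \<delta> / cesaro_A \<delta> n)" by (intro convergent_imp_Bseq convergentI)
  then obtain C where C: "C > 0" "\<And>n. norm ((real n + 2) powr \<delta> / cesaro_A \<delta> n) \<le> C" by (auto elim: BseqE)
  have "1 / cesaro_A \<delta> N \<le> C * circle_gap N powr \<delta>" for N
  proof -
    have "circle_gap N powr \<delta> = 1 / (real N + 2) powr \<delta>"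
      by (simp add: circle_gap_def powr_divide)
    moreover have "(real N + 2) powr \<delta> / cesaro_A \<delta> N \<le> C"
      using C(2)[of N] cesaro_A_pos[of \<delta> N] \<delta> by simp
    ultimately have "circle_gap N powr \<delta> * ((real N + 2) powr \<delta> / cesaro_A \<delta> N) \<le> circle_gap N powr \<delta> * C"
      by (intro mult_left_mono) auto
    moreover have "circle_gap N powr \<delta> * ((real N + 2) powr \<delta> / cesaro_A \<delta> N) = 1 / cesaro_A \<delta> N"
      by (simp add: circle_gap_def powr_divide)
    ultimately show ?thesis by (simp only: mult.commute)
  qed
  with C(1) show ?thesis by blast
qed

lemma cesaro_kernel_eq_arc_kernel:
  "of_real (cesaro_kernel d \<delta> \<gamma> N r s u) =
     of_real (pi powr (- real d / 2)) * arc_kernel (real d + 2 * \<gamma>) \<delta> N s 0 1 (r, u)"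
proof -
  have "(\<lambda>t. circle_integrand (real d + 2 * \<gamma>) \<delta> N s t (r, u)) =
      (\<lambda>t. cesaro_gen (real d + 2 * \<gamma>) \<delta> (circlepath 0 (1 - circle_gap N) t) r s u / circlepath 0 (1 - circle_gap N) t ^ N)"
    by (simp add: circle_integrand_def circle_pt_def)
  then have "arc_kernel (real d + 2 * \<gamma>) \<delta> N s 0 1 (r, u) =
      (deriv ^^ N) (\<lambda>w. cesaro_gen (real d + 2 * \<gamma>) \<delta> w r s u) 0 / fact N"
    unfolding arc_kernel_eq_integral using circle_gap_bounds[of N]
    by (simp only:) (intro integral_unique deriv_funpow_circle_integral holomorphic_cesaro_gen; simp)
  then show ?thesis by (simp only: cesaro_kernel_eq_deriv)
qed

lemma abs_cesaro_kernel:
  "\<bar>cesaro_kernel d \<delta> \<gamma> N r s u\<bar> = pi powr (- real d / 2) * norm (arc_kernel (real d + 2 * \<gamma>) \<delta> N s 0 1 (r, u))"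
  using arg_cong[OF cesaro_kernel_eq_arc_kernel[of d \<delta> \<gamma> N r s u], of norm] by (simp only: norm_mult norm_of_real) simp

text \<open>The symmetry lets a bound on column integrals serve for the rows in the Schur
  test.\<close>

lemma cesaro_kernel_commute: "cesaro_kernel d \<delta> \<gamma> N r s u = cesaro_kernel d \<delta> \<gamma> N s r u"
proof -
  have "circle_integrand D \<delta> N s t (r, u) = circle_integrand D \<delta> N r t (s, u)" for D t
    by (simp add: circle_integrand_def cesaro_gen_def mehler_gen_commute[of D _ r s])
  then have "arc_kernel D \<delta> N s 0 1 (r, u) = arc_kernel D \<delta> N r 0 1 (s, u)" for D
    unfolding arc_kernel_def by simp
  then have "complex_of_real (cesaro_kernel d \<delta> \<gamma> N r s u) = of_real (cesaro_kernel d \<delta> \<gamma> N s r u)"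
    unfolding cesaro_kernel_eq_arc_kernel by (simp only:)
  then show ?thesis by (simp only: of_real_eq_iff)
qed

lemma borel_measurable_cesaro_kernel:
  "(\<lambda>((r, s), u). cesaro_kernel d \<delta> \<gamma> N r s u) \<in> borel_measurable (borel \<Otimes>\<^sub>M borel)"
proof -
  define D where "D = real d + 2 * \<gamma>"
  interpret V: finite_measure "interval_lborel 0 1" by (rule finite_interval_lborel) simp
  have "continuous_on UNIV (\<lambda>z::((real \<times> real) \<times> real) \<times> real.
      circle_integrand D \<delta> N (snd (fst (fst z))) (snd z) (fst (fst (fst z)), snd (fst z)))"
    by (intro continuous_on_circle_integrand continuous_intros)
  then have "(\<lambda>(x, t). circle_integrand D \<delta> N (snd (fst x)) t (fst (fst x), snd x)) \<in>
      borel_measurable (borel \<Otimes>\<^sub>M borel :: (((real \<times> real) \<times> real) \<times> real) measure)"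
    by (simp add: borel_prod case_prod_beta' borel_measurable_continuous_onI)
  then have "(\<lambda>(x, t). circle_integrand D \<delta> N (snd (fst x)) t (fst (fst x), snd x)) \<in>
      borel_measurable (borel \<Otimes>\<^sub>M interval_lborel 0 1)"
    by (simp cong: measurable_cong_sets sets_pair_measure_cong)
  then have "(\<lambda>x. arc_kernel D \<delta> N (snd (fst x)) 0 1 (fst (fst x), snd x)) \<in> borel_measurable borel"
    unfolding arc_kernel_def by (rule V.borel_measurable_lebesgue_integral)
  then have "(\<lambda>x. Re (of_real (pi powr (- real d / 2)) * arc_kernel D \<delta> N (snd (fst x)) 0 1 (fst (fst x), snd x))) \<in> borel_measurable borel"
    by measurable
  then have "(\<lambda>x. cesaro_kernel d \<delta> \<gamma> N (fst (fst x)) (snd (fst x)) (snd x)) \<in> borel_measurable borel"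
    unfolding D_def cesaro_kernel_eq_arc_kernel[symmetric] by simp
  then show ?thesis by (simp add: borel_prod case_prod_beta')
qed

lemma cesaro_A_minus_1: "cesaro_A (-1) j = (if j = 0 then 1 else 0)"
  by (auto simp: cesaro_A_eq_prod prod_zero_iff intro!: bexI[of _ 1])

text \<open>At \<open>\<delta> = -1\<close> and \<open>\<gamma> = 0\<close> both binomial sequences
  reduce to their term of index 0. Measurability and bounds for \<open>hermite_Phi\<close> thus
  follow from the contour representation.\<close>

lemma hermite_Phi_eq_cesaro_kernel: "hermite_Phi d i r s u = cesaro_kernel d (-1) 0 i r s u"
proof -
  define F where "F = (\<Sum>k=0..i. cesaro_A (-1) (i - k) * hermite_Phi d k r s u)"
  have "F = (\<Sum>k=0..i. if k = i then hermite_Phi d k r s u else 0)"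
    unfolding F_def by (rule sum.cong) (auto simp: cesaro_A_minus_1)
  then have F: "F = hermite_Phi d i r s u" by simp
  have "cesaro_kernel d (-1) 0 i r s u = (\<Sum>j=0..i div 2. if j = 0 then F else 0)"
    unfolding cesaro_kernel_def F_def by (rule sum.cong) (auto simp: cesaro_A_minus_1[simplified])
  then show ?thesis by (simp add: F)
qed

text \<open>Qualitative, with no control in \<open>r\<close>, \<open>s\<close> and \<open>i\<close>;
  it serves the integrability in \<open>u\<close> of the single summands.\<close>

lemma hermite_Phi_bounded:
  "\<exists>B. \<forall>u\<in>{-1..1}. \<bar>hermite_Phi d i r s u\<bar> \<le> B"
proof -
  define B where "B = 4 * (circle_gap i powr (- real d / 2))"
  have pt: "norm (circle_integrand (real d) (-1) i s t (r, u)) \<le> B" if "u \<in> {-1..1}" for t u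
  proof -
    have u: "\<bar>snd (r, u)\<bar> \<le> 1" using that by auto
    have "0 \<le> r\<^sup>2 + s\<^sup>2 - 2 * r * s * u" using u by (intro chord_square_nonneg) auto
    then have "exp (- (circle_gap i / (4 * (norm (1 - circle_pt i t))\<^sup>2)) * (r\<^sup>2 + s\<^sup>2 - 2 * r * s * u)) \<le> 1"
      using circle_gap_bounds[of i] by (simp add: mult_nonpos_nonneg)
    moreover have "norm (1 - (circle_pt i t)\<^sup>2) powr (- real d / 2) \<le> circle_gap i powr (- real d / 2)"
      using one_minus_circle_pt_bounds(2)[of i t] circle_gap_bounds[of i] by (intro powr_mono2') auto
    moreover have "norm (1 - circle_pt i t) powr (- (-1) - 1) \<le> 1" by simp
    ultimately have "4 * norm (1 - circle_pt i t) powr (- (-1) - 1) * norm (1 - (circle_pt i t)\<^sup>2) powr (- real d / 2) *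
        exp (- (circle_gap i / (4 * (norm (1 - circle_pt i t))\<^sup>2)) * (r\<^sup>2 + s\<^sup>2 - 2 * r * s * u)) \<le>
        4 * 1 * circle_gap i powr (- real d / 2) * 1"
      by (intro mult_mono) auto
    then show ?thesis using norm_circle_integrand_le[OF u, of "real d" "-1" i s t] by (simp add: B_def)
  qed
  have B0: "B \<ge> 0" by (simp add: B_def)
  have "\<bar>hermite_Phi d i r s u\<bar> \<le> pi powr (- real d / 2) * B" if u: "u \<in> {-1..1}" for u
  proof -
    have "ennreal (norm (arc_kernel (real d) (-1) i s 0 1 (r, u))) \<le> (\<integral>\<^sup>+t. ennreal (norm (circle_integrand (real d) (-1) i s t (r, u))) \<partial>interval_lborel 0 1)"
      unfolding arc_kernel_def by (rule ennreal_norm_integral_le_nn_integral)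
    also have "\<dots> \<le> (\<integral>\<^sup>+t. ennreal B \<partial>interval_lborel 0 1)"
      by (intro nn_integral_mono ennreal_leI pt u)
    also have "\<dots> = ennreal B" by (simp only: nn_integral_const emeasure_interval_lborel[of 0 1]) simp
    finally have "norm (arc_kernel (real d) (-1) i s 0 1 (r, u)) \<le> B" using B0 by simp
    then show ?thesis using mult_left_mono[of _ B "pi powr (- real d / 2)"]
      by (simp add: hermite_Phi_eq_cesaro_kernel abs_cesaro_kernel)
  qed
  then show ?thesis by blast
qed

lemma borel_measurable_cesaro_kernel_u [measurable]:
  "(\<lambda>u. cesaro_kernel d \<delta> \<gamma> N r s u) \<in> borel_measurable borel"
  using measurable_compose[OF _ borel_measurable_cesaro_kernel, of "\<lambda>u. ((r, s), u)" borel]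
  by simp

text \<open>The exponential integral at \<open>b = 0\<close>, where only the term
  \<open>n = 0\<close> of the series is left.\<close>

lemma integrable_Gegenbauer_weight:
  assumes "c > -1"
  shows "integrable lborel (\<lambda>u. indicator {-1..1} u * (1 - u\<^sup>2) powr c :: real)"
proof (rule integrableI_nonneg)
  have "(\<integral>\<^sup>+u. ennreal (indicator {-1..1} u * (1 - u\<^sup>2) powr c) \<partial>lborel) =
      (\<integral>\<^sup>+u. ennreal (indicator {-1<..<1} u * (1 - u\<^sup>2) powr c) * ennreal (exp (0 * u)) \<partial>lborel)"
    by (intro nn_integral_cong) (auto simp: indicator_def power2_eq_1_iff less_le)
  also have "\<dots> = (\<Sum>n. ennreal (0 ^ (2 * n) / fact (2 * n) * Beta (real n + 1 / 2) (c + 1)))"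
    by (rule nn_integral_exp_Gegenbauer_weight[OF assms])
  also have "\<dots> = (\<Sum>n\<in>{0}. ennreal (0 ^ (2 * n) / fact (2 * n) * Beta (real n + 1 / 2) (c + 1)))"
    by (rule suminf_finite) (auto simp: power_0_left)
  finally show "(\<integral>\<^sup>+u. ennreal (indicator {-1..1} u * (1 - u\<^sup>2) powr c) \<partial>lborel) < \<infinity>" by simp
qed auto

definition kernel_majorant :: "nat \<Rightarrow> real \<Rightarrow> real \<Rightarrow> nat \<Rightarrow> real \<Rightarrow> real \<Rightarrow> ennreal" where
  "kernel_majorant d \<delta> \<gamma> N r s =
     (\<integral>\<^sup>+u. ennreal (indicator {-1<..<1} u * (1 - u\<^sup>2) powr ((real d + 2 * \<gamma> - 3) / 2)) *
        ennreal \<bar>cesaro_kernel d \<delta> \<gamma> N r s u\<bar> \<partial>lborel)"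

text \<open>The only place where \<open>m\<close> is eliminated: after moving the finite sums under
  the integral, the ultraspherical factor is bounded by 1.\<close>

lemma abs_dunkl_kernel_le:
  assumes d: "d \<ge> 2" and \<gamma>: "\<gamma> \<ge> 0" and \<delta>: "\<delta> > -1"
  shows "ennreal \<bar>dunkl_kernel d \<delta> \<gamma> N m r s\<bar> \<le>
    ennreal (dunkl_const d \<gamma> / cesaro_A \<delta> N) * kernel_majorant d \<delta> \<gamma> N r s"
proof -
  define lam where "lam = real d / 2 + \<gamma> - 1"
  have lam: "lam \<ge> 0" using d \<gamma> by (simp add: lam_def)
  define c where "c = (real d + 2 * \<gamma> - 3) / 2"
  have c: "lam - 1 / 2 = c" "c > -1" using d \<gamma> by (simp_all add: lam_def c_def field_simps)
  define W where "W u = (1 - u\<^sup>2) powr c" for u :: real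
  define P where "P = ultraspherical lam m"
  have P1: "\<bar>poly P u\<bar> \<le> 1" if "u \<in> {-1..1}" for u
    unfolding P_def using that lam by (intro abs_ultraspherical_le_1) auto
  have [measurable]: "W \<in> borel_measurable borel" unfolding W_def by measurable
  have [measurable]: "poly P \<in> borel_measurable borel"
    by (intro borel_measurable_continuous_onI continuous_intros)
  have Phi_meas [measurable]: "(\<lambda>u. hermite_Phi d i r s u) \<in> borel_measurable borel" for i
    unfolding hermite_Phi_eq_cesaro_kernel by measurable
  \<comment> \<open>A Bochner integral distributes over a finite sum only if every summand is
    integrable.\<close>
  have Phi_int: "integrable lborel (\<lambda>u. indicator {-1..1} u * (hermite_Phi d i r s u * poly P u * W u))" for i
  proof -
    obtain B where B: "\<And>u. u \<in> {-1..1} \<Longrightarrow> \<bar>hermite_Phi d i r s u\<bar> \<le> B"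
      using hermite_Phi_bounded[of d i r s] by blast
    have "B \<ge> 0" using B[of 0] by simp
    have "integrable lborel (\<lambda>u. B * (indicator {-1..1} u * W u))"
      unfolding W_def by (intro integrable_mult_right integrable_Gegenbauer_weight c)
    then show ?thesis
    proof (rule Bochner_Integration.integrable_bound)
      show "AE u in lborel. norm (indicator {-1..1} u * (hermite_Phi d i r s u * poly P u * W u)) \<le> norm (B * (indicator {-1..1} u * W u))"
      proof (rule AE_I2)
        fix u :: real
        have "\<bar>hermite_Phi d i r s u\<bar> * \<bar>poly P u\<bar> \<le> B * 1" if "u \<in> {-1..1}"
          using \<open>B \<ge> 0\<close> by (intro mult_mono B P1 that) auto
        then show "norm (indicator {-1..1} u * (hermite_Phi d i r s u * poly P u * W u)) \<le> norm (B * (indicator {-1..1} u * W u))"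
          using \<open>B \<ge> 0\<close> by (auto simp: indicator_def abs_mult W_def intro!: mult_right_mono)
      qed
    qed measurable
  qed
  have summand: "cesaro_A (\<gamma> - 1) j * cesaro_A \<delta> n * (LINT u:{-1..1}|lborel. hermite_cesaro \<delta> d n r s u * poly P u * W u) =
      (\<integral>u. indicator {-1..1} u * ((cesaro_A (\<gamma> - 1) j * (\<Sum>i=0..n. cesaro_A \<delta> (n - i) * hermite_Phi d i r s u)) * poly P u * W u) \<partial>lborel)"
    for j n
  proof -
    \<comment> \<open>Nonvanishing is needed to cancel this coefficient against the normalization
      inside \<open>hermite_cesaro\<close>.\<close>
    have "cesaro_A \<delta> n > 0" by (rule cesaro_A_pos[OF \<delta>])
    then have "cesaro_A (\<gamma> - 1) j * cesaro_A \<delta> n * (indicator {-1..1} u * (hermite_cesaro \<delta> d n r s u * poly P u * W u)) =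
       indicator {-1..1} u * ((cesaro_A (\<gamma> - 1) j * (\<Sum>i=0..n. cesaro_A \<delta> (n - i) * hermite_Phi d i r s u)) * poly P u * W u)" for u
      by (simp add: hermite_cesaro_def)
    then show ?thesis
      unfolding set_lebesgue_integral_def real_scaleR_def integral_mult_right_zero[symmetric] by (simp only:)
  qed
  have term_int: "integrable lborel (\<lambda>u. indicator {-1..1} u * ((cesaro_A (\<gamma> - 1) j * (\<Sum>i=0..n. cesaro_A \<delta> (n - i) * hermite_Phi d i r s u)) * poly P u * W u))" for j n
  proof -
    have "integrable lborel (\<lambda>u. \<Sum>i=0..n. (cesaro_A (\<gamma> - 1) j * cesaro_A \<delta> (n - i)) * (indicator {-1..1} u * (hermite_Phi d i r s u * poly P u * W u)))"
      by (intro Bochner_Integration.integrable_sum integrable_mult_right Phi_int)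
    then show ?thesis by (simp add: sum_distrib_left sum_distrib_right mult_ac)
  qed
  have "dunkl_kernel d \<delta> \<gamma> N m r s = dunkl_const d \<gamma> / cesaro_A \<delta> N *
      (\<Sum>j=0..N div 2. cesaro_A (\<gamma> - 1) j * cesaro_A \<delta> (N - 2 * j) *
         (LINT u:{-1..1}|lborel. hermite_cesaro \<delta> d (N - 2 * j) r s u * poly P u * W u))"
    unfolding dunkl_kernel_def Let_def lam_def[symmetric] P_def W_def c(1) ..
  also have "\<dots> = dunkl_const d \<gamma> / cesaro_A \<delta> N *
      (\<integral>u. indicator {-1..1} u * (cesaro_kernel d \<delta> \<gamma> N r s u * poly P u * W u) \<partial>lborel)"
    unfolding summand Bochner_Integration.integral_sum[OF term_int, symmetric] cesaro_kernel_def
    by (simp only: sum_distrib_left sum_distrib_right)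
  finally have eq: "dunkl_kernel d \<delta> \<gamma> N m r s = dunkl_const d \<gamma> / cesaro_A \<delta> N *
      (\<integral>u. indicator {-1..1} u * (cesaro_kernel d \<delta> \<gamma> N r s u * poly P u * W u) \<partial>lborel)" .
  have dc: "dunkl_const d \<gamma> > 0"
    unfolding dunkl_const_def using d \<gamma> by (intro divide_pos_pos Gamma_real_pos add_pos_nonneg) auto
  have q: "dunkl_const d \<gamma> / cesaro_A \<delta> N \<ge> 0" using dc cesaro_A_pos[OF \<delta>, of N] by simp
  have "ennreal (norm (\<integral>u. indicator {-1..1} u * (cesaro_kernel d \<delta> \<gamma> N r s u * poly P u * W u) \<partial>lborel)) \<le>
      (\<integral>\<^sup>+u. ennreal (norm (indicator {-1..1} u * (cesaro_kernel d \<delta> \<gamma> N r s u * poly P u * W u))) \<partial>lborel)"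
    by (rule ennreal_norm_integral_le_nn_integral)
  also have "\<dots> \<le> kernel_majorant d \<delta> \<gamma> N r s"
    unfolding kernel_majorant_def c_def[symmetric]
  proof (rule nn_integral_mono)
    fix u :: real
    have "norm (indicator {-1..1} u * (cesaro_kernel d \<delta> \<gamma> N r s u * poly P u * W u)) \<le>
        indicator {-1<..<1} u * W u * \<bar>cesaro_kernel d \<delta> \<gamma> N r s u\<bar>"
    proof (cases "u \<in> {-1<..<1}")
      case True
      then have "\<bar>poly P u\<bar> \<le> 1" by (intro P1) auto
      then have "\<bar>cesaro_kernel d \<delta> \<gamma> N r s u\<bar> * W u * \<bar>poly P u\<bar> \<le> \<bar>cesaro_kernel d \<delta> \<gamma> N r s u\<bar> * W u"
        by (intro mult_left_le) (auto simp: W_def)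
      then show ?thesis using True by (simp add: abs_mult W_def mult_ac)
    next
      case False
      then show ?thesis by (auto simp: indicator_def W_def power2_eq_1_iff less_le)
    qed
    then show "ennreal (norm (indicator {-1..1} u * (cesaro_kernel d \<delta> \<gamma> N r s u * poly P u * W u))) \<le>
        ennreal (indicator {-1<..<1} u * (1 - u\<^sup>2) powr c) * ennreal \<bar>cesaro_kernel d \<delta> \<gamma> N r s u\<bar>"
      by (subst ennreal_mult'[symmetric]) (auto simp: W_def intro!: ennreal_leI)
  qed
  finally have "ennreal (dunkl_const d \<gamma> / cesaro_A \<delta> N) * ennreal (norm (\<integral>u. indicator {-1..1} u * (cesaro_kernel d \<delta> \<gamma> N r s u * poly P u * W u) \<partial>lborel))
     \<le> ennreal (dunkl_const d \<gamma> / cesaro_A \<delta> N) * kernel_majorant d \<delta> \<gamma> N r s"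
    by (intro mult_left_mono) auto
  then show ?thesis unfolding eq abs_mult abs_of_nonneg[OF q] ennreal_mult'[OF q] real_norm_def .
qed

section \<open>The radial measure, the mass of the majorant, and the operators\<close>

lemma measurable_ident_radial [measurable]: "(\<lambda>x. x) \<in> measurable (radial_measure d \<gamma>) borel"
  unfolding radial_measure_def by (simp add: measurable_restrict_space1)

lemma sigma_finite_radial_measure: "sigma_finite_measure (radial_measure d \<gamma>)"
proof -
  interpret sigma_finite_measure "restrict_space lborel {(0::real)<..}"
    by (rule sigma_finite_measure_restrict_space[OF sigma_finite_lborel]) auto
  show ?thesis unfolding radial_measure_def
    by (subst sigma_finite_iff_density_finite) (auto intro!: measurable_restrict_space1)
qed

lemma nn_integral_radial_measure:
  assumes [measurable]: "g \<in> borel_measurable (radial_measure d \<gamma>)"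
  shows "(\<integral>\<^sup>+r. g r \<partial>radial_measure d \<gamma>) =
    (\<integral>\<^sup>+r. ennreal (r powr (real d + 2 * \<gamma> - 1)) * g r * indicator {0<..} r \<partial>lborel)"
proof -
  have g: "g \<in> borel_measurable (restrict_space lborel {0<..})"
    using assms by (simp add: radial_measure_def)
  have "(\<integral>\<^sup>+r. g r \<partial>radial_measure d \<gamma>) =
      (\<integral>\<^sup>+r. ennreal (r powr (real d + 2 * \<gamma> - 1)) * g r \<partial>restrict_space lborel {0<..})"
    unfolding radial_measure_def using g
    by (intro nn_integral_density) (auto intro!: measurable_restrict_space1)
  also have "\<dots> = (\<integral>\<^sup>+r. ennreal (r powr (real d + 2 * \<gamma> - 1)) * g r * indicator {0<..} r \<partial>lborel)"
    by (rule nn_integral_restrict_space) simp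
  finally show ?thesis .
qed

lemma borel_measurable_kernel_majorant [measurable]:
  "(\<lambda>(r, s). kernel_majorant d \<delta> \<gamma> N r s) \<in> borel_measurable (borel \<Otimes>\<^sub>M borel)"
proof -
  have [measurable]: "(\<lambda>z. cesaro_kernel d \<delta> \<gamma> N (fst (fst z)) (snd (fst z)) (snd z)) \<in>
      borel_measurable ((borel \<Otimes>\<^sub>M borel) \<Otimes>\<^sub>M lborel)"
  proof -
    have "sets (((borel :: real measure) \<Otimes>\<^sub>M (borel :: real measure)) \<Otimes>\<^sub>M lborel) = sets ((borel :: (real \<times> real) measure) \<Otimes>\<^sub>M (borel :: real measure))"
      by (intro sets_pair_measure_cong arg_cong[OF borel_prod]) simp
    then show ?thesis
      using borel_measurable_cesaro_kernel[of d \<delta> \<gamma> N]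
      by (subst measurable_cong_sets[OF _ refl]) (assumption, simp add: case_prod_beta')
  qed
  show ?thesis unfolding kernel_majorant_def case_prod_beta'
    by (rule lborel.borel_measurable_nn_integral) (simp add: case_prod_beta')
qed

lemma kernel_majorant_commute: "kernel_majorant d \<delta> \<gamma> N r s = kernel_majorant d \<delta> \<gamma> N s r"
  unfolding kernel_majorant_def by (simp only: cesaro_kernel_commute[of d \<delta> \<gamma> N r s])

text \<open>\<open>polar_measure\<close> is the product of the radial weight and the Gegenbauer
  weight, so integrating the majorant in \<open>r\<close> gives the L1 norm over the full
  circle.\<close>

lemma nn_integral_kernel_majorant:
  "(\<integral>\<^sup>+r. kernel_majorant d \<delta> \<gamma> N r s \<partial>radial_measure d \<gamma>) =
     ennreal (pi powr (- real d / 2)) *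
       (\<integral>\<^sup>+x. ennreal (norm (arc_kernel (real d + 2 * \<gamma>) \<delta> N s 0 1 x)) \<partial>polar_measure (real d + 2 * \<gamma>))"
proof -
  let ?D = "real d + 2 * \<gamma>"
  have [measurable]: "arc_kernel ?D \<delta> N s 0 1 \<in> borel_measurable borel"
    by (rule borel_measurable_arc_kernel) simp
  have mr: "(\<lambda>r. kernel_majorant d \<delta> \<gamma> N r s) \<in> borel_measurable (radial_measure d \<gamma>)"
    using measurable_compose[OF _ borel_measurable_kernel_majorant[of d \<delta> \<gamma> N], of "\<lambda>r. (r, s)" "radial_measure d \<gamma>"]
    by simp
  have K: "kernel_majorant d \<delta> \<gamma> N r s = (\<integral>\<^sup>+u. ennreal (indicator {-1<..<1} u * (1 - u\<^sup>2) powr ((?D - 3) / 2)) *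
        (ennreal (pi powr (- real d / 2)) * ennreal (norm (arc_kernel ?D \<delta> N s 0 1 (r, u)))) \<partial>lborel)" for r
    unfolding kernel_majorant_def abs_cesaro_kernel by (simp add: ennreal_mult')
  have "(\<integral>\<^sup>+r. kernel_majorant d \<delta> \<gamma> N r s \<partial>radial_measure d \<gamma>) =
      (\<integral>\<^sup>+r. ennreal (indicator {0<..} r * r powr (?D - 1)) * kernel_majorant d \<delta> \<gamma> N r s \<partial>lborel)"
    unfolding nn_integral_radial_measure[OF mr]
    by (intro nn_integral_cong) (auto simp: indicator_def)
  also have "\<dots> = (\<integral>\<^sup>+x. ennreal (pi powr (- real d / 2)) * ennreal (norm (arc_kernel ?D \<delta> N s 0 1 x)) \<partial>polar_measure ?D)"
    unfolding K by (rule nn_integral_polar_measure[symmetric]) measurable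
  also have "\<dots> = ennreal (pi powr (- real d / 2)) * (\<integral>\<^sup>+x. ennreal (norm (arc_kernel ?D \<delta> N s 0 1 x)) \<partial>polar_measure ?D)"
    by (rule nn_integral_cmult) measurable
  finally show ?thesis .
qed

definition majorant :: "nat \<Rightarrow> real \<Rightarrow> real \<Rightarrow> nat \<Rightarrow> real \<Rightarrow> real \<Rightarrow> ennreal" where
  "majorant d \<delta> \<gamma> N r s = ennreal (dunkl_const d \<gamma> / cesaro_A \<delta> N) * kernel_majorant d \<delta> \<gamma> N r s"

lemma borel_measurable_majorant:
  "(\<lambda>(r, s). majorant d \<delta> \<gamma> N r s) \<in> borel_measurable (radial_measure d \<gamma> \<Otimes>\<^sub>M radial_measure d \<gamma>)"
proof -
  have "(\<lambda>z. (fst z, snd z)) \<in> measurable (radial_measure d \<gamma> \<Otimes>\<^sub>M radial_measure d \<gamma>) (borel \<Otimes>\<^sub>M borel)"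
    by (intro measurable_Pair measurable_compose[OF measurable_fst] measurable_compose[OF measurable_snd] measurable_ident_radial)
  from measurable_compose[OF this borel_measurable_kernel_majorant[of d \<delta> \<gamma> N]]
  show ?thesis unfolding majorant_def by (simp add: case_prod_beta')
qed

lemma majorant_commute: "majorant d \<delta> \<gamma> N r s = majorant d \<delta> \<gamma> N s r"
  by (simp only: majorant_def kernel_majorant_commute[of d \<delta> \<gamma> N r s])

lemma majorant_mass_bound:
  assumes d: "d \<ge> 2" and \<gamma>: "\<gamma> \<ge> 0" and \<delta>: "\<delta> > (real d + 2 * \<gamma> - 1) / 2"
  shows "\<exists>C>0. \<forall>N s. (\<integral>\<^sup>+r. majorant d \<delta> \<gamma> N r s \<partial>radial_measure d \<gamma>) \<le> ennreal C"
proof -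
  define D where "D = real d + 2 * \<gamma>"
  have D: "D \<ge> 2" "\<delta> > (D - 1) / 2" using d \<gamma> \<delta> by (auto simp: D_def)
  then have \<delta>0: "\<delta> > 0" by simp
  obtain C1 where C1: "C1 > 0" and L1: "\<And>N s. (\<integral>\<^sup>+x. ennreal (norm (arc_kernel D \<delta> N s 0 1 x)) \<partial>polar_measure D) \<le>
      ennreal (C1 * circle_gap N powr (- \<delta>))"
    using circle_kernel_L1_bound[OF D] by blast
  obtain C2 where C2: "C2 > 0" and A: "\<And>N. 1 / cesaro_A \<delta> N \<le> C2 * circle_gap N powr \<delta>"
    using inverse_cesaro_A_bound[OF \<delta>0] by blast
  have dc: "dunkl_const d \<gamma> > 0"
    unfolding dunkl_const_def using d \<gamma> by (intro divide_pos_pos Gamma_real_pos add_pos_nonneg) auto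
  define C where "C = dunkl_const d \<gamma> * C2 * (pi powr (- real d / 2) * C1)"
  show ?thesis
  proof (intro exI[of _ C] conjI allI)
    show "C > 0" using dc C1 C2 by (simp add: C_def)
    fix N s
    define g where "g = circle_gap N"
    have g: "g > 0" using circle_gap_bounds[of N] by (simp add: g_def)
    have q: "dunkl_const d \<gamma> / cesaro_A \<delta> N \<ge> 0" using dc cesaro_A_pos[of \<delta> N] \<delta>0 by simp
    have mr: "(\<lambda>r. kernel_majorant d \<delta> \<gamma> N r s) \<in> borel_measurable (radial_measure d \<gamma>)"
      using measurable_compose[OF _ borel_measurable_kernel_majorant[of d \<delta> \<gamma> N], of "\<lambda>r. (r, s)" "radial_measure d \<gamma>"]
      by simp
    have "(\<integral>\<^sup>+r. majorant d \<delta> \<gamma> N r s \<partial>radial_measure d \<gamma>) =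
        ennreal (dunkl_const d \<gamma> / cesaro_A \<delta> N) * (ennreal (pi powr (- real d / 2)) *
          (\<integral>\<^sup>+x. ennreal (norm (arc_kernel D \<delta> N s 0 1 x)) \<partial>polar_measure D))"
      unfolding majorant_def D_def nn_integral_kernel_majorant[symmetric] by (rule nn_integral_cmult[OF mr])
    also have "\<dots> \<le> ennreal (dunkl_const d \<gamma> / cesaro_A \<delta> N) * (ennreal (pi powr (- real d / 2)) * ennreal (C1 * g powr (- \<delta>)))"
      unfolding g_def by (intro mult_left_mono L1) auto
    also have "\<dots> = ennreal (dunkl_const d \<gamma> / cesaro_A \<delta> N * (pi powr (- real d / 2) * (C1 * g powr (- \<delta>))))"
      by (simp only: ennreal_mult'[OF q] ennreal_mult'[OF powr_ge_zero])
    also have "\<dots> \<le> ennreal C"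
    proof (rule ennreal_leI)
      have "dunkl_const d \<gamma> * (1 / cesaro_A \<delta> N) \<le> dunkl_const d \<gamma> * (C2 * g powr \<delta>)"
        unfolding g_def using dc by (intro mult_left_mono A) auto
      then have "dunkl_const d \<gamma> / cesaro_A \<delta> N * (pi powr (- real d / 2) * (C1 * g powr (- \<delta>))) \<le>
          (dunkl_const d \<gamma> * (C2 * g powr \<delta>)) * (pi powr (- real d / 2) * (C1 * g powr (- \<delta>)))"
        using C1 by (intro mult_right_mono) auto
      also have "\<dots> = C * (g powr \<delta> * g powr (- \<delta>))" by (simp only: C_def mult_ac)
      \<comment> \<open>The growth of the contour bound in \<open>N\<close> cancels exactly against
        the decay of the inverse Cesaro coefficient.\<close>
      also have "g powr \<delta> * g powr (- \<delta>) = 1" using g by (simp flip: powr_add)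
      finally show "dunkl_const d \<gamma> / cesaro_A \<delta> N * (pi powr (- real d / 2) * (C1 * g powr (- \<delta>))) \<le> C" by simp
    qed
    finally show "(\<integral>\<^sup>+r. majorant d \<delta> \<gamma> N r s \<partial>radial_measure d \<gamma>) \<le> ennreal C" .
  qed
qed

text \<open>Valid also where the integral defining the operator diverges, since
  \<open>dunkl_op\<close> then takes the default value 0.\<close>

lemma norm_dunkl_op_le:
  assumes d: "d \<ge> 2" and \<gamma>: "\<gamma> \<ge> 0" and \<delta>: "\<delta> > -1" and f: "f \<in> borel_measurable (radial_measure d \<gamma>)"
    and r: "r \<in> space (radial_measure d \<gamma>)"
  shows "ennreal (norm (dunkl_op d \<delta> \<gamma> N m f r)) \<le>
    (\<integral>\<^sup>+s. majorant d \<delta> \<gamma> N r s * ennreal (norm (f s)) \<partial>radial_measure d \<gamma>)"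
proof -
  let ?w = "\<lambda>s. s powr (real d + 2 * \<gamma> - 1)"
  have "(\<lambda>s. majorant d \<delta> \<gamma> N r s) \<in> borel_measurable (radial_measure d \<gamma>)"
    using measurable_Pair2[OF borel_measurable_majorant r] by simp
  then have m: "(\<lambda>s. majorant d \<delta> \<gamma> N r s * ennreal (norm (f s))) \<in> borel_measurable (radial_measure d \<gamma>)"
    using f by measurable
  have "ennreal (norm (dunkl_op d \<delta> \<gamma> N m f r)) \<le>
      (\<integral>\<^sup>+s. ennreal (norm (indicat_real {0<..} s *\<^sub>R (complex_of_real (dunkl_kernel d \<delta> \<gamma> N m r s) * f s * complex_of_real (?w s)))) \<partial>lborel)"
    unfolding dunkl_op_def set_lebesgue_integral_def by (rule ennreal_norm_integral_le_nn_integral)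
  also have "\<dots> \<le> (\<integral>\<^sup>+s. ennreal (?w s) * (majorant d \<delta> \<gamma> N r s * ennreal (norm (f s))) * indicator {0<..} s \<partial>lborel)"
  proof (rule nn_integral_mono)
    fix s :: real
    have "ennreal \<bar>dunkl_kernel d \<delta> \<gamma> N m r s\<bar> * (ennreal (norm (f s)) * ennreal (?w s)) \<le>
        majorant d \<delta> \<gamma> N r s * (ennreal (norm (f s)) * ennreal (?w s))"
      unfolding majorant_def by (intro mult_right_mono abs_dunkl_kernel_le d \<gamma> \<delta>) auto
    then show "ennreal (norm (indicat_real {0<..} s *\<^sub>R (complex_of_real (dunkl_kernel d \<delta> \<gamma> N m r s) * f s * complex_of_real (?w s)))) \<le>
        ennreal (?w s) * (majorant d \<delta> \<gamma> N r s * ennreal (norm (f s))) * indicator {0<..} s"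
      by (cases "s > 0") (simp_all add: norm_mult ennreal_mult' mult_ac)
  qed
  also have "\<dots> = (\<integral>\<^sup>+s. majorant d \<delta> \<gamma> N r s * ennreal (norm (f s)) \<partial>radial_measure d \<gamma>)"
    by (rule nn_integral_radial_measure[OF m, symmetric])
  finally show ?thesis .
qed

text \<open>One majorant for all \<open>m\<close> reduces the vector-valued estimate to a scalar
  operator applied to the square function.\<close>

lemma square_function_dunkl_op_le:
  assumes d: "d \<ge> 2" and \<gamma>: "\<gamma> \<ge> 0" and \<delta>: "\<delta> > -1"
    and f: "\<And>m j. j \<in> {1..harmonic_dim d m} \<Longrightarrow> f m j \<in> borel_measurable (radial_measure d \<gamma>)"
    and r: "r \<in> space (radial_measure d \<gamma>)"
    and G: "square_function d f \<in> borel_measurable (radial_measure d \<gamma>)"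
  shows "square_function d (\<lambda>m j. dunkl_op d \<delta> \<gamma> N m (f m j)) r \<le>
    (\<integral>\<^sup>+s. majorant d \<delta> \<gamma> N r s * square_function d f s \<partial>radial_measure d \<gamma>)"
proof -
  let ?M = "radial_measure d \<gamma>"
  define H where "H = (\<integral>\<^sup>+s. majorant d \<delta> \<gamma> N r s * square_function d f s \<partial>?M)"
  have a: "(\<lambda>s. majorant d \<delta> \<gamma> N r s) \<in> borel_measurable ?M"
    using measurable_Pair2[OF borel_measurable_majorant r] by simp
  have "(\<Sum>m<n. \<Sum>j=1..harmonic_dim d m. ennreal ((norm (dunkl_op d \<delta> \<gamma> N m (f m j) r))\<^sup>2)) \<le> H\<^sup>2" for n
  proof -
    define I where "I = Sigma {..<n} (\<lambda>m. {1..harmonic_dim d m})"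
    have I: "finite I" by (simp add: I_def)
    have sumI: "(\<Sum>i\<in>I. g (fst i) (snd i)) = (\<Sum>m<n. \<Sum>j=1..harmonic_dim d m. g m j)"
      for g :: "nat \<Rightarrow> nat \<Rightarrow> 'c::comm_monoid_add"
      unfolding I_def by (subst sum.Sigma) (auto simp: case_prod_beta')
    have "(\<Sum>m<n. \<Sum>j=1..harmonic_dim d m. ennreal ((norm (dunkl_op d \<delta> \<gamma> N m (f m j) r))\<^sup>2)) \<le>
        (\<Sum>i\<in>I. (\<integral>\<^sup>+s. majorant d \<delta> \<gamma> N r s * ennreal (norm (f (fst i) (snd i) s)) \<partial>?M)\<^sup>2)"
      unfolding sumI[of "\<lambda>m j. ennreal ((norm (dunkl_op d \<delta> \<gamma> N m (f m j) r))\<^sup>2)", symmetric]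
    proof (rule sum_mono)
      fix i assume "i \<in> I"
      then have "f (fst i) (snd i) \<in> borel_measurable ?M" by (auto simp: I_def intro!: f)
      from norm_dunkl_op_le[OF d \<gamma> \<delta> this r, of N "fst i"]
      show "ennreal ((norm (dunkl_op d \<delta> \<gamma> N (fst i) (f (fst i) (snd i)) r))\<^sup>2) \<le>
          (\<integral>\<^sup>+s. majorant d \<delta> \<gamma> N r s * ennreal (norm (f (fst i) (snd i) s)) \<partial>?M)\<^sup>2"
        by (simp add: ennreal_power[symmetric] power_mono)
    qed
    also have "\<dots> \<le> H\<^sup>2" unfolding H_def
    proof (rule Minkowski_finite_l2[OF I a _ G])
      show "f (fst i) (snd i) \<in> borel_measurable ?M" if "i \<in> I" for i
        using that by (auto simp: I_def intro!: f)
      fix s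
      define S where "S = (\<Sum>i\<in>I. (norm (f (fst i) (snd i) s))\<^sup>2)"
      have S0: "S \<ge> 0" by (simp add: S_def sum_nonneg)
      have "ennreal S = (\<Sum>m<n. \<Sum>j=1..harmonic_dim d m. ennreal ((norm (f m j s))\<^sup>2))"
        unfolding S_def sumI[of "\<lambda>m j. (norm (f m j s))\<^sup>2"] by (simp add: sum_nonneg)
      also have "\<dots> \<le> (\<Sum>m. \<Sum>j=1..harmonic_dim d m. ennreal ((norm (f m j s))\<^sup>2))"
        by (rule sum_le_suminf) auto
      finally have "ennpow (ennreal S) (1 / 2) \<le> square_function d f s"
        unfolding square_function_def by (rule ennpow_mono) simp
      then show "ennreal (sqrt (\<Sum>i\<in>I. (norm (f (fst i) (snd i) s))\<^sup>2)) \<le> square_function d f s"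
        using S0 by (simp add: ennpow_ennreal powr_half_sqrt S_def[symmetric])
    qed
    finally show ?thesis .
  qed
  \<comment> \<open>The bound does not depend on \<open>n\<close>, and in \<open>ennreal\<close> the
    series is the supremum of its partial sums.\<close>
  then have "(\<Sum>m. \<Sum>j=1..harmonic_dim d m. ennreal ((norm (dunkl_op d \<delta> \<gamma> N m (f m j) r))\<^sup>2)) \<le> H\<^sup>2"
    unfolding suminf_eq_SUP by (rule SUP_least)
  then have "square_function d (\<lambda>m j. dunkl_op d \<delta> \<gamma> N m (f m j)) r \<le> ennpow (H\<^sup>2) (1 / 2)"
    unfolding square_function_def by (rule ennpow_mono) simp
  then show ?thesis by (simp only: ennpow_half_power2 H_def)
qed

theorem theorem1p2:
  fixes d :: nat and \<gamma> \<delta> p :: real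
  assumes "d \<ge> 2"
    and "0 \<le> \<gamma>" and "\<gamma> \<le> 1 / 2"
    and "\<delta> > (real d + 2 * \<gamma> - 1) / 2"
    and "1 < p"
  shows "\<exists>C>0. \<forall>N. \<forall>f :: nat \<Rightarrow> nat \<Rightarrow> real \<Rightarrow> complex.
    (\<forall>m. \<forall>j\<in>{1..harmonic_dim d m}. f m j \<in> Lp_space (radial_measure d \<gamma>) p) \<longrightarrow>
    Lp_norm (radial_measure d \<gamma>) p (square_function d f) < \<infinity> \<longrightarrow>
    Lp_norm (radial_measure d \<gamma>) p
        (square_function d (\<lambda>m j. dunkl_op d \<delta> \<gamma> N m (f m j)))
      \<le> ennreal C * Lp_norm (radial_measure d \<gamma>) p (square_function d f)"
proof -
  let ?M = "radial_measure d \<gamma>"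
  have \<delta>: "\<delta> > -1" using assms by simp
  obtain C where C: "C > 0" and mass: "\<And>N s. (\<integral>\<^sup>+r. majorant d \<delta> \<gamma> N r s \<partial>?M) \<le> ennreal C"
    using majorant_mass_bound[OF assms(1,2,4)] by blast
  have "Lp_norm ?M p (square_function d (\<lambda>m j. dunkl_op d \<delta> \<gamma> N m (f m j))) \<le> ennreal C * Lp_norm ?M p (square_function d f)"
    if f: "\<forall>m. \<forall>j\<in>{1..harmonic_dim d m}. f m j \<in> Lp_space ?M p"
      and fin: "Lp_norm ?M p (square_function d f) < \<infinity>" for N and f :: "nat \<Rightarrow> nat \<Rightarrow> real \<Rightarrow> complex"
  proof -
    have fm: "f m j \<in> borel_measurable ?M" if "j \<in> {1..harmonic_dim d m}" for m j
      using f that by (auto simp: Lp_space_def)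
    have G [measurable]: "square_function d f \<in> borel_measurable ?M"
      unfolding square_function_def using fm
      by (intro borel_measurable_ennpow borel_measurable_suminf_order borel_measurable_sum
          measurable_compose[OF _ measurable_ennreal] borel_measurable_power borel_measurable_norm) auto
    have "(\<integral>\<^sup>+r. ennpow (square_function d (\<lambda>m j. dunkl_op d \<delta> \<gamma> N m (f m j)) r) p \<partial>?M) \<le>
        (\<integral>\<^sup>+r. ennpow (\<integral>\<^sup>+s. majorant d \<delta> \<gamma> N r s * square_function d f s \<partial>?M) p \<partial>?M)"
      using assms \<delta> fm G by (intro nn_integral_mono ennpow_mono square_function_dunkl_op_le) auto
    also have "\<dots> \<le> ennreal (C powr p) * (\<integral>\<^sup>+s. ennpow (square_function d f s) p \<partial>?M)"
    proof (rule Schur_test_nn_integral[OF sigma_finite_radial_measure borel_measurable_majorant G \<open>1 < p\<close> C])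
      \<comment> \<open>Rows become columns by symmetry of the majorant.\<close>
      show "(\<integral>\<^sup>+s. majorant d \<delta> \<gamma> N r s \<partial>?M) \<le> ennreal C" for r
        using mass[of N r] by (simp only: majorant_commute[of d \<delta> \<gamma> N r])
    qed (rule mass)
    finally have "Lp_norm ?M p (square_function d (\<lambda>m j. dunkl_op d \<delta> \<gamma> N m (f m j))) \<le>
        ennpow (ennreal (C powr p) * (\<integral>\<^sup>+s. ennpow (square_function d f s) p \<partial>?M)) (1 / p)"
      unfolding Lp_norm_def using assms(5) by (intro ennpow_mono) auto
    also have "\<dots> = ennreal C * Lp_norm ?M p (square_function d f)"
      unfolding Lp_norm_def
    proof (rule ennpow_mult_inverse_exponent)
      \<comment> \<open>Finiteness of the right-hand norm enters here: the constant is pulled out of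
        the p-th root by real arithmetic.\<close>
      show "(\<integral>\<^sup>+s. ennpow (square_function d f s) p \<partial>?M) < \<infinity>"
        using fin by (auto simp: Lp_norm_def ennpow_def less_top split: if_splits)
    qed (use C assms in auto)
    finally show ?thesis .
  qed
  with C show ?thesis by blast
qed

end
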